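(* Let $\mathfrak A_0\xrightarrow{\alpha_0}\mathfrak A_1\xrightarrow{\alpha_1}\mathfrak A_2\xrightarrow{\alpha_2}\cdots$ be an inductive sequence of unital C*-algebras whose connecting maps are unital *-monomorphisms, such that: - for each $n\in\mathbb N$, $\mathsf L_n$ is an $F_n$-Leibniz Lip-norm on $\mathfrak{sa}(\mathfrak A_n)$ (for some $F_n$); - for each $n\in\mathbb N\setminus\{0\}$, there is a conditional expectation $\mathbb E_n$ from $\mathfrak A_n$ onto $\alpha_{n-1}(\mathfrak A_{n-1})$ such that $\mathsf L_n\circ\mathbb E_n\le\mathsf L_n$; - for each $n\in\mathbb N\setminus\{0\}$, there are $c_n,d_n>0$ with $c_n\mathsf L_{n-1}\le\mathsf L_n\circ\alpha_{n-1}\le d_n\mathsf L_{n-1}$. Set $\mathsf S_0=\mathsf L_0$ and, for all $n\in\mathbb N\setminus\{0\}$ and $a\in\mathfrak{sa}(\mathfrak A_n)$, $$\mathsf S_n(a)=\max\left\{\varkappa_n\mathsf L_n(a),\ \mathsf S_{n-1}\circ\alpha_{n-1}^{-1}\circ\mathbb E_n(a),\ 2^n\|a-\mathbb E_n(a)\|_{\mathfrak A_n}\right\},\qquad \varkappa_n=\prod_{j=1}^n\frac1{d_j}.$$ Then for all $n\in\mathbb N$, $$\mathsf\Lambda^*((\mathfrak A_n,\mathsf S_n),(\mathfrak A_{n+1},\mathsf S_{n+1}))\le\frac1{2^{n+1}}.$$ Consequently, there exists a quantum metric order unit space $(O,\mathsf L)$ such that $\lim_{n\to\infty}\mathrm{dist}_q((\mathfrak{sa}(\mathfrak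 A_n),\mathsf S_n),(O,\mathsf L))=0$.
   Context: **Order unit spaces and $\mathrm{dist}_q$.** An order unit space $\mathfrak A$ is an ordered real vector space with a distinguished $1_{\mathfrak A}$ such that for each $a$ there is $\lambda>0$ with $-\lambda 1_{\mathfrak A}\le a\le\lambda 1_{\mathfrak A}$, and which is Archimedean ($a\le\lambda 1_{\mathfrak A}$ for all $\lambda>0$ implies $a\le 0$). Its norm is $\|a\|=\inf\{\lambda>0:-\lambda 1_{\mathfrak A}\le a\le\lambda 1_{\mathfrak A}\}$. Its state space $\mathscr S(\mathfrak A)$ is the set of positive linear functionals $\mathfrak A\to\mathbb R$ taking value $1$ at $1_{\mathfrak A}$. The self-adjoint part $\mathfrak{sa}(\mathfrak A)$ of a unital C*-algebra is a complete order unit space. A quantum metric order unit space $(\mathfrak A,\mathsf L)$ is a norm-complete order unit space with a seminorm $\mathsf L$ (a Lip-norm) defined on a norm-dense subspace $\mathrm{dom}(\mathsf L)$ (convention: $\mathsf L=\infty$ outside) such that: (1) $\{a:\mathsf L(a)=0\}=\mathbb R1_{\mathfrak A}$; (2) $\mathsf{mk}_{\mathsf L}(\varphi,\psi)=\sup\{|\varphi(a)-\psi(a)|:\mathsf L(a)\le 1\}$ is a metric inducing the weak* topology on $\mathscr S(\mathfrak A)$; (3) $\{a:\mathsf L(a)\le 1\}$ is norm-closed. For two such spaces $(\mathfrak A_1,\mathsf L_1),(\mathfrak A_2,\mathsf L_2)$, a Lip-norm $\mathsf L$ on $\mathfrak A_1\oplus\mathfrak A_2$ (coordinatewise order, unit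 $(1,1)$) is admissible if its quotient seminorm on $\mathfrak A_j$ (infimum of $\mathsf L$ over the other coordinate) is $\mathsf L_j$ for $j=1,2$. Rieffel's distance $\mathrm{dist}_q((\mathfrak A_1,\mathsf L_1),(\mathfrak A_2,\mathsf L_2))$ is the infimum over admissible $\mathsf L$ of the Hausdorff distance, for $\mathsf{mk}_{\mathsf L}$, between $\mathscr S(\mathfrak A_1)$ and $\mathscr S(\mathfrak A_2)$, both viewed in $\mathscr S(\mathfrak A_1\oplus\mathfrak A_2)$ via the coordinate projections. **Quantum compact metric spaces and propinquity.** Let $F:[0,\infty)^4\to[0,\infty)$ be increasing in the product order. An $F$-Leibniz quantum compact metric space is a pair $(\mathfrak A,\mathsf L)$ of a unital C*-algebra and a seminorm on a dense domain of $\mathfrak{sa}(\mathfrak A)$ such that $(\mathfrak{sa}(\mathfrak A),\mathsf L)$ is a quantum metric order unit space and $\max\{\mathsf L(\frac{ab+ba}2),\mathsf L(\frac{ab-ba}{2i})\}\le F(\|a\|,\|b\|,\mathsf L(a),\mathsf L(b))$ for all $a,b$ in the domain of $\mathsf L$; then $\mathsf L$ is an $F$-Leibniz Lip-norm. An $F$-Leibniz tunnel from $(\mathfrak A_1,\mathsf L_1)$ to $(\mathfrak A_2,\mathsf L_2)$ is $\tau=(\mathfrak D,\mathsf L_{\mathfrak D},\pi_1,\pi_2)$ with $(\mathfrak D,\mathsf L_{\mathfrak D})$ an $F$-Leibniz quantum compact metric space and $\pi_j:\mathfrak D\to\mathfrak A_j$ unital surjective *-morphisms with $\mathsf L_j(a)=\inf\{\mathsf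 L_{\mathfrak D}(d):d\in\mathfrak{sa}(\mathfrak D),\pi_j(d)=a\}$. Its extent is $\chi(\tau)=\max_j\mathrm{Haus}_{\mathsf{mk}_{\mathsf L_{\mathfrak D}}}(\mathscr S(\mathfrak D),\{\varphi\circ\pi_j:\varphi\in\mathscr S(\mathfrak A_j)\})$. The propinquity $\mathsf\Lambda^*$ is the infimum of extents of tunnels that are $F$-Leibniz for some $F$ ($F$ not fixed). The map $\alpha_{n-1}^{-1}$ is the inverse of $\alpha_{n-1}$ on its range. *)

theory Defs
  imports "HOL-Analysis.Analysis" "HOL-Algebra.Algebraic_Closure_Type"
begin

text \<open>
  Order unit spaces and C*-algebras are modules, in the sense of HOL-Algebra, over the real and the
  complex numbers.  They live on explicit carriers, so that a sequence of them can be indexed by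
  the natural numbers: all terms of the sequence share one element type, which is no restriction
  since countably many structures can be placed on disjoint parts of a sufficiently large type.

  Lip-norms take values in \<^typ>\<open>ennreal\<close>, with value \<open>\<infinity>\<close> outside of their domain.  Their values
  outside of the carrier are never used.
\<close>

definition norm_dist :: "('a, 'm) ring_scheme \<Rightarrow> ('a \<Rightarrow> real) \<Rightarrow> 'a \<Rightarrow> 'a \<Rightarrow> real" where
  "norm_dist V N x y =
     (if x \<in> carrier V \<and> y \<in> carrier V then N (x \<ominus>\<^bsub>V\<^esub> y) else 0)"

definition haus :: "('x \<Rightarrow> 'x \<Rightarrow> ennreal) \<Rightarrow> 'x set \<Rightarrow> 'x set \<Rightarrow> ennreal" where
  "haus d U W = max (SUP x\<in>U. INF y\<in>W. d x y) (SUP y\<in>W. INF x\<in>U. d x y)"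


section \<open>Order unit spaces\<close>

text \<open>The order unit is the field \<^const>\<open>one\<close> of the underlying record; the field
  \<^const>\<open>monoid.mult\<close> plays no role for order unit spaces.\<close>

record 'a ous = "(real, 'a) module" +
  leq :: "'a \<Rightarrow> 'a \<Rightarrow> bool"

locale order_unit_space =
  fixes V :: "'a ous" (structure)
  assumes is_module: "Module.module (ring_of_type_algebra :: real ring) V"
    and unit_closed: "\<one> \<in> carrier V"
    and leq_refl: "a \<in> carrier V \<Longrightarrow> leq V a a"
    and leq_trans: "\<lbrakk>a \<in> carrier V; b \<in> carrier V; c \<in> carrier V; leq V a b; leq V b c\<rbrakk>
           \<Longrightarrow> leq V a c"
    and leq_antisym: "\<lbrakk>a \<in> carrier V; b \<in> carrier V; leq V a b; leq V b a\<rbrakk> \<Longrightarrow> a = b"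
    and leq_add: "\<lbrakk>a \<in> carrier V; b \<in> carrier V; c \<in> carrier V; leq V a b\<rbrakk>
           \<Longrightarrow> leq V (a \<oplus> c) (b \<oplus> c)"
    and leq_smult: "\<lbrakk>a \<in> carrier V; b \<in> carrier V; leq V a b; 0 \<le> r\<rbrakk>
           \<Longrightarrow> leq V (r \<odot> a) (r \<odot> b)"
    and order_unit: "a \<in> carrier V \<Longrightarrow>
           \<exists>r>0. leq V ((- r) \<odot> \<one>) a \<and> leq V a (r \<odot> \<one>)"
    and archimedean: "\<lbrakk>a \<in> carrier V; \<And>r. r > 0 \<Longrightarrow> leq V a (r \<odot> \<one>)\<rbrakk> \<Longrightarrow> leq V a \<zero>"

definition ou_norm :: "'a ous \<Rightarrow> 'a \<Rightarrow> real" where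
  "ou_norm V a =
     Inf {r. r > 0 \<and> leq V ((- r) \<odot>\<^bsub>V\<^esub> \<one>\<^bsub>V\<^esub>) a \<and> leq V a (r \<odot>\<^bsub>V\<^esub> \<one>\<^bsub>V\<^esub>)}"

abbreviation ou_dist :: "'a ous \<Rightarrow> 'a \<Rightarrow> 'a \<Rightarrow> real" where
  "ou_dist V \<equiv> norm_dist V (ou_norm V)"

text \<open>Functionals are extensional, that is, \<^const>\<open>undefined\<close> outside of the carrier, so that
  equality of functionals is equality on the carrier.\<close>

definition states :: "'a ous \<Rightarrow> ('a \<Rightarrow> real) set" where
  "states V = {\<phi> \<in> extensional (carrier V).
     (\<forall>a\<in>carrier V. \<forall>b\<in>carrier V. \<phi> (a \<oplus>\<^bsub>V\<^esub> b) = \<phi> a + \<phi> b) \<and>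
     (\<forall>r. \<forall>a\<in>carrier V. \<phi> (r \<odot>\<^bsub>V\<^esub> a) = r * \<phi> a) \<and>
     (\<forall>a\<in>carrier V. leq V \<zero>\<^bsub>V\<^esub> a \<longrightarrow> 0 \<le> \<phi> a) \<and>
     \<phi> \<one>\<^bsub>V\<^esub> = 1}"

definition weak_star :: "'a ous \<Rightarrow> ('a \<Rightarrow> real) topology" where
  "weak_star V = subtopology (product_topology (\<lambda>_. euclideanreal) (carrier V)) (states V)"

definition mk :: "'a ous \<Rightarrow> ('a \<Rightarrow> ennreal) \<Rightarrow> ('a \<Rightarrow> real) \<Rightarrow> ('a \<Rightarrow> real) \<Rightarrow> ennreal" where
  "mk V L \<phi> \<psi> = (SUP a\<in>{a \<in> carrier V. L a \<le> 1}. ennreal \<bar>\<phi> a - \<psi> a\<bar>)"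

definition ou_seminorm :: "'a ous \<Rightarrow> ('a \<Rightarrow> ennreal) \<Rightarrow> bool" where
  "ou_seminorm V L \<longleftrightarrow>
     (\<forall>a\<in>carrier V. \<forall>b\<in>carrier V. L (a \<oplus>\<^bsub>V\<^esub> b) \<le> L a + L b) \<and>
     (\<forall>r. \<forall>a\<in>carrier V. L (r \<odot>\<^bsub>V\<^esub> a) = ennreal \<bar>r\<bar> * L a)"

definition lip_norm :: "'a ous \<Rightarrow> ('a \<Rightarrow> ennreal) \<Rightarrow> bool" where
  "lip_norm V L \<longleftrightarrow>
     ou_seminorm V L \<and>
     Metric_space.mtopology (carrier V) (ou_dist V) closure_of {a \<in> carrier V. L a < \<infinity>} = carrier V \<and>
     {a \<in> carrier V. L a = 0} = range (\<lambda>r. r \<odot>\<^bsub>V\<^esub> \<one>\<^bsub>V\<^esub>) \<and>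
     (\<forall>\<phi>\<in>states V. \<forall>\<psi>\<in>states V. mk V L \<phi> \<psi> < \<infinity>) \<and>
     Metric_space (states V) (\<lambda>\<phi> \<psi>. enn2real (mk V L \<phi> \<psi>)) \<and>
     Metric_space.mtopology (states V) (\<lambda>\<phi> \<psi>. enn2real (mk V L \<phi> \<psi>)) = weak_star V \<and>
     closedin (Metric_space.mtopology (carrier V) (ou_dist V)) {a \<in> carrier V. L a \<le> 1}"

definition quantum_metric_ous :: "'a ous \<Rightarrow> ('a \<Rightarrow> ennreal) \<Rightarrow> bool" where
  "quantum_metric_ous V L \<longleftrightarrow>
     order_unit_space V \<and> Metric_space.mcomplete (carrier V) (ou_dist V) \<and> lip_norm V L"


subsection \<open>Rieffel's distance\<close>

definition ous_sum :: "'a ous \<Rightarrow> 'b ous \<Rightarrow> ('a \<times> 'b) ous" where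
  "ous_sum V W = \<lparr>
     carrier = carrier V \<times> carrier W,
     monoid.mult = (\<lambda>(a, b) (a', b'). (a \<otimes>\<^bsub>V\<^esub> a', b \<otimes>\<^bsub>W\<^esub> b')),
     one = (\<one>\<^bsub>V\<^esub>, \<one>\<^bsub>W\<^esub>),
     zero = (\<zero>\<^bsub>V\<^esub>, \<zero>\<^bsub>W\<^esub>),
     add = (\<lambda>(a, b) (a', b'). (a \<oplus>\<^bsub>V\<^esub> a', b \<oplus>\<^bsub>W\<^esub> b')),
     smult = (\<lambda>r (a, b). (r \<odot>\<^bsub>V\<^esub> a, r \<odot>\<^bsub>W\<^esub> b)),
     leq = (\<lambda>(a, b) (a', b'). leq V a a' \<and> leq W b b') \<rparr>"

definition admissible ::
  "'a ous \<Rightarrow> ('a \<Rightarrow> ennreal) \<Rightarrow> 'b ous \<Rightarrow> ('b \<Rightarrow> ennreal) \<Rightarrow> ('a \<times> 'b \<Rightarrow> ennreal) \<Rightarrow> bool" where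
  "admissible V L\<^sub>V W L\<^sub>W L \<longleftrightarrow>
     quantum_metric_ous (ous_sum V W) L \<and>
     (\<forall>a\<in>carrier V. L\<^sub>V a = (INF b\<in>carrier W. L (a, b))) \<and>
     (\<forall>b\<in>carrier W. L\<^sub>W b = (INF a\<in>carrier V. L (a, b)))"

definition dist_q ::
  "'a ous \<Rightarrow> ('a \<Rightarrow> ennreal) \<Rightarrow> 'b ous \<Rightarrow> ('b \<Rightarrow> ennreal) \<Rightarrow> ennreal" where
  "dist_q V L\<^sub>V W L\<^sub>W =
     (INF L\<in>{L. admissible V L\<^sub>V W L\<^sub>W L}.
        haus (mk (ous_sum V W) L)
          ((\<lambda>\<phi>. compose (carrier (ous_sum V W)) \<phi> fst) ` states V)
          ((\<lambda>\<psi>. compose (carrier (ous_sum V W)) \<psi> snd) ` states W))"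


section \<open>Unital C*-algebras\<close>

record 'a cstar = "(complex, 'a) module" +
  star :: "'a \<Rightarrow> 'a"
  cnorm :: "'a \<Rightarrow> real"

locale unital_cstar_algebra =
  fixes A :: "'a cstar" (structure)
  assumes is_ring: "Ring.ring A"
    and is_module: "Module.module (ring_of_type_algebra :: complex ring) A"
    and smult_mult_left: "\<lbrakk>x \<in> carrier A; y \<in> carrier A\<rbrakk> \<Longrightarrow> (c \<odot> x) \<otimes> y = c \<odot> (x \<otimes> y)"
    and smult_mult_right: "\<lbrakk>x \<in> carrier A; y \<in> carrier A\<rbrakk> \<Longrightarrow> x \<otimes> (c \<odot> y) = c \<odot> (x \<otimes> y)"
    and star_closed: "x \<in> carrier A \<Longrightarrow> star A x \<in> carrier A"
    and star_star: "x \<in> carrier A \<Longrightarrow> star A (star A x) = x"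
    and star_add: "\<lbrakk>x \<in> carrier A; y \<in> carrier A\<rbrakk> \<Longrightarrow> star A (x \<oplus> y) = star A x \<oplus> star A y"
    and star_smult: "x \<in> carrier A \<Longrightarrow> star A (c \<odot> x) = cnj c \<odot> star A x"
    and star_mult: "\<lbrakk>x \<in> carrier A; y \<in> carrier A\<rbrakk> \<Longrightarrow> star A (x \<otimes> y) = star A y \<otimes> star A x"
    and cnorm_nonneg: "x \<in> carrier A \<Longrightarrow> 0 \<le> cnorm A x"
    and cnorm_eq_zero: "x \<in> carrier A \<Longrightarrow> cnorm A x = 0 \<longleftrightarrow> x = \<zero>"
    and cnorm_add: "\<lbrakk>x \<in> carrier A; y \<in> carrier A\<rbrakk> \<Longrightarrow> cnorm A (x \<oplus> y) \<le> cnorm A x + cnorm A y"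
    and cnorm_smult: "x \<in> carrier A \<Longrightarrow> cnorm A (c \<odot> x) = cmod c * cnorm A x"
    and cnorm_mult: "\<lbrakk>x \<in> carrier A; y \<in> carrier A\<rbrakk> \<Longrightarrow> cnorm A (x \<otimes> y) \<le> cnorm A x * cnorm A y"
    and cstar_identity: "x \<in> carrier A \<Longrightarrow> cnorm A (star A x \<otimes> x) = (cnorm A x)\<^sup>2"
    and complete: "Metric_space.mcomplete (carrier A) (norm_dist A (cnorm A))"

definition cstar_positive :: "'a cstar \<Rightarrow> 'a \<Rightarrow> bool" where
  "cstar_positive A a \<longleftrightarrow> (\<exists>b\<in>carrier A. a = star A b \<otimes>\<^bsub>A\<^esub> b)"

definition sa :: "'a cstar \<Rightarrow> 'a ous" where
  "sa A = \<lparr>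
     carrier = {a \<in> carrier A. star A a = a},
     monoid.mult = monoid.mult A,
     one = \<one>\<^bsub>A\<^esub>,
     zero = \<zero>\<^bsub>A\<^esub>,
     add = add A,
     smult = (\<lambda>r a. complex_of_real r \<odot>\<^bsub>A\<^esub> a),
     leq = (\<lambda>a b. cstar_positive A (b \<ominus>\<^bsub>A\<^esub> a)) \<rparr>"

definition unital_star_hom :: "'a cstar \<Rightarrow> 'b cstar \<Rightarrow> ('a \<Rightarrow> 'b) \<Rightarrow> bool" where
  "unital_star_hom A B h \<longleftrightarrow>
     h \<in> ring_hom A B \<and>
     (\<forall>c. \<forall>x\<in>carrier A. h (c \<odot>\<^bsub>A\<^esub> x) = c \<odot>\<^bsub>B\<^esub> h x) \<and>
     (\<forall>x\<in>carrier A. h (star A x) = star B (h x))"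

text \<open>Here \<open>B\<close> is the underlying set of a unital C*-subalgebra of \<open>A\<close>.\<close>

definition conditional_expectation :: "'a cstar \<Rightarrow> 'a set \<Rightarrow> ('a \<Rightarrow> 'a) \<Rightarrow> bool" where
  "conditional_expectation A B E \<longleftrightarrow>
     E \<in> carrier A \<rightarrow> B \<and>
     (\<forall>x\<in>carrier A. \<forall>y\<in>carrier A. E (x \<oplus>\<^bsub>A\<^esub> y) = E x \<oplus>\<^bsub>A\<^esub> E y) \<and>
     (\<forall>c. \<forall>x\<in>carrier A. E (c \<odot>\<^bsub>A\<^esub> x) = c \<odot>\<^bsub>A\<^esub> E x) \<and>
     (\<forall>b\<in>B. E b = b) \<and>
     (\<forall>x\<in>carrier A. cstar_positive A x \<longrightarrow> cstar_positive A (E x)) \<and>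
     (\<forall>x\<in>carrier A. cnorm A (E x) \<le> cnorm A x) \<and>
     (\<forall>b\<in>B. \<forall>c\<in>B. \<forall>x\<in>carrier A.
        E (b \<otimes>\<^bsub>A\<^esub> x \<otimes>\<^bsub>A\<^esub> c) = b \<otimes>\<^bsub>A\<^esub> E x \<otimes>\<^bsub>A\<^esub> c)"


section \<open>Leibniz quantum compact metric spaces and the propinquity\<close>

definition leibniz_function :: "(real \<Rightarrow> real \<Rightarrow> real \<Rightarrow> real \<Rightarrow> real) \<Rightarrow> bool" where
  "leibniz_function F \<longleftrightarrow>
     (\<forall>x\<ge>0. \<forall>y\<ge>0. \<forall>z\<ge>0. \<forall>w\<ge>0. 0 \<le> F x y z w) \<and>
     (\<forall>x\<ge>0. \<forall>y\<ge>0. \<forall>z\<ge>0. \<forall>w\<ge>0. \<forall>x'\<ge>x. \<forall>y'\<ge>y. \<forall>z'\<ge>z. \<forall>w'\<ge>w. F x y z w \<le> F x' y' z' w')"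

definition leibniz_qcms ::
  "(real \<Rightarrow> real \<Rightarrow> real \<Rightarrow> real \<Rightarrow> real) \<Rightarrow> 'a cstar \<Rightarrow> ('a \<Rightarrow> ennreal) \<Rightarrow> bool" where
  "leibniz_qcms F A L \<longleftrightarrow>
     leibniz_function F \<and> unital_cstar_algebra A \<and> quantum_metric_ous (sa A) L \<and>
     (\<forall>a\<in>carrier (sa A). \<forall>b\<in>carrier (sa A). L a < \<infinity> \<longrightarrow> L b < \<infinity> \<longrightarrow>
        max (L ((1 / 2) \<odot>\<^bsub>A\<^esub> (a \<otimes>\<^bsub>A\<^esub> b \<oplus>\<^bsub>A\<^esub> b \<otimes>\<^bsub>A\<^esub> a)))
            (L ((1 / (2 * \<i>)) \<odot>\<^bsub>A\<^esub> (a \<otimes>\<^bsub>A\<^esub> b \<ominus>\<^bsub>A\<^esub> b \<otimes>\<^bsub>A\<^esub> a)))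
        \<le> ennreal (F (cnorm A a) (cnorm A b) (enn2real (L a)) (enn2real (L b))))"

definition is_tunnel ::
  "(real \<Rightarrow> real \<Rightarrow> real \<Rightarrow> real \<Rightarrow> real) \<Rightarrow>
   'a cstar \<Rightarrow> ('a \<Rightarrow> ennreal) \<Rightarrow> 'b cstar \<Rightarrow> ('b \<Rightarrow> ennreal) \<Rightarrow>
   'd cstar \<Rightarrow> ('d \<Rightarrow> ennreal) \<Rightarrow> ('d \<Rightarrow> 'a) \<Rightarrow> ('d \<Rightarrow> 'b) \<Rightarrow> bool" where
  "is_tunnel F A L\<^sub>A B L\<^sub>B D L\<^sub>D \<pi>\<^sub>A \<pi>\<^sub>B \<longleftrightarrow>
     leibniz_qcms F D L\<^sub>D \<and>
     unital_star_hom D A \<pi>\<^sub>A \<and> \<pi>\<^sub>A ` carrier D = carrier A \<and>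
     unital_star_hom D B \<pi>\<^sub>B \<and> \<pi>\<^sub>B ` carrier D = carrier B \<and>
     (\<forall>a\<in>carrier (sa A). L\<^sub>A a = (INF d\<in>{d \<in> carrier (sa D). \<pi>\<^sub>A d = a}. L\<^sub>D d)) \<and>
     (\<forall>b\<in>carrier (sa B). L\<^sub>B b = (INF d\<in>{d \<in> carrier (sa D). \<pi>\<^sub>B d = b}. L\<^sub>D d))"

definition extent ::
  "'a cstar \<Rightarrow> 'b cstar \<Rightarrow> 'd cstar \<Rightarrow> ('d \<Rightarrow> ennreal) \<Rightarrow> ('d \<Rightarrow> 'a) \<Rightarrow> ('d \<Rightarrow> 'b) \<Rightarrow> ennreal" where
  "extent A B D L\<^sub>D \<pi>\<^sub>A \<pi>\<^sub>B =
     max (haus (mk (sa D) L\<^sub>D) (states (sa D))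
           ((\<lambda>\<phi>. compose (carrier (sa D)) \<phi> \<pi>\<^sub>A) ` states (sa A)))
         (haus (mk (sa D) L\<^sub>D) (states (sa D))
           ((\<lambda>\<phi>. compose (carrier (sa D)) \<phi> \<pi>\<^sub>B) ` states (sa B)))"

text \<open>
  The C*-algebra \<open>D\<close> of a tunnel ranges over all structures, with arbitrary operations and
  arbitrary carrier, on the type \<^typ>\<open>'a \<times> 'b\<close>.  Up to isomorphism these are all tunnels:
  \<open>D\<close> is separable because its state space is metrisable, so it has at most the cardinality of the
  continuum, which \<^typ>\<open>'a\<close> also has as soon as \<open>A\<close> is not zero.  (The zero algebra is not excluded;
  a tunnel to it has infinite extent unless \<open>D\<close> is zero.)
\<close>

definition propinquity ::
  "'a cstar \<Rightarrow> ('a \<Rightarrow> ennreal) \<Rightarrow> 'b cstar \<Rightarrow> ('b \<Rightarrow> ennreal) \<Rightarrow> ennreal" where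
  "propinquity A L\<^sub>A B L\<^sub>B =
     Inf {extent A B D L\<^sub>D \<pi>\<^sub>A \<pi>\<^sub>B | F (D :: ('a \<times> 'b) cstar) L\<^sub>D \<pi>\<^sub>A \<pi>\<^sub>B.
            is_tunnel F A L\<^sub>A B L\<^sub>B D L\<^sub>D \<pi>\<^sub>A \<pi>\<^sub>B}"


section \<open>The Lip-norms along an inductive sequence\<close>

definition varkappa :: "(nat \<Rightarrow> real) \<Rightarrow> nat \<Rightarrow> real" where
  "varkappa d n = (\<Prod>j = 1..n. 1 / d j)"

primrec ind_lip ::
  "(nat \<Rightarrow> 'a cstar) \<Rightarrow> (nat \<Rightarrow> 'a \<Rightarrow> 'a) \<Rightarrow> (nat \<Rightarrow> 'a \<Rightarrow> ennreal) \<Rightarrow> (nat \<Rightarrow> 'a \<Rightarrow> 'a) \<Rightarrow>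
   (nat \<Rightarrow> real) \<Rightarrow> nat \<Rightarrow> 'a \<Rightarrow> ennreal" where
  "ind_lip A \<alpha> L E d 0 = L 0"
| "ind_lip A \<alpha> L E d (Suc n) =
     (\<lambda>a. Max {ennreal (varkappa d (Suc n)) * L (Suc n) a,
               ind_lip A \<alpha> L E d n (inv_into (carrier (A n)) (\<alpha> n) (E (Suc n) a)),
               ennreal (2 ^ Suc n * cnorm (A (Suc n)) (a \<ominus>\<^bsub>A (Suc n)\<^esub> E (Suc n) a))})"

end

theory Submission
  imports Defs
begin

text \<open>
  All distances come from one mechanism.  Let \<open>V\<close> and \<open>W\<close> be quantum metric order unit spaces and
  \<open>j : V \<rightarrow> W\<close>, \<open>p : W \<rightarrow> V\<close> unital positive maps with \<open>p (j a) = a\<close> that do not increase Lip-norms,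
  such that \<open>\<parallel>b - j (p b)\<parallel> \<le> \<epsilon> L\<^sub>W b\<close>.  Then
  \<open>L (a, b) = max (L\<^sub>V a, L\<^sub>W b, \<parallel>b - j a\<parallel> / \<epsilon>)\<close> is a Lip-norm on \<open>V \<oplus> W\<close>.  Its quotients are \<open>L\<^sub>V\<close> and
  \<open>L\<^sub>W\<close>, because \<open>a\<close> lifts to \<open>(a, j a)\<close> and \<open>b\<close> lifts to \<open>(p b, b)\<close> without any increase.  On the unit
  ball of \<open>L\<close>, the element \<open>(a, b)\<close> is within \<open>\<epsilon>\<close> of \<open>(a, j a)\<close> and of \<open>(p b, b)\<close>; hence a state \<open>\<phi>\<close> of the
  sum is within \<open>\<epsilon>\<close> of the state \<open>\<phi> (a, j a)\<close> of \<open>V\<close> and of the state \<open>\<phi> (p b, b)\<close> of \<open>W\<close>.  This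
  bounds both the extent of a tunnel and Rieffel's distance by \<open>\<epsilon>\<close> (\<open>haus_left\<close>, \<open>haus_right\<close>,
  \<open>dist_q_le\<close>).

  The Lip-norms \<open>S\<^sub>n\<close> are made so that \<open>j = \<alpha>\<^sub>n\<close> and \<open>p = \<alpha>\<^sub>n\<^sup>-\<^sup>1 \<circ> E\<^sub>n\<^sub>+\<^sub>1\<close> satisfy this with
  \<open>\<epsilon> = 1 / 2\<^sup>n\<^sup>+\<^sup>1\<close>: the second and the third term of the maximum are the conditions on \<open>p\<close>, and the
  factor of \<open>L\<^sub>n\<^sub>+\<^sub>1\<close> compensates for the Lipschitz constants of the \<open>\<alpha>\<^sub>k\<close>.  The limit space consists of
  the sequences \<open>x\<close> with \<open>x\<^sub>n = p\<^sub>n (x\<^sub>n\<^sub>+\<^sub>1)\<close> that lie in the norm closure of the union of the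
  self-adjoint parts, with Lip-norm \<open>sup\<^sub>n S\<^sub>n (x\<^sub>n)\<close>.  Taking the \<open>n\<close>-th coordinate retracts it onto the
  \<open>n\<close>-th space, with \<open>\<epsilon> = \<Sum>\<^sub>k\<^sub>>\<^sub>n 1 / 2\<^sup>k = 1 / 2\<^sup>n\<close>, so the same bound yields convergence.

  A seminorm with dense domain metrises the weak* topology as soon as the associated distance is
  finite and weak* continuous at every state (\<open>lip_normI\<close>).  For all Lip-norms that are constructed here, this
  continuity is pulled back from given Lip-norms along weak* continuous maps between state spaces.

  Three facts about a C*-algebra enter: the C*-norm of a self-adjoint element is its order unit norm,
  an injective *-homomorphism reflects positivity (so that \<open>p\<close> is positive), and a conditional
  expectation preserves self-adjointness.  The first two rest on square roots: \<open>\<surd>(1 - x)\<close> is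
  obtained by iteration, \<open>\<bar>h\<bar>\<close> by applying it twice, and \<open>\<bar>k\<bar> = k\<close> whenever \<open>k = b\<^sup>* b\<close>.

  The Leibniz inequality for \<open>S\<^sub>n\<close> follows from a two-sided comparison, \<open>\<kappa>\<^sub>n L\<^sub>n \<le> S\<^sub>n \<le> K (L\<^sub>n + \<parallel>\<cdot>\<parallel>)\<close>,
  together with the Leibniz inequality for \<open>L\<^sub>n\<close> and submultiplicativity of the norm.
\<close>

section \<open>Order unit spaces and their norms\<close>

lemma ring_of_type_algebra_simps [simp]:
  "carrier (ring_of_type_algebra :: 'k::comm_ring_1 ring) = UNIV"
  "x \<otimes>\<^bsub>(ring_of_type_algebra :: 'k ring)\<^esub> y = x * y"
  "x \<oplus>\<^bsub>(ring_of_type_algebra :: 'k ring)\<^esub> y = x + y"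
  "\<one>\<^bsub>(ring_of_type_algebra :: 'k ring)\<^esub> = 1"
  "\<zero>\<^bsub>(ring_of_type_algebra :: 'k ring)\<^esub> = 0"
  by (simp_all add: ring_of_type_algebra_def)

abbreviation norm_diff :: "'a ous \<Rightarrow> 'a \<Rightarrow> 'a \<Rightarrow> real" where
  "norm_diff V a b \<equiv> ou_norm V (a \<ominus>\<^bsub>V\<^esub> b)"

lemma norm_dist_simp [simp]:
  "x \<in> carrier V \<Longrightarrow> y \<in> carrier V \<Longrightarrow> norm_dist V N x y = N (x \<ominus>\<^bsub>V\<^esub> y)"
  by (simp add: norm_dist_def)

lemma closedin_norm_dist_iff:
  assumes "Metric_space (carrier V) (norm_dist V N)"
  shows "closedin (Metric_space.mtopology (carrier V) (norm_dist V N)) C \<longleftrightarrow>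
    C \<subseteq> carrier V \<and>
    (\<forall>x\<in>carrier V. (\<forall>e>0. \<exists>y\<in>C. N (x \<ominus>\<^bsub>V\<^esub> y) < e) \<longrightarrow> x \<in> C)"
    (is "?A \<longleftrightarrow> ?B")
proof -
  interpret Metric_space "carrier V" "norm_dist V N" by (rule assms)
  have ball: "y \<in> mball x e \<longleftrightarrow> x \<in> carrier V \<and> y \<in> carrier V \<and> N (x \<ominus>\<^bsub>V\<^esub> y) < e" for x y e
    by (auto simp: in_mball)
  have "?A \<longleftrightarrow> C \<subseteq> carrier V \<and> mtopology closure_of C \<subseteq> C"
    using closure_of_subset_eq[of C mtopology] by auto
  also have "\<dots> \<longleftrightarrow> ?B"
    unfolding metric_closure_of ball by blast
  finally show ?thesis .
qed

lemma dense_norm_dist_iff: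
  assumes "Metric_space (carrier V) (norm_dist V N)" and "D \<subseteq> carrier V"
  shows "Metric_space.mtopology (carrier V) (norm_dist V N) closure_of D = carrier V \<longleftrightarrow>
    (\<forall>x\<in>carrier V. \<forall>e>0. \<exists>y\<in>D. N (x \<ominus>\<^bsub>V\<^esub> y) < e)"
proof -
  interpret Metric_space "carrier V" "norm_dist V N" by (rule assms)
  have ball: "y \<in> mball x e \<longleftrightarrow> x \<in> carrier V \<and> y \<in> carrier V \<and> N (x \<ominus>\<^bsub>V\<^esub> y) < e" for x y e
    by (auto simp: in_mball)
  show ?thesis
    unfolding metric_closure_of ball using assms(2) by blast
qed

lemma mcomplete_norm_dist_iff:
  assumes "Metric_space (carrier V) (norm_dist V N)"
  shows "Metric_space.mcomplete (carrier V) (norm_dist V N) \<longleftrightarrow>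
    (\<forall>s :: nat \<Rightarrow> _. (\<forall>n. s n \<in> carrier V) \<longrightarrow>
         (\<forall>e>0. \<exists>M. \<forall>m\<ge>M. \<forall>n\<ge>M. N (s m \<ominus>\<^bsub>V\<^esub> s n) < e) \<longrightarrow>
         (\<exists>x\<in>carrier V. \<forall>e>0. \<exists>M. \<forall>n\<ge>M. N (s n \<ominus>\<^bsub>V\<^esub> x) < e))"
proof -
  interpret Metric_space "carrier V" "norm_dist V N" by (rule assms)
  have c: "MCauchy s \<longleftrightarrow> (\<forall>n. s n \<in> carrier V) \<and>
         (\<forall>e>0. \<exists>M. \<forall>m\<ge>M. \<forall>n\<ge>M. N (s m \<ominus>\<^bsub>V\<^esub> s n) < e)" for s
    unfolding MCauchy_def by (simp add: image_subset_iff) (metis norm_dist_simp)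
  have l: "limitin mtopology s x sequentially \<longleftrightarrow>
         x \<in> carrier V \<and> (\<forall>e>0. \<exists>M. \<forall>n\<ge>M. N (s n \<ominus>\<^bsub>V\<^esub> x) < e)"
    if "\<forall>n. s n \<in> carrier V" for s x
    unfolding limitin_metric eventually_sequentially using that by auto
  show ?thesis
    unfolding mcomplete_def c by (simp add: l imp_conjL Bex_def cong: imp_cong)
qed

context order_unit_space
begin

sublocale abelian_group V
  using is_module by (rule Module.module.axioms)

lemma minus_zero [simp]: "\<ominus> \<zero> = \<zero>"
  by (simp add: minus_equality)

lemma smult_closed [simp, intro]: "a \<in> carrier V \<Longrightarrow> r \<odot> a \<in> carrier V"
  using module.smult_closed[OF is_module] by simp

lemma smult_add_left: "a \<in> carrier V \<Longrightarrow> (r + s) \<odot> a = r \<odot> a \<oplus> s \<odot> a"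
  using module.smult_l_distr[OF is_module, of r s a] by simp

lemma smult_add_right:
  "a \<in> carrier V \<Longrightarrow> b \<in> carrier V \<Longrightarrow> r \<odot> (a \<oplus> b) = r \<odot> a \<oplus> r \<odot> b"
  using module.smult_r_distr[OF is_module, of r a b] by simp

lemma smult_smult: "a \<in> carrier V \<Longrightarrow> r \<odot> (s \<odot> a) = (r * s) \<odot> a"
  using module.smult_assoc1[OF is_module, of r s a] by simp

lemma smult_1 [simp]: "a \<in> carrier V \<Longrightarrow> 1 \<odot> a = a"
  using module.smult_one[OF is_module, of a] by simp

lemma smult_0 [simp]: "a \<in> carrier V \<Longrightarrow> 0 \<odot> a = \<zero>"
  using module.smult_l_null[OF is_module, of a] by simp

lemma smult_zero_right [simp]: "r \<odot> \<zero> = \<zero>"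
  using module.smult_r_null[OF is_module, of r] by simp

lemma smult_minus_left: "a \<in> carrier V \<Longrightarrow> (- r) \<odot> a = \<ominus> (r \<odot> a)"
  using smult_add_left[of a "- r" r] by (simp add: minus_equality)

lemma smult_minus_right: "a \<in> carrier V \<Longrightarrow> r \<odot> (\<ominus> a) = \<ominus> (r \<odot> a)"
  using module.smult_r_minus[OF is_module, of r a] by simp

lemma smult_diff_right:
  "a \<in> carrier V \<Longrightarrow> b \<in> carrier V \<Longrightarrow> r \<odot> (a \<ominus> b) = r \<odot> a \<ominus> r \<odot> b"
  by (simp add: minus_eq smult_add_right smult_minus_right)

lemmas unit_closed' [simp, intro] = unit_closed

lemma diff_eq_zero_iff: "a \<in> carrier V \<Longrightarrow> b \<in> carrier V \<Longrightarrow> a \<ominus> b = \<zero> \<longleftrightarrow> a = b"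
  by (metis add.inv_closed add.inv_comm minus_eq minus_equality minus_minus r_neg)

lemma diff_self [simp]: "a \<in> carrier V \<Longrightarrow> a \<ominus> a = \<zero>"
  by (simp add: diff_eq_zero_iff)

lemma leq_add2:
  assumes "a \<in> carrier V" "b \<in> carrier V" "c \<in> carrier V" "d \<in> carrier V" "leq V a b" "leq V c d"
  shows "leq V (a \<oplus> c) (b \<oplus> d)"
  using assms leq_add[of a b c] leq_add[of c d b] leq_trans[of "a \<oplus> c" "b \<oplus> c" "b \<oplus> d"]
  by (simp add: a_comm)

lemma leq_move:
  assumes "a \<in> carrier V" "b \<in> carrier V" "c \<in> carrier V"
  shows "leq V (a \<ominus> b) c \<longleftrightarrow> leq V a (c \<oplus> b)"
proof
  assume "leq V (a \<ominus> b) c"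
  from leq_add[OF _ _ assms(2) this] show "leq V a (c \<oplus> b)"
    using assms by (simp add: minus_eq a_assoc l_neg)
next
  assume "leq V a (c \<oplus> b)"
  from leq_add[OF _ _ _ this, of "\<ominus> b"] show "leq V (a \<ominus> b) c"
    using assms by (simp add: minus_eq a_assoc r_neg)
qed

lemma leq_move_right:
  assumes "a \<in> carrier V" "b \<in> carrier V" "c \<in> carrier V"
  shows "leq V a (b \<ominus> c) \<longleftrightarrow> leq V (a \<oplus> c) b"
  using leq_move[of a "\<ominus> c" b] assms by (simp add: minus_eq)

lemma leq_iff_diff: "a \<in> carrier V \<Longrightarrow> b \<in> carrier V \<Longrightarrow> leq V a b \<longleftrightarrow> leq V \<zero> (b \<ominus> a)"
  by (simp add: leq_move_right)

lemma leq_minus_iff: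
  assumes "a \<in> carrier V" "b \<in> carrier V"
  shows "leq V (\<ominus> a) b \<longleftrightarrow> leq V (\<ominus> b) a"
  using assms leq_move[of \<zero> a b] leq_move_right[of \<zero> a "\<ominus> b"] leq_move[of \<zero> b a]
  by (simp add: minus_eq a_comm)

lemma zero_leq_unit: "leq V \<zero> \<one>"
proof -
  obtain r where r: "r > 0" "leq V \<zero> (r \<odot> \<one>)"
    using order_unit[of \<zero>] by auto
  from leq_smult[OF _ _ r(2), of "1 / r"] r(1) show ?thesis
    by (simp add: smult_smult)
qed

lemma smult_unit_mono: "r \<le> s \<Longrightarrow> leq V (r \<odot> \<one>) (s \<odot> \<one>)"
proof -
  assume "r \<le> s"
  then have "leq V \<zero> ((s - r) \<odot> \<one>)"
    using leq_smult[OF _ _ zero_leq_unit, of "s - r"] by simp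
  then have "leq V (\<zero> \<oplus> r \<odot> \<one>) ((s - r) \<odot> \<one> \<oplus> r \<odot> \<one>)"
    by (intro leq_add) auto
  then show ?thesis
    using smult_add_left[of \<one> "s - r" r] by simp
qed

lemma leq_unit_limit:
  assumes "a \<in> carrier V" and "\<And>s. s > r \<Longrightarrow> leq V a (s \<odot> \<one>)"
  shows "leq V a (r \<odot> \<one>)"
proof -
  have "leq V (a \<ominus> r \<odot> \<one>) \<zero>"
  proof (rule archimedean)
    fix e :: real assume "e > 0"
    then have "leq V a ((e + r) \<odot> \<one>)" by (intro assms) auto
    then show "leq V (a \<ominus> r \<odot> \<one>) (e \<odot> \<one>)"
      using assms(1) by (simp add: leq_move smult_add_left)
  qed (use assms in auto)
  then show ?thesis using assms by (simp add: leq_move)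
qed

lemma leq_neg_unit_iff: "a \<in> carrier V \<Longrightarrow> leq V ((- r) \<odot> \<one>) a \<longleftrightarrow> leq V (\<ominus> a) (r \<odot> \<one>)"
  by (simp add: smult_minus_left leq_minus_iff[of "r \<odot> \<one>" a])

text \<open>
  By the Archimedean axiom the infimum that defines the norm is attained (also when it is \<open>0\<close>).  Every norm
  estimate therefore splits into one order estimate for \<open>a\<close> and one for \<open>- a\<close>.
\<close>

theorem ou_norm_le_iff:
  assumes a: "a \<in> carrier V"
  shows "ou_norm V a \<le> r \<longleftrightarrow> 0 \<le> r \<and> leq V (\<ominus> a) (r \<odot> \<one>) \<and> leq V a (r \<odot> \<one>)"
proof -
  define T where "T = {r. r > 0 \<and> leq V (\<ominus> a) (r \<odot> \<one>) \<and> leq V a (r \<odot> \<one>)}"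
  have N: "ou_norm V a = Inf T"
    using a by (simp add: ou_norm_def T_def leq_neg_unit_iff)
  have ne: "T \<noteq> {}"
    using order_unit[OF a] a by (auto simp: T_def leq_neg_unit_iff)
  have bdd: "bdd_below T"
    by (rule bdd_belowI[of _ 0]) (auto simp: T_def)
  show ?thesis
  proof
    assume le: "ou_norm V a \<le> r"
    have "0 \<le> Inf T"
      by (rule cInf_greatest[OF ne]) (auto simp: T_def)
    moreover have "leq V (\<ominus> a) (s \<odot> \<one>) \<and> leq V a (s \<odot> \<one>)" if "s > r" for s
    proof -
      from that le N have "Inf T < s" by simp
      then obtain t where "t \<in> T" "t < s" using cInf_lessD[OF ne] by auto
      then show ?thesis
        using a leq_trans[OF _ _ _ _ smult_unit_mono[of t s], of a]
          leq_trans[OF _ _ _ _ smult_unit_mono[of t s], of "\<ominus> a"]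
        by (simp add: T_def)
    qed
    ultimately show "0 \<le> r \<and> leq V (\<ominus> a) (r \<odot> \<one>) \<and> leq V a (r \<odot> \<one>)"
      using leq_unit_limit[of a r] leq_unit_limit[of "\<ominus> a" r] a le N by auto
  next
    assume r: "0 \<le> r \<and> leq V (\<ominus> a) (r \<odot> \<one>) \<and> leq V a (r \<odot> \<one>)"
    show "ou_norm V a \<le> r"
    proof (rule field_le_epsilon)
      fix e :: real assume "e > 0"
      then have "r + e \<in> T"
        using r a leq_trans[OF _ _ _ _ smult_unit_mono[of r "r + e"], of a]
          leq_trans[OF _ _ _ _ smult_unit_mono[of r "r + e"], of "\<ominus> a"]
        by (simp add: T_def)
      then show "ou_norm V a \<le> r + e"
        unfolding N by (rule cInf_lower[OF _ bdd])
    qed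
  qed
qed

lemma ou_norm_nonneg: "a \<in> carrier V \<Longrightarrow> 0 \<le> ou_norm V a"
  using ou_norm_le_iff[of a "ou_norm V a"] by simp

lemma leq_ou_norm: "a \<in> carrier V \<Longrightarrow> leq V a (ou_norm V a \<odot> \<one>)"
  using ou_norm_le_iff[of a "ou_norm V a"] by simp

lemma neg_leq_ou_norm: "a \<in> carrier V \<Longrightarrow> leq V (\<ominus> a) (ou_norm V a \<odot> \<one>)"
  using ou_norm_le_iff[of a "ou_norm V a"] by simp

lemma ou_norm_minus [simp]: "a \<in> carrier V \<Longrightarrow> ou_norm V (\<ominus> a) = ou_norm V a"
  using ou_norm_le_iff[of a "ou_norm V (\<ominus> a)"] ou_norm_le_iff[of "\<ominus> a" "ou_norm V a"]
    ou_norm_le_iff[of a "ou_norm V a"] ou_norm_le_iff[of "\<ominus> a" "ou_norm V (\<ominus> a)"]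
  by (auto intro: antisym)

lemma ou_norm_add:
  "a \<in> carrier V \<Longrightarrow> b \<in> carrier V \<Longrightarrow> ou_norm V (a \<oplus> b) \<le> ou_norm V a + ou_norm V b"
  using leq_add2[OF _ _ _ _ leq_ou_norm leq_ou_norm, of a b]
    leq_add2[OF _ _ _ _ neg_leq_ou_norm neg_leq_ou_norm, of a b]
  by (simp add: ou_norm_le_iff ou_norm_nonneg smult_add_left minus_add)

lemma ou_norm_zero [simp]: "ou_norm V \<zero> = 0"
  using ou_norm_le_iff[of \<zero> 0] ou_norm_nonneg[of \<zero>] by (simp add: leq_refl)

lemma ou_norm_eq_zero_iff: "a \<in> carrier V \<Longrightarrow> ou_norm V a = 0 \<longleftrightarrow> a = \<zero>"
proof
  assume a: "a \<in> carrier V" "ou_norm V a = 0"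
  then have "leq V a \<zero>" "leq V (\<ominus> a) \<zero>"
    using leq_ou_norm[of a] neg_leq_ou_norm[of a] by simp_all
  then show "a = \<zero>"
    using a(1) leq_minus_iff[of a \<zero>] by (auto intro!: leq_antisym)
qed simp

lemma ou_norm_smult_le: "a \<in> carrier V \<Longrightarrow> ou_norm V (r \<odot> a) \<le> \<bar>r\<bar> * ou_norm V a"
proof -
  assume a: "a \<in> carrier V"
  have *: "ou_norm V (s \<odot> b) \<le> s * ou_norm V b" if "s \<ge> 0" "b \<in> carrier V" for s b
    using that leq_smult[OF _ _ leq_ou_norm, of b s] leq_smult[OF _ _ neg_leq_ou_norm, of b s]
    by (simp add: ou_norm_le_iff ou_norm_nonneg smult_smult smult_minus_right)
  show ?thesis
  proof (cases "r \<ge> 0")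
    case True then show ?thesis using * a by simp
  next
    case False
    have "r \<odot> a = (- r) \<odot> (\<ominus> a)"
      using a by (simp add: smult_minus_left smult_minus_right)
    then show ?thesis using *[of "- r" "\<ominus> a"] a False by simp
  qed
qed

lemma ou_norm_smult: "a \<in> carrier V \<Longrightarrow> ou_norm V (r \<odot> a) = \<bar>r\<bar> * ou_norm V a"
proof (cases "r = 0")
  case False
  assume a: "a \<in> carrier V"
  have "ou_norm V a = ou_norm V ((1 / r) \<odot> (r \<odot> a))"
    using a False by (simp add: smult_smult)
  also have "\<dots> \<le> \<bar>1 / r\<bar> * ou_norm V (r \<odot> a)"
    using a by (intro ou_norm_smult_le) auto
  finally have "\<bar>r\<bar> * ou_norm V a \<le> ou_norm V (r \<odot> a)"
    using False by (simp add: field_simps)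
  then show ?thesis using ou_norm_smult_le[OF a, of r] by linarith
qed simp

lemma ou_norm_diff_commute:
  "a \<in> carrier V \<Longrightarrow> b \<in> carrier V \<Longrightarrow> norm_diff V a b = norm_diff V b a"
  by (metis minus_closed minus_eq minus_add minus_minus a_comm a_inv_closed ou_norm_minus)

lemma diff_add_diff:
  "a \<in> carrier V \<Longrightarrow> b \<in> carrier V \<Longrightarrow> c \<in> carrier V \<Longrightarrow> (a \<ominus> b) \<oplus> (b \<ominus> c) = a \<ominus> c"
  by (simp add: minus_eq a_assoc r_neg2 a_lcomm[of b] r_neg r_neg1)

lemma ou_norm_diff_triangle:
  "a \<in> carrier V \<Longrightarrow> b \<in> carrier V \<Longrightarrow> c \<in> carrier V \<Longrightarrow>
    norm_diff V a c \<le> norm_diff V a b + norm_diff V b c"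
  using ou_norm_add[of "a \<ominus> b" "b \<ominus> c"] by (simp add: diff_add_diff)

lemma add_diff_add:
  "a \<in> carrier V \<Longrightarrow> b \<in> carrier V \<Longrightarrow> c \<in> carrier V \<Longrightarrow> d \<in> carrier V \<Longrightarrow>
    (a \<oplus> b) \<ominus> (c \<oplus> d) = (a \<ominus> c) \<oplus> (b \<ominus> d)"
  by (simp add: minus_eq minus_add a_ac)

lemma Metric_space_ou_dist: "Metric_space (carrier V) (ou_dist V)"
proof
  fix x y
  show "0 \<le> ou_dist V x y" by (simp add: norm_dist_def ou_norm_nonneg)
  show "ou_dist V x y = ou_dist V y x"
    by (auto simp: norm_dist_def ou_norm_diff_commute)
  show "x \<in> carrier V \<Longrightarrow> y \<in> carrier V \<Longrightarrow> ou_dist V x y = 0 \<longleftrightarrow> x = y"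
    by (simp add: ou_norm_eq_zero_iff diff_eq_zero_iff)
next
  fix x y z
  show "x \<in> carrier V \<Longrightarrow> y \<in> carrier V \<Longrightarrow> z \<in> carrier V \<Longrightarrow>
      ou_dist V x z \<le> ou_dist V x y + ou_dist V y z"
    by (simp add: ou_norm_diff_triangle)
qed

lemmas ou_closedin_iff = closedin_norm_dist_iff[OF Metric_space_ou_dist]
lemmas ou_dense_iff = dense_norm_dist_iff[OF Metric_space_ou_dist]
lemmas ou_mcomplete_iff = mcomplete_norm_dist_iff[OF Metric_space_ou_dist]

end

section \<open>States, morphisms and Lip-norms\<close>

lemma
  assumes "\<phi> \<in> states V"
  shows state_add: "a \<in> carrier V \<Longrightarrow> b \<in> carrier V \<Longrightarrow> \<phi> (a \<oplus>\<^bsub>V\<^esub> b) = \<phi> a + \<phi> b"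
    and state_smult: "a \<in> carrier V \<Longrightarrow> \<phi> (r \<odot>\<^bsub>V\<^esub> a) = r * \<phi> a"
    and state_pos: "a \<in> carrier V \<Longrightarrow> leq V \<zero>\<^bsub>V\<^esub> a \<Longrightarrow> 0 \<le> \<phi> a"
    and state_unit: "\<phi> \<one>\<^bsub>V\<^esub> = 1"
    and state_extensional: "\<phi> \<in> extensional (carrier V)"
  using assms by (auto simp: states_def)

text \<open>
  Unital positive linear maps are norm contractions and pull states back to states.  All comparisons
  between the state spaces of different order unit spaces go through such maps.
\<close>

locale ou_morphism = V: order_unit_space V + W: order_unit_space W
  for V :: "'a ous" and W :: "'b ous" and f :: "'a \<Rightarrow> 'b" +
  assumes closed [simp, intro]: "a \<in> carrier V \<Longrightarrow> f a \<in> carrier W"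
    and add: "a \<in> carrier V \<Longrightarrow> b \<in> carrier V \<Longrightarrow> f (a \<oplus>\<^bsub>V\<^esub> b) = f a \<oplus>\<^bsub>W\<^esub> f b"
    and smult: "a \<in> carrier V \<Longrightarrow> f (r \<odot>\<^bsub>V\<^esub> a) = r \<odot>\<^bsub>W\<^esub> f a"
    and unit: "f \<one>\<^bsub>V\<^esub> = \<one>\<^bsub>W\<^esub>"
    and pos: "a \<in> carrier V \<Longrightarrow> leq V \<zero>\<^bsub>V\<^esub> a \<Longrightarrow> leq W \<zero>\<^bsub>W\<^esub> (f a)"
begin

lemma minus: "a \<in> carrier V \<Longrightarrow> f (\<ominus>\<^bsub>V\<^esub> a) = \<ominus>\<^bsub>W\<^esub> f a"
  using smult[of a "-1"] by (simp add: V.smult_minus_left W.smult_minus_left)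

lemma diff: "a \<in> carrier V \<Longrightarrow> b \<in> carrier V \<Longrightarrow> f (a \<ominus>\<^bsub>V\<^esub> b) = f a \<ominus>\<^bsub>W\<^esub> f b"
  by (simp add: V.minus_eq W.minus_eq add minus)

lemma mono: "a \<in> carrier V \<Longrightarrow> b \<in> carrier V \<Longrightarrow> leq V a b \<Longrightarrow> leq W (f a) (f b)"
  using pos[of "b \<ominus>\<^bsub>V\<^esub> a"] by (simp add: V.leq_iff_diff[of a] W.leq_iff_diff[of "f a"] diff)

lemma norm_le: "a \<in> carrier V \<Longrightarrow> ou_norm W (f a) \<le> ou_norm V a"
  using mono[OF _ _ V.leq_ou_norm, of a] mono[OF _ _ V.neg_leq_ou_norm, of a]
  by (simp add: W.ou_norm_le_iff V.ou_norm_nonneg minus smult unit)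

lemma pullback_state:
  assumes "\<phi> \<in> states W" shows "compose (carrier V) \<phi> f \<in> states V"
  using assms by (auto simp: states_def compose_def add smult unit pos)

end

lemma ou_morphism_id: "order_unit_space V \<Longrightarrow> ou_morphism V V (\<lambda>a. a)"
  by (simp add: ou_morphism_def ou_morphism_axioms_def)

lemma ou_morphism_comp:
  assumes "ou_morphism V W f" "ou_morphism W U g"
  shows "ou_morphism V U (\<lambda>a. g (f a))"
  using assms by (simp add: ou_morphism_def ou_morphism_axioms_def)

context order_unit_space
begin

lemma state_minus: "\<phi> \<in> states V \<Longrightarrow> a \<in> carrier V \<Longrightarrow> \<phi> (\<ominus> a) = - \<phi> a"
  using state_smult[of \<phi> V a "-1"] by (simp add: smult_minus_left)

lemma state_diff:
  "\<phi> \<in> states V \<Longrightarrow> a \<in> carrier V \<Longrightarrow> b \<in> carrier V \<Longrightarrow> \<phi> (a \<ominus> b) = \<phi> a - \<phi> b"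
  by (simp add: minus_eq state_add state_minus)

lemma state_mono:
  "\<phi> \<in> states V \<Longrightarrow> a \<in> carrier V \<Longrightarrow> b \<in> carrier V \<Longrightarrow> leq V a b \<Longrightarrow> \<phi> a \<le> \<phi> b"
  using state_pos[of \<phi> V "b \<ominus> a"] by (simp add: leq_iff_diff[of a] state_diff)

lemma state_le_norm:
  assumes "\<phi> \<in> states V" "a \<in> carrier V" shows "\<bar>\<phi> a\<bar> \<le> ou_norm V a"
  using state_mono[OF assms _ leq_ou_norm] state_mono[OF assms(1) _ _ neg_leq_ou_norm, of a] assms
  by (auto simp: state_smult state_unit state_minus abs_le_iff)

end

lemma topspace_weak_star [simp]: "topspace (weak_star V) = states V"
  by (auto simp: weak_star_def PiE_def states_def)

lemma continuous_map_weak_star_eval: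
  "a \<in> carrier V \<Longrightarrow> continuous_map (weak_star V) euclideanreal (\<lambda>\<phi>. \<phi> a)"
  unfolding weak_star_def
  by (intro continuous_map_from_subtopology continuous_map_product_projection)

lemma continuous_map_into_weak_star:
  assumes "\<And>x. x \<in> topspace Y \<Longrightarrow> T x \<in> states V"
    and "\<And>a. a \<in> carrier V \<Longrightarrow> continuous_map Y euclideanreal (\<lambda>x. T x a)"
  shows "continuous_map Y (weak_star V) T"
  unfolding weak_star_def continuous_map_in_subtopology continuous_map_componentwise
  using assms by (auto simp: states_def)

lemma (in ou_morphism) continuous_map_pullback:
  "continuous_map (weak_star W) (weak_star V) (\<lambda>\<phi>. compose (carrier V) \<phi> f)"
proof (rule continuous_map_into_weak_star)
  fix a assume a: "a \<in> carrier V"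
  then have "continuous_map (weak_star W) euclideanreal (\<lambda>\<phi>. \<phi> (f a))"
    by (intro continuous_map_weak_star_eval) auto
  with a show "continuous_map (weak_star W) euclideanreal (\<lambda>\<phi>. compose (carrier V) \<phi> f a)"
    by (simp add: compose_eq)
qed (simp add: pullback_state)

lemma mk_leI:
  assumes "\<And>a. a \<in> carrier V \<Longrightarrow> L a \<le> 1 \<Longrightarrow> \<bar>\<phi> a - \<psi> a\<bar> \<le> e"
  shows "mk V L \<phi> \<psi> \<le> ennreal e"
  unfolding mk_def using assms by (auto intro!: SUP_least ennreal_leI)

lemma mk_leD:
  assumes "mk V L \<phi> \<psi> \<le> ennreal e" "0 \<le> e" "a \<in> carrier V" "L a \<le> 1"
  shows "\<bar>\<phi> a - \<psi> a\<bar> \<le> e"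
proof -
  have "ennreal \<bar>\<phi> a - \<psi> a\<bar> \<le> mk V L \<phi> \<psi>"
    unfolding mk_def using assms by (intro SUP_upper) auto
  with assms show ?thesis by (auto dest: order_trans)
qed

lemma mk_finiteD:
  assumes "mk V L \<phi> \<psi> < \<infinity>" "a \<in> carrier V" "L a \<le> 1"
  shows "\<bar>\<phi> a - \<psi> a\<bar> \<le> enn2real (mk V L \<phi> \<psi>)"
  using assms by (intro mk_leD[of V L]) auto

lemma mk_commute: "mk V L \<phi> \<psi> = mk V L \<psi> \<phi>"
  by (simp add: mk_def abs_minus_commute)

lemma mk_self [simp]: "mk V L \<phi> \<phi> = 0"
  using mk_leI[of V L \<phi> \<phi> 0] by simp

lemma mk_triangle: "mk V L \<phi> \<rho> \<le> mk V L \<phi> \<psi> + mk V L \<psi> \<rho>"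
  unfolding mk_def[of V L \<phi> \<rho>]
proof (rule SUP_least)
  fix a assume a: "a \<in> {a \<in> carrier V. L a \<le> 1}"
  have "ennreal \<bar>\<phi> a - \<rho> a\<bar> \<le> ennreal \<bar>\<phi> a - \<psi> a\<bar> + ennreal \<bar>\<psi> a - \<rho> a\<bar>"
    by (simp flip: ennreal_plus add: ennreal_leI)
  also have "\<dots> \<le> mk V L \<phi> \<psi> + mk V L \<psi> \<rho>"
    unfolding mk_def using a by (intro add_mono SUP_upper) auto
  finally show "ennreal \<bar>\<phi> a - \<rho> a\<bar> \<le> mk V L \<phi> \<psi> + mk V L \<psi> \<rho>" .
qed

text \<open>
  One of the two inclusions between the \<open>mk\<close> topology and the weak* topology, stated around each state, so
  that it can be transported along weak* continuous maps of state spaces.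
\<close>

definition mk_continuous :: "'a ous \<Rightarrow> ('a \<Rightarrow> ennreal) \<Rightarrow> bool" where
  "mk_continuous V L \<longleftrightarrow> (\<forall>\<phi>\<in>states V. \<forall>e>0. \<exists>U. openin (weak_star V) U \<and> \<phi> \<in> U \<and>
     (\<forall>\<psi>\<in>U. mk V L \<phi> \<psi> \<le> ennreal e))"

lemma lip_norm_imp_mk_continuous:
  assumes "lip_norm V L" shows "mk_continuous V L"
  unfolding mk_continuous_def
proof (intro ballI allI impI)
  fix \<phi> and e :: real assume p: "\<phi> \<in> states V" "e > 0"
  interpret M: Metric_space "states V" "\<lambda>\<phi> \<psi>. enn2real (mk V L \<phi> \<psi>)"
    using assms by (simp add: lip_norm_def)
  have "openin (weak_star V) (M.mball \<phi> e)"
    using assms M.openin_mball[of \<phi> e] by (simp add: lip_norm_def)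
  moreover have "mk V L \<phi> \<psi> \<le> ennreal e" if "\<psi> \<in> M.mball \<phi> e" for \<psi>
  proof -
    have "mk V L \<phi> \<psi> < \<infinity>"
      using that p assms by (simp add: lip_norm_def M.in_mball)
    then have "mk V L \<phi> \<psi> = ennreal (enn2real (mk V L \<phi> \<psi>))" by simp
    also have "\<dots> \<le> ennreal e"
      using that by (intro ennreal_leI) (simp add: M.in_mball)
    finally show ?thesis .
  qed
  ultimately show "\<exists>U. openin (weak_star V) U \<and> \<phi> \<in> U \<and> (\<forall>\<psi>\<in>U. mk V L \<phi> \<psi> \<le> ennreal e)"
    using p by (intro exI[of _ "M.mball \<phi> e"]) auto
qed

lemma mk_continuous_preimage:
  assumes "mk_continuous V L" "continuous_map (weak_star W) (weak_star V) T"
    and "\<phi> \<in> states W" "e > 0"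
  obtains U where "openin (weak_star W) U" "\<phi> \<in> U" "\<And>\<psi>. \<psi> \<in> U \<Longrightarrow> mk V L (T \<phi>) (T \<psi>) \<le> ennreal e"
proof -
  have "T \<phi> \<in> states V"
    using assms(2,3) continuous_map_image_subset_topspace by fastforce
  then obtain U where U: "openin (weak_star V) U" "T \<phi> \<in> U" "\<forall>\<psi>\<in>U. mk V L (T \<phi>) \<psi> \<le> ennreal e"
    using assms(1,4) unfolding mk_continuous_def by meson
  show ?thesis
    by (rule that[of "{x \<in> topspace (weak_star W). T x \<in> U}"])
      (use U assms openin_continuous_map_preimage[OF assms(2) U(1)] in auto)
qed

context order_unit_space
begin

text \<open>
  By density, \<open>a\<close> is close in norm to some \<open>b\<close> of finite Lip-norm, and evaluation at \<open>b\<close> is Lipschitz for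
  \<open>mk\<close>.  Hence \<open>mk\<close> separates states, and its topology is finer than the weak* topology.
\<close>

lemma mk_dominates_eval:
  assumes L: "ou_seminorm V L"
    and dense: "\<And>a e. a \<in> carrier V \<Longrightarrow> e > 0 \<Longrightarrow> \<exists>b\<in>carrier V. L b < \<infinity> \<and> norm_diff V a b < e"
    and a: "a \<in> carrier V" and e: "e > 0"
  obtains k where "k \<ge> 0"
    "\<And>\<phi> \<psi>. \<phi> \<in> states V \<Longrightarrow> \<psi> \<in> states V \<Longrightarrow> mk V L \<phi> \<psi> < \<infinity> \<Longrightarrow>
       \<bar>\<phi> a - \<psi> a\<bar> \<le> e + k * enn2real (mk V L \<phi> \<psi>)"
proof -
  obtain b where b: "b \<in> carrier V" "L b < \<infinity>" "norm_diff V a b < e / 2"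
    using dense[OF a, of "e / 2"] e by auto
  \<comment> \<open>the summand 1 makes \<open>b / k\<close> an element of the unit ball also if \<open>L b = 0\<close>\<close>
  define k where "k = enn2real (L b) + 1"
  have k: "k > 0" by (simp add: k_def add_nonneg_pos)
  have "L ((1 / k) \<odot> b) = ennreal (1 / k) * L b"
    using L b k by (simp add: ou_seminorm_def)
  also have "\<dots> = ennreal (1 / k) * ennreal (enn2real (L b))" using b by simp
  also have "\<dots> = ennreal (enn2real (L b) / k)"
    using k by (simp flip: ennreal_mult')
  also have "\<dots> \<le> 1"
    using k by (auto simp: k_def field_simps simp flip: ennreal_1 intro!: ennreal_leI)
  finally have Lb: "L ((1 / k) \<odot> b) \<le> 1" .
  show ?thesis
  proof (rule that[of k])
    fix \<phi> \<psi> assume s: "\<phi> \<in> states V" "\<psi> \<in> states V" "mk V L \<phi> \<psi> < \<infinity>"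
    have "\<bar>\<phi> ((1 / k) \<odot> b) - \<psi> ((1 / k) \<odot> b)\<bar> \<le> enn2real (mk V L \<phi> \<psi>)"
      using mk_finiteD[OF s(3) _ Lb] b by simp
    moreover have "\<phi> ((1 / k) \<odot> b) - \<psi> ((1 / k) \<odot> b) = (\<phi> b - \<psi> b) / k"
      using s b by (simp add: state_smult diff_divide_distrib)
    ultimately have "\<bar>\<phi> b - \<psi> b\<bar> \<le> k * enn2real (mk V L \<phi> \<psi>)"
      using k by (simp add: field_simps)
    moreover have "\<bar>\<phi> a - \<phi> b\<bar> \<le> e / 2" "\<bar>\<psi> a - \<psi> b\<bar> \<le> e / 2"
      using state_le_norm[of \<phi> "a \<ominus> b"] state_le_norm[of \<psi> "a \<ominus> b"] a b s by (auto simp: state_diff)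
    ultimately show "\<bar>\<phi> a - \<psi> a\<bar> \<le> e + k * enn2real (mk V L \<phi> \<psi>)" by linarith
  qed (use k in simp)
qed

text \<open>
  Density of the domain makes \<open>mk\<close> a metric whose topology is finer than the weak* topology; the converse
  inclusion is exactly \<open>mk_continuous\<close>.
\<close>

theorem lip_normI:
  assumes L: "ou_seminorm V L"
    and dense: "\<And>a e. a \<in> carrier V \<Longrightarrow> e > 0 \<Longrightarrow> \<exists>b\<in>carrier V. L b < \<infinity> \<and> norm_diff V a b < e"
    and kernel: "\<And>a. a \<in> carrier V \<Longrightarrow> L a = 0 \<Longrightarrow> \<exists>r. a = r \<odot> \<one>"
    and unit: "L \<one> = 0"
    and finite: "\<And>\<phi> \<psi>. \<phi> \<in> states V \<Longrightarrow> \<psi> \<in> states V \<Longrightarrow> mk V L \<phi> \<psi> < \<infinity>"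
    and cont: "mk_continuous V L"
    and closed: "\<And>a. a \<in> carrier V \<Longrightarrow> (\<And>e. e > 0 \<Longrightarrow> \<exists>b\<in>carrier V. L b \<le> 1 \<and> norm_diff V a b < e)
                   \<Longrightarrow> L a \<le> 1"
  shows "lip_norm V L"
proof -
  let ?d = "\<lambda>\<phi> \<psi>. enn2real (mk V L \<phi> \<psi>)"
  have eval: "\<exists>k\<ge>0. \<forall>\<phi>\<in>states V. \<forall>\<psi>\<in>states V. \<bar>\<phi> a - \<psi> a\<bar> \<le> e + k * ?d \<phi> \<psi>"
    if ae: "a \<in> carrier V" "e > 0" for a e
    by (rule mk_dominates_eval[OF L _ ae]) (use dense finite in \<open>blast+\<close>)
  interpret M: Metric_space "states V" ?d
  proof
    fix \<phi> \<psi> \<rho> assume s: "\<phi> \<in> states V" "\<psi> \<in> states V"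
    show "?d \<phi> \<psi> = 0 \<longleftrightarrow> \<phi> = \<psi>"
    proof
      assume d: "?d \<phi> \<psi> = 0"
      have "\<phi> a = \<psi> a" if a: "a \<in> carrier V" for a
      proof -
        have "\<bar>\<phi> a - \<psi> a\<bar> \<le> 0 + e" if e: "e > 0" for e
        proof -
          obtain k where "\<forall>\<phi>\<in>states V. \<forall>\<psi>\<in>states V. \<bar>\<phi> a - \<psi> a\<bar> \<le> e + k * ?d \<phi> \<psi>"
            using eval[OF a e] by blast
          then have "\<bar>\<phi> a - \<psi> a\<bar> \<le> e + k * ?d \<phi> \<psi>" using s by blast
          then show ?thesis using d by simp
        qed
        then have "\<bar>\<phi> a - \<psi> a\<bar> \<le> 0" by (rule field_le_epsilon)
        then show ?thesis by simp
      qed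
      then show "\<phi> = \<psi>"
        using s by (intro extensionalityI[OF state_extensional state_extensional]) auto
    qed simp
    assume "\<rho> \<in> states V"
    then show "?d \<phi> \<rho> \<le> ?d \<phi> \<psi> + ?d \<psi> \<rho>"
      using s mk_triangle[of V L \<phi> \<rho> \<psi>] finite
      by (metis enn2real_mono enn2real_plus ennreal_add_less_top infinity_ennreal_def)
  qed (simp_all add: mk_commute)
  have "continuous_map M.mtopology (weak_star V) (\<lambda>\<phi>. \<phi>)"
  proof (rule continuous_map_into_weak_star)
    fix a assume a: "a \<in> carrier V"
    show "continuous_map M.mtopology euclideanreal (\<lambda>\<phi>. \<phi> a)"
      unfolding Met_TC.continuous_map_to_metric[unfolded mtopology_is_euclidean]
    proof (intro ballI allI impI)
      fix \<phi> and e :: real assume p: "\<phi> \<in> topspace M.mtopology" "e > 0"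
      obtain k where k: "k \<ge> 0"
        "\<forall>\<phi>\<in>states V. \<forall>\<psi>\<in>states V. \<bar>\<phi> a - \<psi> a\<bar> \<le> e / 2 + k * ?d \<phi> \<psi>"
        using eval[OF a, of "e / 2"] p by auto
      define r where "r = e / 4 / (k + 1)"
      have r: "r > 0" using p k by (simp add: r_def)
      have "\<psi> a \<in> Met_TC.mball (\<phi> a) e" if "\<psi> \<in> M.mball \<phi> r" for \<psi>
      proof -
        have "\<bar>\<phi> a - \<psi> a\<bar> \<le> e / 2 + k * ?d \<phi> \<psi>"
          using that k(2) by (auto simp: M.in_mball)
        also have "\<dots> \<le> e / 2 + (k + 1) * r"
          using that k(1) r by (intro add_left_mono mult_mono) (auto simp: M.in_mball)
        also have "(k + 1) * r = e / 4"
          using k(1) by (simp only: r_def times_divide_eq_right nonzero_mult_div_cancel_left)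
            (simp add: divide_simps)
        also have "e / 2 + e / 4 < e" using p by simp
        finally show ?thesis by (simp add: dist_real_def)
      qed
      then show "\<exists>U. openin M.mtopology U \<and> \<phi> \<in> U \<and> (\<forall>\<psi>\<in>U. \<psi> a \<in> Met_TC.mball (\<phi> a) e)"
        using p r by (intro exI[of _ "M.mball \<phi> r"]) auto
    qed
  qed simp
  then have "openin M.mtopology T" if "openin (weak_star V) T" for T
    using openin_continuous_map_preimage[OF _ that, of M.mtopology "\<lambda>\<phi>. \<phi>"] openin_subset[OF that]
    by (simp add: Collect_conj_eq Int_absorb1)
  moreover have "openin (weak_star V) T" if T: "openin M.mtopology T" for T
  proof (subst openin_subopen, intro ballI)
    fix \<phi> assume p: "\<phi> \<in> T"
    obtain r where r: "r > 0" "M.mball \<phi> r \<subseteq> T" "\<phi> \<in> states V"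
      using T p unfolding M.openin_mtopology by blast
    obtain U where U: "openin (weak_star V) U" "\<phi> \<in> U" "\<forall>\<psi>\<in>U. mk V L \<phi> \<psi> \<le> ennreal (r / 2)"
      using cont r half_gt_zero[OF r(1)] unfolding mk_continuous_def by meson
    have "U \<subseteq> M.mball \<phi> r"
    proof
      fix \<psi> assume u: "\<psi> \<in> U"
      have "?d \<phi> \<psi> \<le> r / 2" using U(3) u r by (intro enn2real_leI) auto
      then show "\<psi> \<in> M.mball \<phi> r"
        using r u openin_subset[OF U(1)] by (auto simp: M.in_mball)
    qed
    with U r show "\<exists>S. openin (weak_star V) S \<and> \<phi> \<in> S \<and> S \<subseteq> T" by auto
  qed
  ultimately have top: "M.mtopology = weak_star V"
    by (auto simp: topology_eq)
  have "{a \<in> carrier V. L a = 0} = range (\<lambda>r. r \<odot> \<one>)"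
    using kernel unit L by (auto simp: ou_seminorm_def)
  moreover have "Metric_space.mtopology (carrier V) (ou_dist V) closure_of {a \<in> carrier V. L a < \<infinity>} = carrier V"
    using dense by (subst ou_dense_iff) auto
  moreover have "closedin (Metric_space.mtopology (carrier V) (ou_dist V)) {a \<in> carrier V. L a \<le> 1}"
    unfolding ou_closedin_iff using closed by (simp add: Bex_def)
  ultimately show ?thesis
    unfolding lip_norm_def using L finite top M.Metric_space_axioms by auto
qed

lemma lip_normD:
  assumes "lip_norm V L"
  shows "ou_seminorm V L"
    and "\<And>a e. a \<in> carrier V \<Longrightarrow> e > 0 \<Longrightarrow> \<exists>b\<in>carrier V. L b < \<infinity> \<and> norm_diff V a b < e"
    and "\<And>a. a \<in> carrier V \<Longrightarrow> L a = 0 \<Longrightarrow> \<exists>r. a = r \<odot> \<one>"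
    and "L \<one> = 0"
    and "\<And>\<phi> \<psi>. \<phi> \<in> states V \<Longrightarrow> \<psi> \<in> states V \<Longrightarrow> mk V L \<phi> \<psi> < \<infinity>"
    and "\<And>a. a \<in> carrier V \<Longrightarrow> (\<And>e. e > 0 \<Longrightarrow> \<exists>b\<in>carrier V. L b \<le> 1 \<and> norm_diff V a b < e)
                   \<Longrightarrow> L a \<le> 1"
proof -
  have ker: "{a \<in> carrier V. L a = 0} = range (\<lambda>r. r \<odot> \<one>)"
    and dense: "Metric_space.mtopology (carrier V) (ou_dist V) closure_of {a \<in> carrier V. L a < \<infinity>} = carrier V"
    and closed: "closedin (Metric_space.mtopology (carrier V) (ou_dist V)) {a \<in> carrier V. L a \<le> 1}"
    using assms by (simp_all add: lip_norm_def)
  show "ou_seminorm V L" using assms by (simp add: lip_norm_def)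
  show "\<exists>b\<in>carrier V. L b < \<infinity> \<and> norm_diff V a b < e" if "a \<in> carrier V" "e > 0" for a e
    using dense that by (subst (asm) ou_dense_iff) auto
  show "\<exists>r. a = r \<odot> \<one>" if "a \<in> carrier V" "L a = 0" for a
    using ker that by auto
  have "1 \<odot> \<one> \<in> {a \<in> carrier V. L a = 0}" unfolding ker by blast
  then show "L \<one> = 0" by simp
  show "mk V L \<phi> \<psi> < \<infinity>" if "\<phi> \<in> states V" "\<psi> \<in> states V" for \<phi> \<psi>
    using assms that by (simp add: lip_norm_def)
  show "L a \<le> 1" if "a \<in> carrier V" "\<And>e. e > 0 \<Longrightarrow> \<exists>b\<in>carrier V. L b \<le> 1 \<and> norm_diff V a b < e" for a
    using closed that unfolding ou_closedin_iff by (simp add: Bex_def)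
qed

lemma ou_seminorm_norm:
  assumes closed: "\<And>a. a \<in> carrier U \<Longrightarrow> T a \<in> carrier V"
    and add: "\<And>a b. a \<in> carrier U \<Longrightarrow> b \<in> carrier U \<Longrightarrow> T (a \<oplus>\<^bsub>U\<^esub> b) = T a \<oplus> T b"
    and smult: "\<And>r a. a \<in> carrier U \<Longrightarrow> T (r \<odot>\<^bsub>U\<^esub> a) = r \<odot> T a"
    and k: "k > 0"
  shows "ou_seminorm U (\<lambda>a. ennreal (ou_norm V (T a) / k))"
  unfolding ou_seminorm_def
proof (intro conjI ballI allI)
  fix a b assume ab: "a \<in> carrier U" "b \<in> carrier U"
  then show "ennreal (ou_norm V (T (a \<oplus>\<^bsub>U\<^esub> b)) / k)
      \<le> ennreal (ou_norm V (T a) / k) + ennreal (ou_norm V (T b) / k)"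
    using ou_norm_add[OF closed closed, of a b] ou_norm_nonneg[OF closed] k
    by (simp add: add divide_right_mono flip: ennreal_plus add_divide_distrib)
next
  fix r a assume "a \<in> carrier U"
  then show "ennreal (ou_norm V (T (r \<odot>\<^bsub>U\<^esub> a)) / k) = ennreal \<bar>r\<bar> * ennreal (ou_norm V (T a) / k)"
    using ou_norm_nonneg[OF closed] k
    by (simp add: smult closed ou_norm_smult flip: ennreal_mult')
qed

end

lemma ennreal_mult_max: "(k :: ennreal) * max a b = max (k * a) (k * b)"
  by (cases "a \<le> b") (auto simp: max_absorb1 max_absorb2 mult_left_mono)

lemma ou_seminorm_max:
  assumes "ou_seminorm V L" "ou_seminorm V L'"
  shows "ou_seminorm V (\<lambda>a. max (L a) (L' a))"
  unfolding ou_seminorm_def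
proof (intro conjI ballI allI)
  fix a b assume ab: "a \<in> carrier V" "b \<in> carrier V"
  have "L (a \<oplus>\<^bsub>V\<^esub> b) \<le> L a + L b" "L' (a \<oplus>\<^bsub>V\<^esub> b) \<le> L' a + L' b"
    using assms ab by (auto simp: ou_seminorm_def)
  moreover have "L a + L b \<le> max (L a) (L' a) + max (L b) (L' b)"
    "L' a + L' b \<le> max (L a) (L' a) + max (L b) (L' b)"
    by (auto intro!: add_mono)
  ultimately show "max (L (a \<oplus>\<^bsub>V\<^esub> b)) (L' (a \<oplus>\<^bsub>V\<^esub> b)) \<le> max (L a) (L' a) + max (L b) (L' b)"
    by (auto intro: order_trans)
qed (use assms in \<open>simp add: ou_seminorm_def ennreal_mult_max\<close>)

lemma ou_seminorm_scale:
  "ou_seminorm V L \<Longrightarrow> ou_seminorm V (\<lambda>a. k * L a)"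
  unfolding ou_seminorm_def
  by (auto simp: distrib_left[symmetric] mult.left_commute intro!: mult_left_mono)

section \<open>Direct sums along a retraction\<close>

text \<open>
  A condition on \<open>U\<close> instead of a fixed construction: it covers the direct sum of two order unit spaces
  as well as the self-adjoint part of a direct sum of C*-algebras, whose order is defined by squares in the
  sum and is componentwise on the carrier only.
\<close>

locale ous_direct_sum = V: order_unit_space V + W: order_unit_space W
  for V :: "'a ous" and W :: "'b ous" +
  fixes U :: "('a \<times> 'b) ous"
  assumes carrier_sum: "carrier U = carrier V \<times> carrier W"
    and unit_sum: "\<one>\<^bsub>U\<^esub> = (\<one>\<^bsub>V\<^esub>, \<one>\<^bsub>W\<^esub>)"
    and zero_sum: "\<zero>\<^bsub>U\<^esub> = (\<zero>\<^bsub>V\<^esub>, \<zero>\<^bsub>W\<^esub>)"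
    and add_sum: "(a, b) \<oplus>\<^bsub>U\<^esub> (a', b') = (a \<oplus>\<^bsub>V\<^esub> a', b \<oplus>\<^bsub>W\<^esub> b')"
    and smult_sum: "r \<odot>\<^bsub>U\<^esub> (a, b) = (r \<odot>\<^bsub>V\<^esub> a, r \<odot>\<^bsub>W\<^esub> b)"
    and leq_sum: "\<lbrakk>a \<in> carrier V; b \<in> carrier W; a' \<in> carrier V; b' \<in> carrier W\<rbrakk> \<Longrightarrow>
      leq U (a, b) (a', b') \<longleftrightarrow> leq V a a' \<and> leq W b b'"
begin

lemmas sum_simps = carrier_sum unit_sum zero_sum add_sum smult_sum leq_sum

lemma order_unit_space_sum: "order_unit_space U"
proof (rule order_unit_space.intro)
  have "abelian_group U"
  proof (rule abelian_groupI)
    fix x assume "x \<in> carrier U"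
    then show "\<exists>y\<in>carrier U. y \<oplus>\<^bsub>U\<^esub> x = \<zero>\<^bsub>U\<^esub>"
      by (cases x) (auto simp: sum_simps V.l_neg W.l_neg intro!: bexI[of _ "(\<ominus>\<^bsub>V\<^esub> fst x, \<ominus>\<^bsub>W\<^esub> snd x)"])
  qed (auto simp: sum_simps V.a_assoc W.a_assoc intro: V.a_comm W.a_comm)
  then show "Module.module (ring_of_type_algebra :: real ring) U"
    by (intro moduleI cring_from_type_algebra)
      (auto simp: sum_simps V.smult_add_left W.smult_add_left V.smult_add_right W.smult_add_right
        V.smult_smult W.smult_smult)
next
  fix x assume "x \<in> carrier U"
  then obtain a b where x: "x = (a, b)" "a \<in> carrier V" "b \<in> carrier W" by (auto simp: carrier_sum)
  define r where "r = max (ou_norm V a) (ou_norm W b) + 1"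
  have "ou_norm V a \<le> r" "ou_norm W b \<le> r" "r > 0"
    using V.ou_norm_nonneg[OF x(2)] by (auto simp: r_def)
  then show "\<exists>r>0. leq U ((- r) \<odot>\<^bsub>U\<^esub> \<one>\<^bsub>U\<^esub>) x \<and> leq U x (r \<odot>\<^bsub>U\<^esub> \<one>\<^bsub>U\<^esub>)"
    using x by (intro exI[of _ r])
      (auto simp: sum_simps V.ou_norm_le_iff W.ou_norm_le_iff V.leq_neg_unit_iff W.leq_neg_unit_iff)
next
  fix x assume "x \<in> carrier U" and *: "\<And>r. r > 0 \<Longrightarrow> leq U x (r \<odot>\<^bsub>U\<^esub> \<one>\<^bsub>U\<^esub>)"
  then show "leq U x \<zero>\<^bsub>U\<^esub>"
    by (cases x) (auto simp: sum_simps intro!: V.archimedean W.archimedean)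
next
  show "\<one>\<^bsub>U\<^esub> \<in> carrier U" by (simp add: sum_simps)
next
  fix x assume "x \<in> carrier U"
  then show "leq U x x" by (cases x) (simp add: sum_simps V.leq_refl W.leq_refl)
next
  fix x y z assume c: "x \<in> carrier U" "y \<in> carrier U" "z \<in> carrier U" and l: "leq U x y"
  obtain a b a' b' a'' b'' where [simp]: "x = (a, b)" "y = (a', b')" "z = (a'', b'')" by (metis surj_pair)
  show "leq U y z \<Longrightarrow> leq U x z"
    using c l V.leq_trans[of a a' a''] W.leq_trans[of b b' b''] by (simp add: sum_simps)
  show "leq U (x \<oplus>\<^bsub>U\<^esub> z) (y \<oplus>\<^bsub>U\<^esub> z)"
    using c l V.leq_add[of a a' a''] W.leq_add[of b b' b''] by (simp add: sum_simps)
next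
  fix x y assume c: "x \<in> carrier U" "y \<in> carrier U" and l: "leq U x y"
  obtain a b a' b' where [simp]: "x = (a, b)" "y = (a', b')" by (metis surj_pair)
  show "leq U y x \<Longrightarrow> x = y"
    using c l V.leq_antisym[of a a'] W.leq_antisym[of b b'] by (simp add: sum_simps)
  show "leq U (r \<odot>\<^bsub>U\<^esub> x) (r \<odot>\<^bsub>U\<^esub> y)" if "0 \<le> r" for r
    using c l that V.leq_smult[of a a' r] W.leq_smult[of b b' r] by (simp add: sum_simps)
qed

sublocale U: order_unit_space U
  by (rule order_unit_space_sum)

lemma ou_morphism_fst: "ou_morphism U V fst"
  by unfold_locales (auto simp: sum_simps)

lemma ou_morphism_snd: "ou_morphism U W snd"
  by unfold_locales (auto simp: sum_simps)

lemma diff_sum: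
  assumes "a \<in> carrier V" "b \<in> carrier W" "a' \<in> carrier V" "b' \<in> carrier W"
  shows "(a, b) \<ominus>\<^bsub>U\<^esub> (a', b') = (a \<ominus>\<^bsub>V\<^esub> a', b \<ominus>\<^bsub>W\<^esub> b')"
  using ou_morphism.diff[OF ou_morphism_fst, of "(a, b)" "(a', b')"]
    ou_morphism.diff[OF ou_morphism_snd, of "(a, b)" "(a', b')"] assms
  by (simp add: prod_eq_iff carrier_sum)

lemma ou_norm_sum_le_iff:
  assumes "a \<in> carrier V" "b \<in> carrier W"
  shows "ou_norm U (a, b) \<le> r \<longleftrightarrow> ou_norm V a \<le> r \<and> ou_norm W b \<le> r"
proof
  assume "ou_norm U (a, b) \<le> r"
  then show "ou_norm V a \<le> r \<and> ou_norm W b \<le> r"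
    using ou_morphism.norm_le[OF ou_morphism_fst, of "(a, b)"]
      ou_morphism.norm_le[OF ou_morphism_snd, of "(a, b)"] assms by (simp add: carrier_sum)
next
  assume "ou_norm V a \<le> r \<and> ou_norm W b \<le> r"
  then show "ou_norm U (a, b) \<le> r"
    using assms U.leq_neg_unit_iff[of "(a, b)" r]
    by (auto simp: U.ou_norm_le_iff V.ou_norm_le_iff W.ou_norm_le_iff sum_simps
        V.leq_neg_unit_iff W.leq_neg_unit_iff)
qed

lemma ou_norm_sum:
  "a \<in> carrier V \<Longrightarrow> b \<in> carrier W \<Longrightarrow> ou_norm U (a, b) = max (ou_norm V a) (ou_norm W b)"
  using ou_norm_sum_le_iff[of a b "ou_norm U (a, b)"]
    ou_norm_sum_le_iff[of a b "max (ou_norm V a) (ou_norm W b)"] by auto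

lemma mcomplete_sum:
  assumes "Metric_space.mcomplete (carrier V) (ou_dist V)"
    and "Metric_space.mcomplete (carrier W) (ou_dist W)"
  shows "Metric_space.mcomplete (carrier U) (ou_dist U)"
  unfolding U.ou_mcomplete_iff
proof (intro allI impI)
  fix s :: "nat \<Rightarrow> 'a \<times> 'b"
  assume s: "\<forall>n. s n \<in> carrier U"
    and cauchy: "\<forall>e>0. \<exists>M. \<forall>m\<ge>M. \<forall>n\<ge>M. norm_diff U (s m) (s n) < e"
  define a b where "a n = fst (s n)" and "b n = snd (s n)" for n
  have ab: "s n = (a n, b n)" "a n \<in> carrier V" "b n \<in> carrier W" for n
    using s[rule_format, of n] by (auto simp: a_def b_def carrier_sum)
  have cauchy': "\<forall>e>0. \<exists>M. \<forall>m\<ge>M. \<forall>n\<ge>M. norm_diff V (a m) (a n) < e \<and> norm_diff W (b m) (b n) < e"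
    using cauchy ab by (simp add: diff_sum ou_norm_sum)
  have "\<exists>x\<in>carrier V. \<forall>e>0. \<exists>M. \<forall>n\<ge>M. norm_diff V (a n) x < e"
  proof (rule assms(1)[unfolded V.ou_mcomplete_iff, THEN spec, THEN mp, THEN mp])
    show "\<forall>e>0. \<exists>M. \<forall>m\<ge>M. \<forall>n\<ge>M. norm_diff V (a m) (a n) < e" using cauchy' by meson
  qed (use ab in simp)
  then obtain x where x: "x \<in> carrier V" "\<forall>e>0. \<exists>M. \<forall>n\<ge>M. norm_diff V (a n) x < e" by blast
  have "\<exists>y\<in>carrier W. \<forall>e>0. \<exists>M. \<forall>n\<ge>M. norm_diff W (b n) y < e"
  proof (rule assms(2)[unfolded W.ou_mcomplete_iff, THEN spec, THEN mp, THEN mp])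
    show "\<forall>e>0. \<exists>M. \<forall>m\<ge>M. \<forall>n\<ge>M. norm_diff W (b m) (b n) < e" using cauchy' by meson
  qed (use ab in simp)
  then obtain y where y: "y \<in> carrier W" "\<forall>e>0. \<exists>M. \<forall>n\<ge>M. norm_diff W (b n) y < e" by blast
  show "\<exists>x\<in>carrier U. \<forall>e>0. \<exists>M. \<forall>n\<ge>M. norm_diff U (s n) x < e"
  proof (intro bexI[of _ "(x, y)"] allI impI)
    fix e :: real assume "e > 0"
    then obtain M N where "\<forall>n\<ge>M. norm_diff V (a n) x < e" "\<forall>n\<ge>N. norm_diff W (b n) y < e"
      using x y by meson
    then show "\<exists>M. \<forall>n\<ge>M. norm_diff U (s n) (x, y) < e"
      using ab x y by (intro exI[of _ "max M N"]) (simp add: diff_sum ou_norm_sum)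
  qed (use x y in \<open>simp add: carrier_sum\<close>)
qed

end

lemma ous_direct_sum_ous_sum:
  "order_unit_space V \<Longrightarrow> order_unit_space W \<Longrightarrow> ous_direct_sum V W (ous_sum V W)"
  by (simp add: ous_direct_sum_def ous_direct_sum_axioms_def ous_sum_def)

text \<open>
  On the unit ball of \<open>L\<^sub>W\<close> the idempotent \<open>j \<circ> p\<close> moves points by at most \<open>\<epsilon>\<close>.
\<close>

locale lip_retraction = j: ou_morphism V W j + p: ou_morphism W V p
  for V :: "'a ous" and W :: "'b ous" and j p +
  fixes L\<^sub>V L\<^sub>W and \<epsilon> :: real
  assumes qV: "quantum_metric_ous V L\<^sub>V" and qW: "quantum_metric_ous W L\<^sub>W"
    and retract: "a \<in> carrier V \<Longrightarrow> p (j a) = a"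
    and lip_j: "a \<in> carrier V \<Longrightarrow> L\<^sub>W (j a) \<le> L\<^sub>V a"
    and lip_p: "b \<in> carrier W \<Longrightarrow> L\<^sub>V (p b) \<le> L\<^sub>W b"
    and eps_pos: "\<epsilon> > 0"
    and approx: "b \<in> carrier W \<Longrightarrow> ennreal (norm_diff W b (j (p b)) / \<epsilon>) \<le> L\<^sub>W b"

locale lip_retraction_sum = ous_direct_sum V W U + lip_retraction V W j p L\<^sub>V L\<^sub>W \<epsilon>
  for V :: "'a ous" and W :: "'b ous" and j p L\<^sub>V L\<^sub>W \<epsilon> U
begin

definition sum_lip :: "'a \<times> 'b \<Rightarrow> ennreal" where
  "sum_lip = (\<lambda>(a, b). max (max (L\<^sub>V a) (L\<^sub>W b)) (ennreal (norm_diff W b (j a) / \<epsilon>)))"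

lemma lip_V: "lip_norm V L\<^sub>V" and lip_W: "lip_norm W L\<^sub>W"
  using qV qW by (auto simp: quantum_metric_ous_def)

lemma sum_lip_le_1_iff:
  "a \<in> carrier V \<Longrightarrow> b \<in> carrier W \<Longrightarrow>
    sum_lip (a, b) \<le> 1 \<longleftrightarrow> L\<^sub>V a \<le> 1 \<and> L\<^sub>W b \<le> 1 \<and> norm_diff W b (j a) \<le> \<epsilon>"
  using eps_pos by (simp add: sum_lip_def field_simps flip: ennreal_1)

lemma ou_seminorm_sum_lip: "ou_seminorm U sum_lip"
proof -
  have "ou_seminorm U (\<lambda>x. L\<^sub>V (fst x))"
    using lip_V by (auto simp: ou_seminorm_def lip_norm_def sum_simps)
  moreover have "ou_seminorm U (\<lambda>x. L\<^sub>W (snd x))"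
    using lip_W by (auto simp: ou_seminorm_def lip_norm_def sum_simps)
  moreover have "ou_seminorm U (\<lambda>x. ennreal (norm_diff W (snd x) (j (fst x)) / \<epsilon>))"
    by (rule W.ou_seminorm_norm)
      (auto simp: sum_simps j.add j.smult W.add_diff_add W.smult_diff_right eps_pos)
  ultimately show ?thesis
    unfolding sum_lip_def case_prod_beta by (intro ou_seminorm_max)
qed

text \<open>
  The lifts \<open>(a, j a)\<close> and \<open>(p b, b)\<close> attain the quotient seminorms: in the former the last term of the
  maximum vanishes, in the latter it is at most \<open>L\<^sub>W b\<close>.
\<close>

lemma sum_lip_section: "a \<in> carrier V \<Longrightarrow> sum_lip (a, j a) = L\<^sub>V a"
  using lip_j[of a] by (simp add: sum_lip_def max_absorb1)

lemma sum_lip_retract: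
  assumes b: "b \<in> carrier W" shows "sum_lip (p b, b) = L\<^sub>W b"
  using lip_p[OF b] approx[OF b] by (simp add: sum_lip_def max_absorb1 max_absorb2)

lemma sum_lip_quotient_left:
  "a \<in> carrier V \<Longrightarrow> L\<^sub>V a = (INF b\<in>carrier W. sum_lip (a, b))"
  by (intro antisym INF_greatest INF_lower2[of "j a"]) (auto simp: sum_lip_section, simp add: sum_lip_def le_max_iff_disj)

lemma sum_lip_quotient_right:
  "b \<in> carrier W \<Longrightarrow> L\<^sub>W b = (INF a\<in>carrier V. sum_lip (a, b))"
  by (intro antisym INF_greatest INF_lower2[of "p b"]) (auto simp: sum_lip_retract, simp add: sum_lip_def le_max_iff_disj)

lemma section_morphism: "ou_morphism V U (\<lambda>a. (a, j a))"
  by unfold_locales (auto simp: sum_simps j.add j.smult j.unit j.pos)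

lemma retract_morphism: "ou_morphism W U (\<lambda>b. (p b, b))"
  by unfold_locales (auto simp: sum_simps p.add p.smult p.unit p.pos)

text \<open>
  A state \<open>\<phi>\<close> of the sum is a convex combination of a state of \<open>V\<close> and a state of \<open>W\<close>, but these two
  depend continuously on \<open>\<phi>\<close> only as long as their weights do not vanish.  Pulling \<open>\<phi>\<close> back along
  \<open>a \<mapsto> (a, \<eta> a \<odot> \<one>)\<close>, for a fixed state \<open>\<eta>\<close>, fills up the missing weight with \<open>\<eta>\<close>: the result is always a
  state of \<open>V\<close> and depends continuously on \<open>\<phi>\<close>.
\<close>

lemma left_morphism:
  assumes \<eta>: "\<eta> \<in> states V" shows "ou_morphism V U (\<lambda>a. (a, \<eta> a \<odot>\<^bsub>W\<^esub> \<one>\<^bsub>W\<^esub>))"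
proof -
  have pos: "leq W \<zero>\<^bsub>W\<^esub> (r \<odot>\<^bsub>W\<^esub> \<one>\<^bsub>W\<^esub>)" if "0 \<le> r" for r
    using W.smult_unit_mono[OF that] by simp
  show ?thesis
    by unfold_locales (simp_all add: sum_simps state_add[OF \<eta>] state_smult[OF \<eta>] state_unit[OF \<eta>]
        state_pos[OF \<eta>] W.smult_add_left W.smult_smult pos)
qed

lemma right_morphism:
  assumes \<eta>: "\<eta> \<in> states V" shows "ou_morphism W U (\<lambda>b. (\<eta> (p b) \<odot>\<^bsub>V\<^esub> \<one>\<^bsub>V\<^esub>, b))"
proof -
  have pos: "leq V \<zero>\<^bsub>V\<^esub> (r \<odot>\<^bsub>V\<^esub> \<one>\<^bsub>V\<^esub>)" if "0 \<le> r" for r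
    using V.smult_unit_mono[OF that] by simp
  show ?thesis
    by unfold_locales (simp_all add: sum_simps p.add p.smult p.unit p.pos state_add[OF \<eta>] state_smult[OF \<eta>]
        state_unit[OF \<eta>] state_pos[OF \<eta>] V.smult_add_left V.smult_smult pos)
qed

abbreviation "left_state \<eta> \<phi> \<equiv> compose (carrier V) \<phi> (\<lambda>a. (a, \<eta> a \<odot>\<^bsub>W\<^esub> \<one>\<^bsub>W\<^esub>))"
abbreviation "right_state \<eta> \<phi> \<equiv> compose (carrier W) \<phi> (\<lambda>b. (\<eta> (p b) \<odot>\<^bsub>V\<^esub> \<one>\<^bsub>V\<^esub>, b))"
abbreviation "section_state \<phi> \<equiv> compose (carrier V) \<phi> (\<lambda>a. (a, j a))"
abbreviation "retract_state \<phi> \<equiv> compose (carrier W) \<phi> (\<lambda>b. (p b, b))"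

lemmas section_state = ou_morphism.pullback_state[OF section_morphism]
lemmas retract_state = ou_morphism.pullback_state[OF retract_morphism]
lemmas left_state = ou_morphism.pullback_state[OF left_morphism]
lemmas right_state = ou_morphism.pullback_state[OF right_morphism]

lemma state_scalars:
  assumes \<phi>: "\<phi> \<in> states U"
  shows "\<phi> (r \<odot>\<^bsub>V\<^esub> \<one>\<^bsub>V\<^esub>, s \<odot>\<^bsub>W\<^esub> \<one>\<^bsub>W\<^esub>) = s + (r - s) * \<phi> (\<one>\<^bsub>V\<^esub>, \<zero>\<^bsub>W\<^esub>)"
proof -
  have c: "(\<one>\<^bsub>V\<^esub>, \<zero>\<^bsub>W\<^esub>) \<in> carrier U" by (simp add: carrier_sum)
  have "(r \<odot>\<^bsub>V\<^esub> \<one>\<^bsub>V\<^esub>, s \<odot>\<^bsub>W\<^esub> \<one>\<^bsub>W\<^esub>) = s \<odot>\<^bsub>U\<^esub> \<one>\<^bsub>U\<^esub> \<oplus>\<^bsub>U\<^esub> (r - s) \<odot>\<^bsub>U\<^esub> (\<one>\<^bsub>V\<^esub>, \<zero>\<^bsub>W\<^esub>)"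
    by (simp add: sum_simps flip: V.smult_add_left)
  also have "\<phi> \<dots> = s + (r - s) * \<phi> (\<one>\<^bsub>V\<^esub>, \<zero>\<^bsub>W\<^esub>)"
    using c by (simp add: state_add[OF \<phi>] state_smult[OF \<phi>] state_unit[OF \<phi>])
  finally show ?thesis .
qed

lemma state_decomposition:
  assumes \<phi>: "\<phi> \<in> states U" and a: "a \<in> carrier V" and b: "b \<in> carrier W"
  shows "\<phi> (a, b) = \<phi> (a, s \<odot>\<^bsub>W\<^esub> \<one>\<^bsub>W\<^esub>) + \<phi> (r \<odot>\<^bsub>V\<^esub> \<one>\<^bsub>V\<^esub>, b) - \<phi> (r \<odot>\<^bsub>V\<^esub> \<one>\<^bsub>V\<^esub>, s \<odot>\<^bsub>W\<^esub> \<one>\<^bsub>W\<^esub>)"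
proof -
  have "(a, b) \<oplus>\<^bsub>U\<^esub> (r \<odot>\<^bsub>V\<^esub> \<one>\<^bsub>V\<^esub>, s \<odot>\<^bsub>W\<^esub> \<one>\<^bsub>W\<^esub>) = (a, s \<odot>\<^bsub>W\<^esub> \<one>\<^bsub>W\<^esub>) \<oplus>\<^bsub>U\<^esub> (r \<odot>\<^bsub>V\<^esub> \<one>\<^bsub>V\<^esub>, b)"
    using a b by (simp add: add_sum W.a_comm)
  from arg_cong[OF this, of \<phi>] show ?thesis
    using a b by (simp add: state_add[OF \<phi>] carrier_sum)
qed

text \<open>
  The two pullbacks determine \<open>\<phi> (a, b)\<close> up to the value of \<open>\<phi>\<close> at the pair of scalars
  \<open>(\<eta> (p b) \<odot> \<one>, \<eta> a \<odot> \<one>)\<close>, which depends on \<open>\<phi>\<close> through its weight \<open>\<phi> (\<one>, \<zero>)\<close> only.  The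
  coefficient of the weight is \<open>\<eta> (p b) - \<eta> a = \<eta> (p (b - j a))\<close>, at most \<open>\<epsilon>\<close> on the unit ball.
\<close>

lemma mk_sum_lip_le:
  assumes \<phi>: "\<phi> \<in> states U" and \<psi>: "\<psi> \<in> states U" and \<eta>: "\<eta> \<in> states V"
    and x: "0 \<le> x" "mk V L\<^sub>V (left_state \<eta> \<phi>) (left_state \<eta> \<psi>) \<le> ennreal x"
    and y: "0 \<le> y" "mk W L\<^sub>W (right_state \<eta> \<phi>) (right_state \<eta> \<psi>) \<le> ennreal y"
  shows "mk U sum_lip \<phi> \<psi> \<le> ennreal (x + y + \<bar>\<phi> (\<one>\<^bsub>V\<^esub>, \<zero>\<^bsub>W\<^esub>) - \<psi> (\<one>\<^bsub>V\<^esub>, \<zero>\<^bsub>W\<^esub>)\<bar> * \<epsilon>)"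
proof (rule mk_leI)
  fix z assume z: "z \<in> carrier U" "sum_lip z \<le> 1"
  then obtain a b where ab: "z = (a, b)" "a \<in> carrier V" "b \<in> carrier W" by (auto simp: carrier_sum)
  have L: "L\<^sub>V a \<le> 1" "L\<^sub>W b \<le> 1" "norm_diff W b (j a) \<le> \<epsilon>"
    using z ab by (auto simp: sum_lip_le_1_iff)
  let ?t = "\<lambda>\<phi>. \<phi> (\<one>\<^bsub>V\<^esub>, \<zero>\<^bsub>W\<^esub>) :: real"
  have eq: "\<phi> z - \<psi> z = (left_state \<eta> \<phi> a - left_state \<eta> \<psi> a) + (right_state \<eta> \<phi> b - right_state \<eta> \<psi> b)
      + (?t \<phi> - ?t \<psi>) * (\<eta> a - \<eta> (p b))"
    using ab state_decomposition[OF \<phi> ab(2,3), of "\<eta> a" "\<eta> (p b)"]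
      state_decomposition[OF \<psi> ab(2,3), of "\<eta> a" "\<eta> (p b)"]
    by (simp add: compose_eq state_scalars[OF \<phi>] state_scalars[OF \<psi>] algebra_simps)
  have "\<eta> (p b) - \<eta> a = \<eta> (p (b \<ominus>\<^bsub>W\<^esub> j a))"
    using ab by (simp add: p.diff retract V.state_diff[OF \<eta>])
  then have "\<bar>\<eta> a - \<eta> (p b)\<bar> \<le> ou_norm V (p (b \<ominus>\<^bsub>W\<^esub> j a))"
    using V.state_le_norm[OF \<eta>, of "p (b \<ominus>\<^bsub>W\<^esub> j a)"] ab by (simp add: abs_minus_commute)
  also have "\<dots> \<le> norm_diff W b (j a)"
    using ab by (intro p.norm_le) auto
  also have "\<dots> \<le> \<epsilon>" by (rule L)
  finally have "\<bar>(?t \<phi> - ?t \<psi>) * (\<eta> a - \<eta> (p b))\<bar> \<le> \<bar>?t \<phi> - ?t \<psi>\<bar> * \<epsilon>"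
    by (simp add: abs_mult mult_left_mono)
  moreover have "\<bar>left_state \<eta> \<phi> a - left_state \<eta> \<psi> a\<bar> \<le> x"
    using mk_leD[OF x(2,1) ab(2) L(1)] .
  moreover have "\<bar>right_state \<eta> \<phi> b - right_state \<eta> \<psi> b\<bar> \<le> y"
    using mk_leD[OF y(2,1) ab(3) L(2)] .
  ultimately show "\<bar>\<phi> z - \<psi> z\<bar> \<le> x + y + \<bar>?t \<phi> - ?t \<psi>\<bar> * \<epsilon>"
    unfolding eq by linarith
qed

lemma mk_continuous_sum_lip: "mk_continuous U sum_lip"
  unfolding mk_continuous_def
proof (intro ballI allI impI)
  fix \<phi> and e :: real assume \<phi>: "\<phi> \<in> states U" and e: "e > 0"
  define \<eta> where "\<eta> = section_state \<phi>"
  have \<eta>: "\<eta> \<in> states V" unfolding \<eta>_def by (rule section_state[OF \<phi>])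
  have e3: "e / 3 > 0" using e by simp
  obtain U1 where U1: "openin (weak_star U) U1" "\<phi> \<in> U1"
    "\<And>\<psi>. \<psi> \<in> U1 \<Longrightarrow> mk V L\<^sub>V (left_state \<eta> \<phi>) (left_state \<eta> \<psi>) \<le> ennreal (e / 3)"
    using mk_continuous_preimage[OF lip_norm_imp_mk_continuous[OF lip_V]
        ou_morphism.continuous_map_pullback[OF left_morphism[OF \<eta>]] \<phi> e3] by blast
  obtain U2 where U2: "openin (weak_star U) U2" "\<phi> \<in> U2"
    "\<And>\<psi>. \<psi> \<in> U2 \<Longrightarrow> mk W L\<^sub>W (right_state \<eta> \<phi>) (right_state \<eta> \<psi>) \<le> ennreal (e / 3)"
    using mk_continuous_preimage[OF lip_norm_imp_mk_continuous[OF lip_W]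
        ou_morphism.continuous_map_pullback[OF right_morphism[OF \<eta>]] \<phi> e3] by blast
  define U3 where "U3 = {\<psi> \<in> topspace (weak_star U). \<psi> (\<one>\<^bsub>V\<^esub>, \<zero>\<^bsub>W\<^esub>) \<in> ball (\<phi> (\<one>\<^bsub>V\<^esub>, \<zero>\<^bsub>W\<^esub>)) (e / 3 / \<epsilon>)}"
  have U3: "openin (weak_star U) U3"
    unfolding U3_def
    by (rule openin_continuous_map_preimage[OF continuous_map_weak_star_eval]) (auto simp: carrier_sum)
  have "mk U sum_lip \<phi> \<psi> \<le> ennreal e" if \<psi>: "\<psi> \<in> U1 \<inter> U2 \<inter> U3" for \<psi>
  proof -
    have s: "\<psi> \<in> states U" using \<psi> by (simp add: U3_def)
    have "mk U sum_lip \<phi> \<psi> \<le> ennreal (e/3 + e/3 + \<bar>\<phi> (\<one>\<^bsub>V\<^esub>, \<zero>\<^bsub>W\<^esub>) - \<psi> (\<one>\<^bsub>V\<^esub>, \<zero>\<^bsub>W\<^esub>)\<bar> * \<epsilon>)"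
      using U1 U2 \<psi> e by (intro mk_sum_lip_le[OF \<phi> s \<eta>]) auto
    also have "\<dots> \<le> ennreal e"
      using \<psi> eps_pos by (intro ennreal_leI) (auto simp: U3_def dist_real_def field_simps)
    finally show ?thesis .
  qed
  then show "\<exists>T. openin (weak_star U) T \<and> \<phi> \<in> T \<and> (\<forall>\<psi>\<in>T. mk U sum_lip \<phi> \<psi> \<le> ennreal e)"
    using U1 U2 U3 \<phi> e3 eps_pos
    by (intro exI[of _ "U1 \<inter> U2 \<inter> U3"]) (auto simp: U3_def)
qed

theorem lip_norm_sum_lip: "lip_norm U sum_lip"
proof (rule U.lip_normI[OF ou_seminorm_sum_lip])
  fix x e assume x: "x \<in> carrier U" and e: "(e :: real) > 0"
  then obtain a b where ab: "x = (a, b)" "a \<in> carrier V" "b \<in> carrier W" by (auto simp: carrier_sum)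
  obtain a' where a': "a' \<in> carrier V" "L\<^sub>V a' < \<infinity>" "norm_diff V a a' < e"
    using V.lip_normD(2)[OF lip_V ab(2) e] by blast
  obtain b' where b': "b' \<in> carrier W" "L\<^sub>W b' < \<infinity>" "norm_diff W b b' < e"
    using W.lip_normD(2)[OF lip_W ab(3) e] by blast
  show "\<exists>b\<in>carrier U. sum_lip b < \<infinity> \<and> norm_diff U x b < e"
    using ab a' b' by (intro bexI[of _ "(a', b')"]) (auto simp: sum_lip_def diff_sum ou_norm_sum carrier_sum)
next
  fix x assume x: "x \<in> carrier U" "sum_lip x = 0"
  then obtain a b where ab: "x = (a, b)" "a \<in> carrier V" "b \<in> carrier W" by (auto simp: carrier_sum)
  have 0: "L\<^sub>V a = 0" "norm_diff W b (j a) = 0"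
    using x ab eps_pos W.ou_norm_nonneg[of "b \<ominus>\<^bsub>W\<^esub> j a"]
    by (auto simp: sum_lip_def max_def ennreal_eq_0_iff divide_le_0_iff split: if_splits)
  obtain r where r: "a = r \<odot>\<^bsub>V\<^esub> \<one>\<^bsub>V\<^esub>" using V.lip_normD(3)[OF lip_V ab(2) 0(1)] by blast
  have "b = j a" using 0(2) ab by (simp add: W.ou_norm_eq_zero_iff W.diff_eq_zero_iff)
  then show "\<exists>r. x = r \<odot>\<^bsub>U\<^esub> \<one>\<^bsub>U\<^esub>" using ab r by (auto simp: sum_simps j.smult j.unit)
next
  show "sum_lip \<one>\<^bsub>U\<^esub> = 0"
    using sum_lip_section[of "\<one>\<^bsub>V\<^esub>"] V.lip_normD(4)[OF lip_V] by (simp add: unit_sum j.unit)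
next
  fix \<phi> \<psi> assume s: "\<phi> \<in> states U" "\<psi> \<in> states U"
  define \<eta> where "\<eta> = section_state \<phi>"
  have \<eta>: "\<eta> \<in> states V" unfolding \<eta>_def by (rule section_state[OF s(1)])
  have f: "mk V L\<^sub>V (left_state \<eta> \<phi>) (left_state \<eta> \<psi>) < \<infinity>" "mk W L\<^sub>W (right_state \<eta> \<phi>) (right_state \<eta> \<psi>) < \<infinity>"
    using V.lip_normD(5)[OF lip_V] W.lip_normD(5)[OF lip_W] left_state[OF \<eta>] right_state[OF \<eta>] s by auto
  have "mk U sum_lip \<phi> \<psi> \<le> ennreal (enn2real (mk V L\<^sub>V (left_state \<eta> \<phi>) (left_state \<eta> \<psi>))
      + enn2real (mk W L\<^sub>W (right_state \<eta> \<phi>) (right_state \<eta> \<psi>)) + \<bar>\<phi> (\<one>\<^bsub>V\<^esub>, \<zero>\<^bsub>W\<^esub>) - \<psi> (\<one>\<^bsub>V\<^esub>, \<zero>\<^bsub>W\<^esub>)\<bar> * \<epsilon>)"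
    using f by (intro mk_sum_lip_le[OF s \<eta>]) auto
  also have "\<dots> < \<infinity>" by simp
  finally show "mk U sum_lip \<phi> \<psi> < \<infinity>" .
next
  show "mk_continuous U sum_lip" by (rule mk_continuous_sum_lip)
next
  fix x assume x: "x \<in> carrier U"
    and lim: "\<And>e. e > 0 \<Longrightarrow> \<exists>y\<in>carrier U. sum_lip y \<le> 1 \<and> norm_diff U x y < e"
  then obtain a b where ab: "x = (a, b)" "a \<in> carrier V" "b \<in> carrier W" by (auto simp: carrier_sum)
  have lim': "\<exists>a'\<in>carrier V. \<exists>b'\<in>carrier W. L\<^sub>V a' \<le> 1 \<and> L\<^sub>W b' \<le> 1 \<and> norm_diff W b' (j a') \<le> \<epsilon>
      \<and> norm_diff V a a' < e \<and> norm_diff W b b' < e" if e: "e > 0" for e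
    using lim[OF e] ab by (auto simp: carrier_sum sum_lip_le_1_iff diff_sum ou_norm_sum)
  have "L\<^sub>V a \<le> 1" using lim' by (intro V.lip_normD(6)[OF lip_V ab(2)]) blast
  moreover have "L\<^sub>W b \<le> 1" using lim' by (intro W.lip_normD(6)[OF lip_W ab(3)]) blast
  moreover have "norm_diff W b (j a) \<le> \<epsilon>"
  proof (rule field_le_epsilon)
    fix e :: real assume "e > 0"
    then obtain a' b' where c: "a' \<in> carrier V" "b' \<in> carrier W" "norm_diff W b' (j a') \<le> \<epsilon>"
      "norm_diff V a a' < e / 2" "norm_diff W b b' < e / 2"
      using lim'[of "e / 2"] by auto
    have "norm_diff W (j a') (j a) \<le> norm_diff V a a'"
      using c ab j.norm_le[of "a' \<ominus>\<^bsub>V\<^esub> a"] by (simp add: j.diff V.ou_norm_diff_commute)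
    moreover have "norm_diff W b (j a) \<le> norm_diff W b b' + (norm_diff W b' (j a') + norm_diff W (j a') (j a))"
      using c ab W.ou_norm_diff_triangle[of b b' "j a"] W.ou_norm_diff_triangle[of b' "j a'" "j a"] by simp
    ultimately show "norm_diff W b (j a) \<le> \<epsilon> + e" using c by linarith
  qed
  ultimately show "sum_lip x \<le> 1" using ab by (simp add: sum_lip_le_1_iff)
qed

theorem quantum_metric_sum: "quantum_metric_ous U sum_lip"
  using lip_norm_sum_lip order_unit_space_sum mcomplete_sum qV qW
  by (simp add: quantum_metric_ous_def)

text \<open>
  Used for the two maps \<open>T (a, b) = (a, j a)\<close> and \<open>T (a, b) = (p b, b)\<close>, which move a point of the unit ball
  by at most \<open>\<parallel>b - j a\<parallel> \<le> \<epsilon>\<close>.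
\<close>

lemma mk_pullback_le:
  assumes \<phi>: "\<phi> \<in> states U"
    and T: "\<And>a b. a \<in> carrier V \<Longrightarrow> b \<in> carrier W \<Longrightarrow> T (a, b) \<in> carrier U \<and>
      norm_diff U (a, b) (T (a, b)) \<le> norm_diff W b (j a)"
    and \<psi>: "\<And>z. z \<in> carrier U \<Longrightarrow> \<psi> z = \<phi> (T z)"
  shows "mk U sum_lip \<phi> \<psi> \<le> ennreal \<epsilon>"
proof (rule mk_leI)
  fix z assume z: "z \<in> carrier U" "sum_lip z \<le> 1"
  then obtain a b where ab: "z = (a, b)" "a \<in> carrier V" "b \<in> carrier W" by (auto simp: carrier_sum)
  note Tz = T[OF ab(2,3), folded ab(1)]
  have "\<bar>\<phi> z - \<psi> z\<bar> = \<bar>\<phi> (z \<ominus>\<^bsub>U\<^esub> T z)\<bar>" using z Tz by (simp add: U.state_diff[OF \<phi>] \<psi>)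
  also have "\<dots> \<le> norm_diff U z (T z)" using z Tz by (intro U.state_le_norm[OF \<phi>]) auto
  also have "\<dots> \<le> \<epsilon>" using Tz z ab by (simp add: sum_lip_le_1_iff)
  finally show "\<bar>\<phi> z - \<psi> z\<bar> \<le> \<epsilon>" .
qed

lemma mk_section:
  assumes \<phi>: "\<phi> \<in> states U"
  shows "mk U sum_lip \<phi> (compose (carrier U) (section_state \<phi>) fst) \<le> ennreal \<epsilon>"
  by (rule mk_pullback_le[OF \<phi>, of "\<lambda>(a, b). (a, j a)"])
    (auto simp: compose_eq sum_simps diff_sum ou_norm_sum W.ou_norm_nonneg)

lemma mk_retract:
  assumes \<phi>: "\<phi> \<in> states U"
  shows "mk U sum_lip \<phi> (compose (carrier U) (retract_state \<phi>) snd) \<le> ennreal \<epsilon>"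
proof (rule mk_pullback_le[OF \<phi>, of "\<lambda>(a, b). (p b, b)"])
  fix a b assume ab: "a \<in> carrier V" "b \<in> carrier W"
  have "norm_diff V a (p b) = ou_norm V (p (b \<ominus>\<^bsub>W\<^esub> j a))"
    using ab by (simp add: p.diff retract V.ou_norm_diff_commute)
  also have "\<dots> \<le> norm_diff W b (j a)" using ab by (intro p.norm_le) auto
  finally show "(case (a, b) of (a, b) \<Rightarrow> (p b, b)) \<in> carrier U \<and>
      norm_diff U (a, b) (case (a, b) of (a, b) \<Rightarrow> (p b, b)) \<le> norm_diff W b (j a)"
    using ab by (simp add: carrier_sum diff_sum ou_norm_sum W.ou_norm_nonneg)
qed (auto simp: compose_eq carrier_sum)

abbreviation "left_image \<equiv> (\<lambda>\<phi>. compose (carrier U) \<phi> fst) ` states V"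
abbreviation "right_image \<equiv> (\<lambda>\<phi>. compose (carrier U) \<phi> snd) ` states W"

lemma left_image_states: "left_image \<subseteq> states U" and right_image_states: "right_image \<subseteq> states U"
  using ou_morphism.pullback_state[OF ou_morphism_fst] ou_morphism.pullback_state[OF ou_morphism_snd] by auto

lemma INF_left_image: "\<phi> \<in> states U \<Longrightarrow> (INF \<psi>\<in>left_image. mk U sum_lip \<phi> \<psi>) \<le> ennreal \<epsilon>"
  using section_state mk_section by (intro INF_lower2[OF imageI]) blast

lemma INF_right_image: "\<phi> \<in> states U \<Longrightarrow> (INF \<psi>\<in>right_image. mk U sum_lip \<phi> \<psi>) \<le> ennreal \<epsilon>"
  using retract_state mk_retract by (intro INF_lower2[OF imageI]) blast

lemma haus_left: "haus (mk U sum_lip) (states U) left_image \<le> ennreal \<epsilon>"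
  unfolding haus_def
proof (intro max.boundedI SUP_least)
  fix \<psi> assume "\<psi> \<in> left_image"
  then show "(INF \<phi>\<in>states U. mk U sum_lip \<phi> \<psi>) \<le> ennreal \<epsilon>"
    using left_image_states by (intro INF_lower2[of \<psi>]) auto
qed (rule INF_left_image)

lemma haus_right: "haus (mk U sum_lip) (states U) right_image \<le> ennreal \<epsilon>"
  unfolding haus_def
proof (intro max.boundedI SUP_least)
  fix \<psi> assume "\<psi> \<in> right_image"
  then show "(INF \<phi>\<in>states U. mk U sum_lip \<phi> \<psi>) \<le> ennreal \<epsilon>"
    using right_image_states by (intro INF_lower2[of \<psi>]) auto
qed (rule INF_right_image)

lemma haus_left_right: "haus (mk U sum_lip) left_image right_image \<le> ennreal \<epsilon>"
  unfolding haus_def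
proof (intro max.boundedI SUP_least)
  fix \<psi> assume "\<psi> \<in> right_image"
  then show "(INF \<phi>\<in>left_image. mk U sum_lip \<phi> \<psi>) \<le> ennreal \<epsilon>"
    using INF_left_image[of \<psi>] right_image_states by (subst mk_commute) auto
next
  fix \<phi> assume "\<phi> \<in> left_image"
  then show "(INF \<psi>\<in>right_image. mk U sum_lip \<phi> \<psi>) \<le> ennreal \<epsilon>"
    using left_image_states by (intro INF_right_image) auto
qed

end

theorem (in lip_retraction) dist_q_le: "dist_q V L\<^sub>V W L\<^sub>W \<le> ennreal \<epsilon>"
proof -
  interpret S: ous_direct_sum V W "ous_sum V W"
    by (rule ous_direct_sum_ous_sum) unfold_locales
  interpret lip_retraction_sum V W j p L\<^sub>V L\<^sub>W \<epsilon> "ous_sum V W" ..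
  have "admissible V L\<^sub>V W L\<^sub>W sum_lip"
    unfolding admissible_def using quantum_metric_sum sum_lip_quotient_left sum_lip_quotient_right by blast
  then show ?thesis
    unfolding dist_q_def using haus_left_right by (intro INF_lower2[of sum_lip]) auto
qed

section \<open>The limit of a tower of retractions\<close>

locale lip_tower =
  fixes V :: "nat \<Rightarrow> 'a ous" and \<alpha> P :: "nat \<Rightarrow> 'a \<Rightarrow> 'a" and L :: "nat \<Rightarrow> 'a \<Rightarrow> ennreal"
  assumes step: "lip_retraction (V n) (V (Suc n)) (\<alpha> n) (P n) (L n) (L (Suc n)) (1 / 2 ^ Suc n)"
begin

sublocale V: order_unit_space "V n" for n
  using step[of n] by (simp add: lip_retraction_def ou_morphism_def)

sublocale step: lip_retraction "V n" "V (Suc n)" "\<alpha> n" "P n" "L n" "L (Suc n)" "1 / 2 ^ Suc n" for n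
  by (rule step)

text \<open>
  The target index \<open>m\<close> is absolute, and \<open>up n m\<close> is the identity for \<open>m \<le> n\<close>, just as \<open>down n m\<close> is the
  identity for \<open>n \<le> m\<close>.  Thus \<open>up n m (down n m a)\<close> describes the image of \<open>a\<close> at every level \<open>m\<close>.
\<close>

primrec up :: "nat \<Rightarrow> nat \<Rightarrow> 'a \<Rightarrow> 'a" where
  "up n 0 a = a"
| "up n (Suc m) a = (if Suc m \<le> n then a else \<alpha> m (up n m a))"

primrec down :: "nat \<Rightarrow> nat \<Rightarrow> 'a \<Rightarrow> 'a" where
  "down 0 m a = a"
| "down (Suc n) m a = (if Suc n \<le> m then a else down n m (P n a))"

lemma up_id [simp]: "m \<le> n \<Longrightarrow> up n m a = a"
  by (cases m) auto

lemma down_id [simp]: "n \<le> m \<Longrightarrow> down n m a = a"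
  by (cases n) auto

lemma up_morphism: "n \<le> m \<Longrightarrow> ou_morphism (V n) (V m) (up n m)"
proof (induction m rule: dec_induct)
  case base
  then show ?case using ou_morphism_id[OF V.order_unit_space_axioms] by simp
next
  case (step m)
  then have "up n (Suc m) = (\<lambda>a. \<alpha> m (up n m a))" by (simp add: fun_eq_iff)
  then show ?case using ou_morphism_comp[OF step.IH step.j.ou_morphism_axioms] by simp
qed

lemma down_morphism: "m \<le> n \<Longrightarrow> ou_morphism (V n) (V m) (down n m)"
proof (induction n rule: dec_induct)
  case base
  then show ?case using ou_morphism_id[OF V.order_unit_space_axioms] by simp
next
  case (step n)
  then have "down (Suc n) m = (\<lambda>a. down n m (P n a))" by (simp add: fun_eq_iff)
  then show ?case using ou_morphism_comp[OF step.p.ou_morphism_axioms step.IH] by simp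
qed

lemma P_down: "Suc m \<le> n \<Longrightarrow> P m (down n (Suc m) a) = down n m a"
proof (induction n arbitrary: a)
  case (Suc n)
  then show ?case by (cases "m = n") auto
qed simp

lemma lip_up: "n \<le> m \<Longrightarrow> a \<in> carrier (V n) \<Longrightarrow> L m (up n m a) \<le> L n a"
proof (induction m rule: dec_induct)
  case (step m)
  then have "up n m a \<in> carrier (V m)" using ou_morphism.closed[OF up_morphism] by blast
  then have "L (Suc m) (\<alpha> m (up n m a)) \<le> L m (up n m a)" by (rule step.lip_j)
  then show ?case using step by (simp add: order_trans)
qed simp

lemma lip_down: "m \<le> n \<Longrightarrow> a \<in> carrier (V n) \<Longrightarrow> L m (down n m a) \<le> L n a"
proof (induction n arbitrary: a rule: dec_induct)
  case (step n)
  then have "L m (down n m (P n a)) \<le> L n (P n a)" by simp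
  also have "\<dots> \<le> L (Suc n) a" using step by (intro step.lip_p)
  finally show ?case using step by simp
qed simp

definition coherent :: "(nat \<Rightarrow> 'a) \<Rightarrow> bool" where
  "coherent x \<longleftrightarrow> (\<forall>n. x n \<in> carrier (V n) \<and> P n (x (Suc n)) = x n)"

text \<open>
  For coherent \<open>x\<close> this says that \<open>x\<close> lies in the norm closure of the images of the spaces \<open>V n\<close>.  The
  space of all bounded coherent sequences is larger in general, and the domain of the limit Lip-norm is
  contained in this closure.
\<close>

definition asymptotic :: "(nat \<Rightarrow> 'a) \<Rightarrow> bool" where
  "asymptotic x \<longleftrightarrow>
     (\<forall>e>0. \<exists>N. \<forall>n\<ge>N. \<forall>m\<ge>n. norm_diff (V m) (x m) (up n m (x n)) \<le> e)"

definition limit_ous :: "(nat \<Rightarrow> 'a) ous" where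
  "limit_ous = \<lparr>
     carrier = {x. coherent x \<and> asymptotic x},
     monoid.mult = (\<lambda>x y. x),
     one = (\<lambda>n. \<one>\<^bsub>V n\<^esub>),
     zero = (\<lambda>n. \<zero>\<^bsub>V n\<^esub>),
     add = (\<lambda>x y n. x n \<oplus>\<^bsub>V n\<^esub> y n),
     smult = (\<lambda>r x n. r \<odot>\<^bsub>V n\<^esub> x n),
     leq = (\<lambda>x y. \<forall>n. leq (V n) (x n) (y n)) \<rparr>"

abbreviation (input) "Q \<equiv> limit_ous"

lemma limit_simps:
  "x \<in> carrier Q \<longleftrightarrow> coherent x \<and> asymptotic x"
  "\<one>\<^bsub>Q\<^esub> = (\<lambda>n. \<one>\<^bsub>V n\<^esub>)"
  "\<zero>\<^bsub>Q\<^esub> = (\<lambda>n. \<zero>\<^bsub>V n\<^esub>)"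
  "x \<oplus>\<^bsub>Q\<^esub> y = (\<lambda>n. x n \<oplus>\<^bsub>V n\<^esub> y n)"
  "r \<odot>\<^bsub>Q\<^esub> x = (\<lambda>n. r \<odot>\<^bsub>V n\<^esub> x n)"
  "leq Q x y \<longleftrightarrow> (\<forall>n. leq (V n) (x n) (y n))"
  by (simp_all add: limit_ous_def)

lemma coherent_closed: "coherent x \<Longrightarrow> x n \<in> carrier (V n)"
  by (simp add: coherent_def)

lemma down_coherent:
  assumes x: "coherent x" shows "m \<le> n \<Longrightarrow> down n m (x n) = x m"
proof (induction n rule: dec_induct)
  case (step n)
  then show ?case using x by (simp add: coherent_def)
qed simp

lemma asymptotic_add_smult:
  assumes x: "coherent x" "asymptotic x" and y: "coherent y" "asymptotic y"
  shows "asymptotic (\<lambda>n. x n \<oplus>\<^bsub>V n\<^esub> r \<odot>\<^bsub>V n\<^esub> y n)"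
  unfolding asymptotic_def
proof (intro allI impI)
  fix e :: real assume e: "e > 0"
  define k where "k = e / 2 / (\<bar>r\<bar> + 1)"
  have cancel: "(\<bar>r\<bar> + 1) * (t / (\<bar>r\<bar> + 1)) = t" for t :: real by simp
  have k: "k > 0" using e by (simp add: k_def add_nonneg_pos)
  obtain M N where
    M: "\<forall>n\<ge>M. \<forall>m\<ge>n. norm_diff (V m) (x m) (up n m (x n)) \<le> e / 2" and
    N: "\<forall>n\<ge>N. \<forall>m\<ge>n. norm_diff (V m) (y m) (up n m (y n)) \<le> k"
    using x y e k unfolding asymptotic_def by (meson half_gt_zero)
  show "\<exists>N. \<forall>n\<ge>N. \<forall>m\<ge>n. ou_norm (V m)
      ((x m \<oplus>\<^bsub>V m\<^esub> r \<odot>\<^bsub>V m\<^esub> y m) \<ominus>\<^bsub>V m\<^esub> up n m (x n \<oplus>\<^bsub>V n\<^esub> r \<odot>\<^bsub>V n\<^esub> y n)) \<le> e"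
  proof (intro exI[of _ "max M N"] allI impI)
    fix n m assume nm: "max M N \<le> n" "n \<le> m"
    interpret u: ou_morphism "V n" "V m" "up n m" by (rule up_morphism[OF nm(2)])
    note c = coherent_closed[OF x(1)] coherent_closed[OF y(1)]
    let ?x = "x m \<ominus>\<^bsub>V m\<^esub> up n m (x n)" and ?y = "y m \<ominus>\<^bsub>V m\<^esub> up n m (y n)"
    have "(x m \<oplus>\<^bsub>V m\<^esub> r \<odot>\<^bsub>V m\<^esub> y m) \<ominus>\<^bsub>V m\<^esub> up n m (x n \<oplus>\<^bsub>V n\<^esub> r \<odot>\<^bsub>V n\<^esub> y n) = ?x \<oplus>\<^bsub>V m\<^esub> r \<odot>\<^bsub>V m\<^esub> ?y"
      using c by (simp add: u.add u.smult V.add_diff_add V.smult_diff_right)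
    also have "ou_norm (V m) \<dots> \<le> ou_norm (V m) ?x + \<bar>r\<bar> * ou_norm (V m) ?y"
      using c V.ou_norm_add[of ?x m "r \<odot>\<^bsub>V m\<^esub> ?y"] by (simp add: V.ou_norm_smult)
    also have "\<dots> \<le> e / 2 + (\<bar>r\<bar> + 1) * k"
      using M N nm c k by (intro add_mono mult_mono) (auto simp: V.ou_norm_nonneg)
    also have "(\<bar>r\<bar> + 1) * k = e / 2"
      unfolding k_def by (rule cancel)
    finally show "ou_norm (V m)
      ((x m \<oplus>\<^bsub>V m\<^esub> r \<odot>\<^bsub>V m\<^esub> y m) \<ominus>\<^bsub>V m\<^esub> up n m (x n \<oplus>\<^bsub>V n\<^esub> r \<odot>\<^bsub>V n\<^esub> y n)) \<le> e" by simp
  qed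
qed

lemma asymptotic_add:
  assumes "coherent x" "asymptotic x" "coherent y" "asymptotic y"
  shows "asymptotic (\<lambda>n. x n \<oplus>\<^bsub>V n\<^esub> y n)"
  using asymptotic_add_smult[OF assms, of 1] coherent_closed[OF assms(3)] by simp

lemma asymptotic_smult:
  assumes x: "coherent x" "asymptotic x"
  shows "asymptotic (\<lambda>n. r \<odot>\<^bsub>V n\<^esub> x n)"
proof -
  have "x n \<oplus>\<^bsub>V n\<^esub> (r - 1) \<odot>\<^bsub>V n\<^esub> x n = r \<odot>\<^bsub>V n\<^esub> x n" for n
    using V.smult_add_left[of "x n" n 1 "r - 1"] coherent_closed[OF x(1)] by simp
  then show ?thesis using asymptotic_add_smult[OF x x, of "r - 1"] by simp
qed

lemma coherent_add: "coherent x \<Longrightarrow> coherent y \<Longrightarrow> coherent (\<lambda>n. x n \<oplus>\<^bsub>V n\<^esub> y n)"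
  by (simp add: coherent_def step.p.add)

lemma coherent_smult: "coherent x \<Longrightarrow> coherent (\<lambda>n. r \<odot>\<^bsub>V n\<^esub> x n)"
  by (simp add: coherent_def step.p.smult)

lemma coherent_unit: "coherent (\<lambda>n. \<one>\<^bsub>V n\<^esub>)"
  by (simp add: coherent_def step.p.unit)

lemma asymptotic_unit: "asymptotic (\<lambda>n. \<one>\<^bsub>V n\<^esub>)"
proof -
  have "n \<le> m \<Longrightarrow> up n m \<one>\<^bsub>V n\<^esub> = \<one>\<^bsub>V m\<^esub>" for n m
    using ou_morphism.unit[OF up_morphism] .
  then show ?thesis by (auto simp: asymptotic_def)
qed

text \<open>
  Beyond a level \<open>N\<close> the sequence stays within distance \<open>1\<close> of the image of \<open>x N\<close>; below \<open>N\<close> it consists of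
  images of \<open>x N\<close> under contractions.
\<close>

lemma limit_bounded:
  assumes x: "coherent x" "asymptotic x"
  obtains r where "r > 0" "\<And>n. ou_norm (V n) (x n) \<le> r"
proof -
  obtain N where N: "\<forall>n\<ge>N. \<forall>m\<ge>n. norm_diff (V m) (x m) (up n m (x n)) \<le> 1"
    using x unfolding asymptotic_def by (meson zero_less_one)
  note c = coherent_closed[OF x(1)]
  show ?thesis
  proof (rule that[of "1 + ou_norm (V N) (x N)"])
    fix m
    show "ou_norm (V m) (x m) \<le> 1 + ou_norm (V N) (x N)"
    proof (cases "N \<le> m")
      case True
      interpret u: ou_morphism "V N" "V m" "up N m" by (rule up_morphism[OF True])
      have "ou_norm (V m) (x m) \<le> norm_diff (V m) (x m) (up N m (x N)) + ou_norm (V m) (up N m (x N))"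
        using V.ou_norm_diff_triangle[of "x m" m "up N m (x N)" "\<zero>\<^bsub>V m\<^esub>"] c
        by (simp add: V.minus_eq)
      also have "\<dots> \<le> 1 + ou_norm (V N) (x N)"
        using N True c by (intro add_mono u.norm_le) auto
      finally show ?thesis .
    next
      case False
      then have "ou_norm (V m) (down N m (x N)) \<le> ou_norm (V N) (x N)"
        using c by (intro ou_morphism.norm_le[OF down_morphism]) auto
      then show ?thesis using False down_coherent[OF x(1), of m N] by simp
    qed
  qed (use V.ou_norm_nonneg[OF c] in \<open>simp add: add_pos_nonneg\<close>)
qed

lemma order_unit_space_limit: "order_unit_space Q"
proof (rule order_unit_space.intro)
  have zero: "coherent (\<lambda>n. \<zero>\<^bsub>V n\<^esub>)" "asymptotic (\<lambda>n. \<zero>\<^bsub>V n\<^esub>)"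
    using coherent_smult[OF coherent_unit, of 0] asymptotic_smult[OF coherent_unit asymptotic_unit, of 0]
    by simp_all
  have "abelian_group Q"
  proof (rule abelian_groupI)
    fix x assume "x \<in> carrier Q"
    then show "\<exists>y\<in>carrier Q. y \<oplus>\<^bsub>Q\<^esub> x = \<zero>\<^bsub>Q\<^esub>"
      by (intro bexI[of _ "\<lambda>n. (- 1) \<odot>\<^bsub>V n\<^esub> x n"])
        (simp add: limit_simps coherent_closed V.smult_minus_left V.l_neg,
          simp add: limit_simps coherent_smult asymptotic_smult)
  qed (auto simp: limit_simps coherent_closed V.a_assoc zero coherent_add asymptotic_add intro!: ext V.a_comm)
  then show "Module.module (ring_of_type_algebra :: real ring) Q"
    by (intro moduleI cring_from_type_algebra)
      (auto simp: limit_simps coherent_closed V.smult_add_left V.smult_add_right V.smult_smult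
        coherent_smult asymptotic_smult)
next
  fix x assume "x \<in> carrier Q"
  then have x: "coherent x" "asymptotic x" by (auto simp: limit_simps)
  obtain r where "r > 0" "\<And>n. ou_norm (V n) (x n) \<le> r" using limit_bounded[OF x] by blast
  then show "\<exists>r>0. leq Q ((- r) \<odot>\<^bsub>Q\<^esub> \<one>\<^bsub>Q\<^esub>) x \<and> leq Q x (r \<odot>\<^bsub>Q\<^esub> \<one>\<^bsub>Q\<^esub>)"
    using coherent_closed[OF x(1)]
    by (intro exI[of _ r]) (auto simp: limit_simps V.ou_norm_le_iff V.leq_neg_unit_iff)
next
  fix x assume "x \<in> carrier Q" and *: "\<And>r. r > 0 \<Longrightarrow> leq Q x (r \<odot>\<^bsub>Q\<^esub> \<one>\<^bsub>Q\<^esub>)"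
  then show "leq Q x \<zero>\<^bsub>Q\<^esub>"
    by (auto simp: limit_simps coherent_closed intro!: V.archimedean)
next
  show "\<one>\<^bsub>Q\<^esub> \<in> carrier Q"
    by (simp add: limit_simps coherent_unit asymptotic_unit)
next
  fix x assume "x \<in> carrier Q"
  then show "leq Q x x" by (simp add: limit_simps coherent_closed V.leq_refl)
next
  fix x y z assume c: "x \<in> carrier Q" "y \<in> carrier Q" "z \<in> carrier Q" and l: "leq Q x y"
  note c' = c[unfolded limit_simps, THEN conjunct1, THEN coherent_closed]
  show "leq Q y z \<Longrightarrow> leq Q x z"
    using l V.leq_trans[OF c'(1) c'(2) c'(3)] by (simp add: limit_simps)
  show "leq Q (x \<oplus>\<^bsub>Q\<^esub> z) (y \<oplus>\<^bsub>Q\<^esub> z)"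
    using l V.leq_add[OF c'(1) c'(2) c'(3)] by (simp add: limit_simps)
next
  fix x y assume c: "x \<in> carrier Q" "y \<in> carrier Q" and l: "leq Q x y"
  note c' = c[unfolded limit_simps, THEN conjunct1, THEN coherent_closed]
  show "leq Q y x \<Longrightarrow> x = y"
    using l V.leq_antisym[OF c'(1) c'(2)] by (simp add: limit_simps fun_eq_iff)
  show "leq Q (r \<odot>\<^bsub>Q\<^esub> x) (r \<odot>\<^bsub>Q\<^esub> y)" if "0 \<le> r" for r
    using l that V.leq_smult[OF c'(1) c'(2)] by (simp add: limit_simps)
qed

sublocale Q: order_unit_space Q
  by (rule order_unit_space_limit)

lemma coord_morphism: "ou_morphism Q (V n) (\<lambda>x. x n)"
  by unfold_locales (auto simp: limit_simps coherent_closed)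

sublocale coord: ou_morphism Q "V n" "\<lambda>x. x n" for n
  by (rule coord_morphism)

lemma limit_norm_le_iff:
  assumes x: "x \<in> carrier Q"
  shows "ou_norm Q x \<le> r \<longleftrightarrow> (\<forall>n. ou_norm (V n) (x n) \<le> r)"
proof
  assume "ou_norm Q x \<le> r"
  then show "\<forall>n. ou_norm (V n) (x n) \<le> r"
    using coord.norm_le[OF x] order_trans by blast
next
  assume *: "\<forall>n. ou_norm (V n) (x n) \<le> r"
  have c: "x n \<in> carrier (V n)" for n using x by (rule coord.closed)
  show "ou_norm Q x \<le> r"
    using * x c Q.leq_neg_unit_iff[OF x, of r]
    by (auto simp: Q.ou_norm_le_iff V.ou_norm_le_iff limit_simps V.leq_neg_unit_iff)
qed

definition emb :: "nat \<Rightarrow> 'a \<Rightarrow> nat \<Rightarrow> 'a" where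
  "emb n a m = up n m (down n m a)"

lemma emb_up: "n \<le> m \<Longrightarrow> emb n a m = up n m a"
  and emb_down: "m \<le> n \<Longrightarrow> emb n a m = down n m a"
  by (simp_all add: emb_def)

lemma emb_coord: "ou_morphism (V n) (V m) (\<lambda>a. emb n a m)"
  by (cases "n \<le> m") (simp_all add: emb_up emb_down up_morphism down_morphism)

lemma up_up: "n \<le> k \<Longrightarrow> k \<le> m \<Longrightarrow> up k m (up n k a) = up n m a"
  by (induction m) (auto simp: le_Suc_eq)

lemma emb_closed:
  assumes a: "a \<in> carrier (V n)" shows "emb n a \<in> carrier Q"
proof -
  have c: "emb n a m \<in> carrier (V m)" for m
    using ou_morphism.closed[OF emb_coord a] .
  have "P m (emb n a (Suc m)) = emb n a m" for m
  proof (cases "n \<le> m")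
    case True
    then have "up n m a \<in> carrier (V m)" using c[of m] by (simp add: emb_up)
    then show ?thesis using True by (simp add: emb_up step.retract)
  qed (simp add: emb_down P_down)
  then have "coherent (emb n a)" using c by (simp add: coherent_def)
  moreover have "asymptotic (emb n a)"
    unfolding asymptotic_def
  proof (intro allI impI exI[of _ n])
    fix e :: real and k m assume "0 < e" "n \<le> k" "k \<le> m"
    then have "up k m (emb n a k) = emb n a m" by (simp add: emb_up up_up)
    then show "norm_diff (V m) (emb n a m) (up k m (emb n a k)) \<le> e"
      using c \<open>0 < e\<close> by simp
  qed
  ultimately show ?thesis by (simp add: limit_simps)
qed

lemma emb_morphism: "ou_morphism (V n) Q (emb n)"
proof
  fix a b r assume a: "a \<in> carrier (V n)"
  show "emb n a \<in> carrier Q" by (rule emb_closed[OF a])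
  show "emb n (r \<odot>\<^bsub>V n\<^esub> a) = r \<odot>\<^bsub>Q\<^esub> emb n a"
    using ou_morphism.smult[OF emb_coord a] by (simp add: limit_simps fun_eq_iff)
  show "b \<in> carrier (V n) \<Longrightarrow> emb n (a \<oplus>\<^bsub>V n\<^esub> b) = emb n a \<oplus>\<^bsub>Q\<^esub> emb n b"
    using ou_morphism.add[OF emb_coord a] by (simp add: limit_simps fun_eq_iff)
  show "leq (V n) \<zero>\<^bsub>V n\<^esub> a \<Longrightarrow> leq Q \<zero>\<^bsub>Q\<^esub> (emb n a)"
    using ou_morphism.pos[OF emb_coord a] by (simp add: limit_simps)
next
  show "emb n \<one>\<^bsub>V n\<^esub> = \<one>\<^bsub>Q\<^esub>"
    using ou_morphism.unit[OF emb_coord] by (simp add: limit_simps fun_eq_iff)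
qed

sublocale emb: ou_morphism "V n" Q "emb n" for n
  by (rule emb_morphism)

lemma diff_coord: "x \<in> carrier Q \<Longrightarrow> y \<in> carrier Q \<Longrightarrow> (x \<ominus>\<^bsub>Q\<^esub> y) n = x n \<ominus>\<^bsub>V n\<^esub> y n"
  using coord.diff .

lemma norm_diff_emb_le_iff:
  assumes x: "x \<in> carrier Q" and r: "0 \<le> r"
  shows "norm_diff Q x (emb n (x n)) \<le> r \<longleftrightarrow>
    (\<forall>m\<ge>n. norm_diff (V m) (x m) (up n m (x n)) \<le> r)"
proof -
  have c: "x n \<in> carrier (V n)" for n using x by (rule coord.closed)
  have "norm_diff (V m) (x m) (emb n (x n) m) = 0" if "m \<le> n" for m
    using that x c down_coherent[of x m n] by (simp add: emb_down limit_simps)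
  then show ?thesis
    using x c r by (simp add: limit_norm_le_iff diff_coord)
      (metis emb_up nat_le_linear)
qed

lemma mcomplete_limit: "Metric_space.mcomplete (carrier Q) (ou_dist Q)"
  unfolding Q.ou_mcomplete_iff
proof (intro allI impI)
  fix s :: "nat \<Rightarrow> nat \<Rightarrow> 'a"
  assume s: "\<forall>k. s k \<in> carrier Q"
    and cauchy: "\<forall>e>0. \<exists>M. \<forall>k\<ge>M. \<forall>l\<ge>M. norm_diff Q (s k) (s l) < e"
  have sc: "s k n \<in> carrier (V n)" for k n using s coord.closed by blast
  have cauchy': "\<exists>M. \<forall>k\<ge>M. \<forall>l\<ge>M. \<forall>n. norm_diff (V n) (s k n) (s l n) < e" if e: "e > 0" for e
  proof -
    obtain M where M: "\<forall>k\<ge>M. \<forall>l\<ge>M. norm_diff Q (s k) (s l) < e"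
      using cauchy e by blast
    have "norm_diff (V n) (s k n) (s l n) \<le> norm_diff Q (s k) (s l)" for k l n
      using coord.norm_le[of "s k \<ominus>\<^bsub>Q\<^esub> s l" n] s by (simp add: diff_coord)
    then show ?thesis using M le_less_trans by blast
  qed
  have "\<exists>x\<in>carrier (V n). \<forall>e>0. \<exists>M. \<forall>k\<ge>M. norm_diff (V n) (s k n) x < e" for n
  proof -
    have "Metric_space.mcomplete (carrier (V n)) (ou_dist (V n))"
      using step.qV by (simp add: quantum_metric_ous_def)
    from this[unfolded V.ou_mcomplete_iff, THEN spec[of _ "\<lambda>k. s k n"], THEN mp, THEN mp]
    show ?thesis using sc cauchy' by meson
  qed
  then obtain x where xc: "\<And>n. x n \<in> carrier (V n)"
    and x: "\<And>n e. e > 0 \<Longrightarrow> \<exists>M. \<forall>k\<ge>M. norm_diff (V n) (s k n) (x n) < e"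
    by metis
  have unif: "\<exists>M. \<forall>k\<ge>M. \<forall>n. norm_diff (V n) (s k n) (x n) \<le> e" if e: "e > 0" for e
  proof -
    obtain M where M: "\<forall>k\<ge>M. \<forall>l\<ge>M. \<forall>n. norm_diff (V n) (s k n) (s l n) < e / 2"
      using cauchy'[of "e / 2"] e by auto
    have "norm_diff (V n) (s k n) (x n) \<le> e" if k: "k \<ge> M" for k n
    proof -
      obtain N where N: "\<forall>l\<ge>N. norm_diff (V n) (s l n) (x n) < e / 2"
        using x[of "e / 2" n] e by auto
      have "norm_diff (V n) (s k n) (x n) \<le>
          norm_diff (V n) (s k n) (s (max M N) n) + norm_diff (V n) (s (max M N) n) (x n)"
        using sc xc by (intro V.ou_norm_diff_triangle)
      also have "\<dots> \<le> e / 2 + e / 2"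
        using M N k by (intro add_mono less_imp_le) auto
      finally show ?thesis by simp
    qed
    then show ?thesis by blast
  qed
  have "P n (x (Suc n)) = x n" for n
  proof -
    have "norm_diff (V n) (P n (x (Suc n))) (x n) \<le> 0 + e" if e: "e > 0" for e
    proof -
      obtain k where k: "\<forall>n. norm_diff (V n) (s k n) (x n) \<le> e / 2"
        using unif[of "e / 2"] e by auto
      have Ps: "P n (s k (Suc n)) = s k n" using s by (simp add: limit_simps coherent_def)
      have "norm_diff (V n) (P n (x (Suc n))) (x n) \<le>
          norm_diff (V n) (P n (x (Suc n))) (s k n) + norm_diff (V n) (s k n) (x n)"
        using sc xc by (intro V.ou_norm_diff_triangle) auto
      also have "P n (x (Suc n)) \<ominus>\<^bsub>V n\<^esub> s k n = P n (x (Suc n) \<ominus>\<^bsub>V (Suc n)\<^esub> s k (Suc n))"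
        using sc xc by (simp add: step.p.diff Ps)
      also have "ou_norm (V n) \<dots> \<le> norm_diff (V (Suc n)) (x (Suc n)) (s k (Suc n))"
        using sc xc by (intro step.p.norm_le) auto
      also have "\<dots> = norm_diff (V (Suc n)) (s k (Suc n)) (x (Suc n))"
        using sc xc by (intro V.ou_norm_diff_commute)
      finally show ?thesis using k[rule_format, of "Suc n"] k[rule_format, of n] by linarith
    qed
    then have "norm_diff (V n) (P n (x (Suc n))) (x n) \<le> 0" by (rule field_le_epsilon)
    then have "norm_diff (V n) (P n (x (Suc n))) (x n) = 0"
      using V.ou_norm_nonneg[of "P n (x (Suc n)) \<ominus>\<^bsub>V n\<^esub> x n" n] xc by simp
    then show ?thesis using xc by (simp add: V.ou_norm_eq_zero_iff V.diff_eq_zero_iff)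
  qed
  then have coh: "coherent x" using xc by (simp add: coherent_def)
  have asy: "asymptotic x"
    unfolding asymptotic_def
  proof (intro allI impI)
    fix e :: real assume e: "e > 0"
    obtain k where k: "\<forall>n. norm_diff (V n) (s k n) (x n) \<le> e / 3"
      using unif[of "e / 3"] e by auto
    have "asymptotic (s k)" using s by (simp add: limit_simps)
    then obtain N where N: "\<forall>n\<ge>N. \<forall>m\<ge>n. norm_diff (V m) (s k m) (up n m (s k n)) \<le> e / 3"
      using e unfolding asymptotic_def by (meson divide_pos_pos zero_less_numeral)
    show "\<exists>N. \<forall>n\<ge>N. \<forall>m\<ge>n. norm_diff (V m) (x m) (up n m (x n)) \<le> e"
    proof (intro exI[of _ N] allI impI)
      fix n m assume nm: "N \<le> n" "n \<le> m"
      interpret u: ou_morphism "V n" "V m" "up n m" by (rule up_morphism[OF nm(2)])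
      have "norm_diff (V m) (x m) (up n m (x n)) \<le>
          norm_diff (V m) (x m) (s k m) + norm_diff (V m) (s k m) (up n m (x n))"
        using sc xc by (intro V.ou_norm_diff_triangle) auto
      moreover have "norm_diff (V m) (s k m) (up n m (x n)) \<le>
          norm_diff (V m) (s k m) (up n m (s k n)) + norm_diff (V m) (up n m (s k n)) (up n m (x n))"
        using sc xc by (intro V.ou_norm_diff_triangle) auto
      moreover have "norm_diff (V m) (up n m (s k n)) (up n m (x n)) \<le> norm_diff (V n) (s k n) (x n)"
        using u.norm_le[of "s k n \<ominus>\<^bsub>V n\<^esub> x n"] sc xc by (simp add: u.diff)
      moreover have "norm_diff (V m) (x m) (s k m) = norm_diff (V m) (s k m) (x m)"
        using sc xc by (intro V.ou_norm_diff_commute)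
      moreover have "norm_diff (V m) (s k m) (up n m (s k n)) \<le> e / 3"
        using N nm by blast
      ultimately show "norm_diff (V m) (x m) (up n m (x n)) \<le> e"
        using k[rule_format, of n] k[rule_format, of m] by linarith
    qed
  qed
  have xQ: "x \<in> carrier Q" using coh asy by (simp add: limit_simps)
  show "\<exists>x\<in>carrier Q. \<forall>e>0. \<exists>M. \<forall>k\<ge>M. norm_diff Q (s k) x < e"
  proof (intro bexI[OF _ xQ] allI impI)
    fix e :: real assume e: "e > 0"
    obtain M where M: "\<forall>k\<ge>M. \<forall>n. norm_diff (V n) (s k n) (x n) \<le> e / 2"
      using unif[of "e / 2"] e by auto
    have "norm_diff Q (s k) x \<le> e / 2" if "k \<ge> M" for k
      using M that s xQ by (subst limit_norm_le_iff) (auto simp: diff_coord)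
    then show "\<exists>M. \<forall>k\<ge>M. norm_diff Q (s k) x < e"
      using e by (intro exI[of _ M]) fastforce
  qed
qed

definition limit_lip :: "(nat \<Rightarrow> 'a) \<Rightarrow> ennreal" where
  "limit_lip x = (SUP n. L n (x n))"

lemma lip_V: "lip_norm (V n) (L n)"
  using step.qV by (simp add: quantum_metric_ous_def)

lemma limit_lip_emb: "a \<in> carrier (V n) \<Longrightarrow> limit_lip (emb n a) \<le> L n a"
  unfolding limit_lip_def
proof (rule SUP_least)
  fix m assume "a \<in> carrier (V n)"
  then show "L m (emb n a m) \<le> L n a"
    using lip_up[of n m a] lip_down[of m n a] by (cases "n \<le> m") (auto simp: emb_up emb_down)
qed

lemma coord_lip: "L n (x n) \<le> limit_lip x"
  unfolding limit_lip_def by (rule SUP_upper) simp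

text \<open>
  A telescoping sum: by the retraction from level \<open>m + 1\<close> to level \<open>m\<close>, the step between these levels
  costs at most \<open>l / 2 ^ (m + 1)\<close>.
\<close>

lemma up_approx:
  assumes x: "x \<in> carrier Q" and l: "limit_lip x \<le> ennreal l" "0 \<le> l"
  shows "n \<le> m \<Longrightarrow> norm_diff (V m) (x m) (up n m (x n)) \<le> l * (1 / 2 ^ n - 1 / 2 ^ m)"
proof (induction m rule: dec_induct)
  case base
  have "x n \<in> carrier (V n)" using x by (rule coord.closed)
  then show ?case by simp
next
  case (step m)
  interpret u: ou_morphism "V n" "V m" "up n m" by (rule up_morphism) (use step in simp)
  have c: "x n \<in> carrier (V n)" for n using x by (rule coord.closed)
  have P: "P m (x (Suc m)) = x m" using x by (simp add: limit_simps coherent_def)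
  have "ennreal (norm_diff (V (Suc m)) (x (Suc m)) (\<alpha> m (x m)) / (1 / 2 ^ Suc m)) \<le> L (Suc m) (x (Suc m))"
    using step.approx[OF c[of "Suc m"]] P by simp
  also have "\<dots> \<le> limit_lip x" by (rule coord_lip)
  also have "\<dots> \<le> ennreal l" by (rule l)
  finally have "norm_diff (V (Suc m)) (x (Suc m)) (\<alpha> m (x m)) \<le> l * (1 / 2 ^ Suc m)"
    using l(2) by (simp add: field_simps)
  moreover have "norm_diff (V (Suc m)) (\<alpha> m (x m)) (\<alpha> m (up n m (x n))) \<le> l * (1 / 2 ^ n - 1 / 2 ^ m)"
    using step.IH step.j.norm_le[of "x m \<ominus>\<^bsub>V m\<^esub> up n m (x n)" m] c by (simp add: step.j.diff)
  moreover have "norm_diff (V (Suc m)) (x (Suc m)) (\<alpha> m (up n m (x n))) \<le>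
      norm_diff (V (Suc m)) (x (Suc m)) (\<alpha> m (x m))
      + norm_diff (V (Suc m)) (\<alpha> m (x m)) (\<alpha> m (up n m (x n)))"
    using c by (intro V.ou_norm_diff_triangle) auto
  ultimately have "norm_diff (V (Suc m)) (x (Suc m)) (\<alpha> m (up n m (x n))) \<le>
      l * (1 / 2 ^ Suc m) + l * (1 / 2 ^ n - 1 / 2 ^ m)" by linarith
  also have "\<dots> = l * (1 / 2 ^ n - 1 / 2 ^ Suc m)" by (simp add: field_simps)
  finally show ?case using step by simp
qed

lemma emb_approx:
  assumes x: "x \<in> carrier Q" and l: "limit_lip x \<le> ennreal l" "0 \<le> l"
  shows "norm_diff Q x (emb n (x n)) \<le> l / 2 ^ n"
proof -
  have "norm_diff (V m) (x m) (up n m (x n)) \<le> l / 2 ^ n" if "n \<le> m" for m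
  proof -
    have "l * (1 / 2 ^ n - 1 / 2 ^ m) \<le> l * (1 / 2 ^ n)"
      using l by (intro mult_left_mono) auto
    then show ?thesis using up_approx[OF x l that] by simp
  qed
  then show ?thesis using x l by (simp add: norm_diff_emb_le_iff)
qed

text \<open>
  Replacing \<open>x\<close> by the image of its coordinate \<open>x n\<close> changes the value of each of the two states by at most
  \<open>1 / 2 ^ n\<close>.
\<close>

lemma mk_limit_le:
  assumes \<phi>: "\<phi> \<in> states Q" and \<psi>: "\<psi> \<in> states Q" and y: "0 \<le> y"
    and mk: "mk (V n) (L n) (compose (carrier (V n)) \<phi> (emb n)) (compose (carrier (V n)) \<psi> (emb n)) \<le> ennreal y"
  shows "mk Q limit_lip \<phi> \<psi> \<le> ennreal (y + 2 / 2 ^ n)"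
proof (rule mk_leI)
  fix x assume x: "x \<in> carrier Q" and L1: "limit_lip x \<le> 1"
  have c: "x n \<in> carrier (V n)" using x by (rule coord.closed)
  have Ln: "L n (x n) \<le> 1" using coord_lip L1 by (rule order_trans)
  have e: "norm_diff Q x (emb n (x n)) \<le> 1 / 2 ^ n"
    using emb_approx[OF x, of 1] L1 by simp
  have "\<bar>\<chi>' x - \<chi>' (emb n (x n))\<bar> \<le> 1 / 2 ^ n" if "\<chi>' \<in> states Q" for \<chi>'
    using Q.state_le_norm[OF that, of "x \<ominus>\<^bsub>Q\<^esub> emb n (x n)"] e x c by (simp add: Q.state_diff[OF that])
  from this[OF \<phi>] this[OF \<psi>]
  have "\<bar>\<phi> x - \<phi> (emb n (x n))\<bar> \<le> 1 / 2 ^ n" "\<bar>\<psi> x - \<psi> (emb n (x n))\<bar> \<le> 1 / 2 ^ n" .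
  moreover have "\<bar>\<phi> (emb n (x n)) - \<psi> (emb n (x n))\<bar> \<le> y"
    using mk_leD[OF mk y c Ln] c by (simp add: compose_eq)
  ultimately show "\<bar>\<phi> x - \<psi> x\<bar> \<le> y + 2 / 2 ^ n" by linarith
qed

theorem lip_norm_limit: "lip_norm Q limit_lip"
proof (rule Q.lip_normI)
  show "ou_seminorm Q limit_lip"
    unfolding ou_seminorm_def
  proof (intro conjI ballI allI)
    fix x y assume xy: "x \<in> carrier Q" "y \<in> carrier Q"
    show "limit_lip (x \<oplus>\<^bsub>Q\<^esub> y) \<le> limit_lip x + limit_lip y"
      unfolding limit_lip_def[of "x \<oplus>\<^bsub>Q\<^esub> y"]
    proof (rule SUP_least)
      fix n
      have "L n (x n \<oplus>\<^bsub>V n\<^esub> y n) \<le> L n (x n) + L n (y n)"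
        using V.lip_normD(1)[OF lip_V[of n]] coord.closed[OF xy(1)] coord.closed[OF xy(2)]
        by (auto simp: ou_seminorm_def)
      also have "\<dots> \<le> limit_lip x + limit_lip y" by (intro add_mono coord_lip)
      finally show "L n ((x \<oplus>\<^bsub>Q\<^esub> y) n) \<le> limit_lip x + limit_lip y"
        by (simp add: limit_simps)
    qed
  next
    fix r x assume x: "x \<in> carrier Q"
    have "L n ((r \<odot>\<^bsub>Q\<^esub> x) n) = ennreal \<bar>r\<bar> * L n (x n)" for n
      using V.lip_normD(1)[OF lip_V[of n]] coord.closed[OF x] by (auto simp: ou_seminorm_def limit_simps)
    then show "limit_lip (r \<odot>\<^bsub>Q\<^esub> x) = ennreal \<bar>r\<bar> * limit_lip x"
      by (simp add: limit_lip_def SUP_mult_left_ennreal)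
  qed
next
  fix x and e :: real assume x: "x \<in> carrier Q" and e: "e > 0"
  then obtain n where "\<forall>m\<ge>n. norm_diff (V m) (x m) (up n m (x n)) \<le> e / 2"
    unfolding limit_simps asymptotic_def by (meson half_gt_zero order_refl)
  then have 1: "norm_diff Q x (emb n (x n)) \<le> e / 2"
    using x e by (subst norm_diff_emb_le_iff) auto
  have c: "x n \<in> carrier (V n)" using x by (rule coord.closed)
  obtain a where a: "a \<in> carrier (V n)" "L n a < \<infinity>" "norm_diff (V n) (x n) a < e / 2"
    using V.lip_normD(2)[OF lip_V c, of "e / 2"] e by auto
  have "norm_diff Q (emb n (x n)) (emb n a) < e / 2"
    using emb.norm_le[of "x n \<ominus>\<^bsub>V n\<^esub> a" n] a c by (simp add: emb.diff)
  with 1 have "norm_diff Q x (emb n a) < e"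
    using Q.ou_norm_diff_triangle[of x "emb n (x n)" "emb n a"] x a c by auto
  then show "\<exists>y\<in>carrier Q. limit_lip y < \<infinity> \<and> norm_diff Q x y < e"
    using a limit_lip_emb[OF a(1)] by (intro bexI[of _ "emb n a"]) (auto intro: le_less_trans)
next
  fix x assume x: "x \<in> carrier Q" "limit_lip x = 0"
  have c: "x n \<in> carrier (V n)" for n using x by (intro coord.closed)
  \<comment> \<open>the coordinate at level 0 is a scalar, and with Lip-norm 0 there is no loss in passing to level \<open>m\<close>\<close>
  have "L 0 (x 0) = 0" using coord_lip[of 0 x] x by simp
  then obtain r where r: "x 0 = r \<odot>\<^bsub>V 0\<^esub> \<one>\<^bsub>V 0\<^esub>" using V.lip_normD(3)[OF lip_V c] by blast
  have "x m = r \<odot>\<^bsub>V m\<^esub> \<one>\<^bsub>V m\<^esub>" for m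
  proof -
    interpret u: ou_morphism "V 0" "V m" "up 0 m" by (rule up_morphism) simp
    have "norm_diff (V m) (x m) (up 0 m (x 0)) \<le> 0"
      using up_approx[OF x(1), of 0 0 m] x by simp
    then have "norm_diff (V m) (x m) (up 0 m (x 0)) = 0"
      using V.ou_norm_nonneg[of "x m \<ominus>\<^bsub>V m\<^esub> up 0 m (x 0)" m] c by simp
    then show ?thesis
      using c by (simp add: V.ou_norm_eq_zero_iff V.diff_eq_zero_iff r u.smult u.unit)
  qed
  then show "\<exists>r. x = r \<odot>\<^bsub>Q\<^esub> \<one>\<^bsub>Q\<^esub>" by (auto simp: limit_simps)
next
  show "limit_lip \<one>\<^bsub>Q\<^esub> = 0"
    using V.lip_normD(4)[OF lip_V] by (simp add: limit_lip_def limit_simps)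
next
  fix \<phi> \<psi> assume s: "\<phi> \<in> states Q" "\<psi> \<in> states Q"
  let ?d = "mk (V 0) (L 0) (compose (carrier (V 0)) \<phi> (emb 0)) (compose (carrier (V 0)) \<psi> (emb 0))"
  have "?d < \<infinity>"
    using V.lip_normD(5)[OF lip_V] emb.pullback_state s by blast
  then have "mk Q limit_lip \<phi> \<psi> \<le> ennreal (enn2real ?d + 2 / 2 ^ 0)"
    by (intro mk_limit_le s) auto
  also have "\<dots> < \<infinity>" by simp
  finally show "mk Q limit_lip \<phi> \<psi> < \<infinity>" .
next
  show "mk_continuous Q limit_lip"
    unfolding mk_continuous_def
  proof (intro ballI allI impI)
    fix \<phi> and e :: real assume \<phi>: "\<phi> \<in> states Q" and e: "e > 0"
    obtain n where n: "(1 / 2) ^ n < e / 4"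
      using real_arch_pow_inv[of "e / 4" "1 / 2"] e by auto
    obtain U where U: "openin (weak_star Q) U" "\<phi> \<in> U"
      "\<And>\<psi>. \<psi> \<in> U \<Longrightarrow> mk (V n) (L n) (compose (carrier (V n)) \<phi> (emb n)) (compose (carrier (V n)) \<psi> (emb n)) \<le> ennreal (e / 2)"
      using mk_continuous_preimage[OF lip_norm_imp_mk_continuous[OF lip_V] emb.continuous_map_pullback \<phi> half_gt_zero[OF e]]
      by blast
    have "mk Q limit_lip \<phi> \<psi> \<le> ennreal e" if "\<psi> \<in> U" for \<psi>
    proof -
      have "\<psi> \<in> states Q" using openin_subset[OF U(1)] that by auto
      then have "mk Q limit_lip \<phi> \<psi> \<le> ennreal (e / 2 + 2 / 2 ^ n)"
        using U(3)[OF that] e by (intro mk_limit_le \<phi>) auto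
      also have "\<dots> \<le> ennreal e" using n by (intro ennreal_leI) (simp add: power_one_over)
      finally show ?thesis .
    qed
    then show "\<exists>U. openin (weak_star Q) U \<and> \<phi> \<in> U \<and> (\<forall>\<psi>\<in>U. mk Q limit_lip \<phi> \<psi> \<le> ennreal e)"
      using U by blast
  qed
next
  fix x assume x: "x \<in> carrier Q"
    and lim: "\<And>e. e > 0 \<Longrightarrow> \<exists>y\<in>carrier Q. limit_lip y \<le> 1 \<and> norm_diff Q x y < e"
  show "limit_lip x \<le> 1"
    unfolding limit_lip_def
  proof (rule SUP_least)
    fix n
    show "L n (x n) \<le> 1"
    proof (rule V.lip_normD(6)[OF lip_V coord.closed[OF x]])
      fix e :: real assume "e > 0"
      then obtain y where y: "y \<in> carrier Q" "limit_lip y \<le> 1" "norm_diff Q x y < e"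
        using lim by blast
      have "norm_diff (V n) (x n) (y n) < e"
        using coord.norm_le[of "x \<ominus>\<^bsub>Q\<^esub> y" n] x y by (simp add: diff_coord)
      moreover have "L n (y n) \<le> 1" using coord_lip y(2) by (rule order_trans)
      ultimately show "\<exists>b\<in>carrier (V n). L n b \<le> 1 \<and> norm_diff (V n) (x n) b < e"
        using coord.closed[OF y(1)] by blast
    qed
  qed
qed

theorem quantum_metric_limit: "quantum_metric_ous Q limit_lip"
  using order_unit_space_limit mcomplete_limit lip_norm_limit by (simp add: quantum_metric_ous_def)

lemma lip_retraction_limit:
  "lip_retraction (V n) Q (emb n) (\<lambda>x. x n) (L n) limit_lip (1 / 2 ^ n)"
proof (intro lip_retraction.intro lip_retraction_axioms.intro emb_morphism coord_morphism
    step.qV quantum_metric_limit limit_lip_emb coord_lip)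
  show "emb n a n = a" for a by (simp add: emb_def)
  show "0 < 1 / (2 :: real) ^ n" by simp
  fix x assume x: "x \<in> carrier Q"
  show "ennreal (norm_diff Q x (emb n (x n)) / (1 / 2 ^ n)) \<le> limit_lip x"
  proof (cases "limit_lip x = \<infinity>")
    case False
    then have l: "limit_lip x = ennreal (enn2real (limit_lip x))" by (simp add: less_top)
    have "norm_diff Q x (emb n (x n)) \<le> enn2real (limit_lip x) / 2 ^ n"
      using l by (intro emb_approx x) auto
    then show ?thesis by (subst l) (auto intro!: ennreal_leI simp: field_simps)
  qed simp
qed

theorem dist_q_limit: "(\<lambda>n. dist_q (V n) (L n) Q limit_lip) \<longlonglongrightarrow> 0"
proof (rule tendsto_sandwich[where f = "\<lambda>_. 0"])
  show "\<forall>\<^sub>F n in sequentially. dist_q (V n) (L n) Q limit_lip \<le> ennreal (1 / 2 ^ n)"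
    using lip_retraction.dist_q_le[OF lip_retraction_limit] by (auto intro!: always_eventually)
  have "(\<lambda>n. (1 / 2 :: real) ^ n) \<longlonglongrightarrow> 0" by (intro LIMSEQ_realpow_zero) auto
  then have "(\<lambda>n. ennreal ((1 / 2) ^ n)) \<longlonglongrightarrow> ennreal 0" by (rule tendsto_ennrealI)
  then show "(\<lambda>n. ennreal (1 / 2 ^ n)) \<longlonglongrightarrow> 0" by (simp add: power_one_over)
qed auto

end

section \<open>Square roots in unital C*-algebras\<close>

context unital_cstar_algebra
begin

sublocale ring A
  by (rule is_ring)

lemma smult_closed [simp, intro]: "a \<in> carrier A \<Longrightarrow> c \<odot> a \<in> carrier A"
  using module.smult_closed[OF is_module] by simp

lemma smult_add_left: "a \<in> carrier A \<Longrightarrow> (c + d) \<odot> a = c \<odot> a \<oplus> d \<odot> a"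
  using module.smult_l_distr[OF is_module, of c d a] by simp

lemma smult_add_right:
  "a \<in> carrier A \<Longrightarrow> b \<in> carrier A \<Longrightarrow> c \<odot> (a \<oplus> b) = c \<odot> a \<oplus> c \<odot> b"
  using module.smult_r_distr[OF is_module, of c a b] by simp

lemma smult_smult: "a \<in> carrier A \<Longrightarrow> c \<odot> (d \<odot> a) = (c * d) \<odot> a"
  using module.smult_assoc1[OF is_module, of c d a] by simp

lemma smult_1 [simp]: "a \<in> carrier A \<Longrightarrow> 1 \<odot> a = a"
  using module.smult_one[OF is_module, of a] by simp

lemma smult_0 [simp]: "a \<in> carrier A \<Longrightarrow> 0 \<odot> a = \<zero>"
  using module.smult_l_null[OF is_module, of a] by simp

lemma smult_zero_right [simp]: "c \<odot> \<zero> = \<zero>"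
  using module.smult_r_null[OF is_module, of c] by simp

lemma smult_minus_left: "a \<in> carrier A \<Longrightarrow> (- c) \<odot> a = \<ominus> (c \<odot> a)"
  using smult_add_left[of a "- c" c] by (simp add: minus_equality)

lemma smult_minus_right: "a \<in> carrier A \<Longrightarrow> c \<odot> (\<ominus> a) = \<ominus> (c \<odot> a)"
  using module.smult_r_minus[OF is_module, of c a] by simp

lemma smult_minus_minus: "a \<in> carrier A \<Longrightarrow> (- c) \<odot> (\<ominus> a) = c \<odot> a"
  by (simp add: smult_minus_left smult_minus_right)

lemma smult_diff_right:
  "a \<in> carrier A \<Longrightarrow> b \<in> carrier A \<Longrightarrow> c \<odot> (a \<ominus> b) = c \<odot> a \<ominus> c \<odot> b"
  by (simp add: minus_eq smult_add_right smult_minus_right)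

lemma diff_eq_zero_iff: "a \<in> carrier A \<Longrightarrow> b \<in> carrier A \<Longrightarrow> a \<ominus> b = \<zero> \<longleftrightarrow> a = b"
  using r_right_minus_eq by simp

lemma diff_self [simp]: "a \<in> carrier A \<Longrightarrow> a \<ominus> a = \<zero>"
  by (simp add: diff_eq_zero_iff)

lemmas star_closed' [simp, intro] = star_closed
lemmas star_star' [simp] = star_star

lemma star_zero [simp]: "star A \<zero> = \<zero>"
  using star_smult[of \<zero> 0] by simp

lemma star_minus: "a \<in> carrier A \<Longrightarrow> star A (\<ominus> a) = \<ominus> star A a"
  using star_smult[of a "-1"] by (simp add: smult_minus_left)

lemma star_diff: "a \<in> carrier A \<Longrightarrow> b \<in> carrier A \<Longrightarrow> star A (a \<ominus> b) = star A a \<ominus> star A b"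
  by (simp add: minus_eq star_add star_minus)

lemma star_one [simp]: "star A \<one> = \<one>"
  using star_mult[of \<one> "star A \<one>"] by simp

lemma cnorm_zero [simp]: "cnorm A \<zero> = 0"
  by (simp add: cnorm_eq_zero)

lemma cnorm_minus [simp]: "a \<in> carrier A \<Longrightarrow> cnorm A (\<ominus> a) = cnorm A a"
  using cnorm_smult[of a "-1"] by (simp add: smult_minus_left)

lemma cnorm_star_le: "a \<in> carrier A \<Longrightarrow> cnorm A a \<le> cnorm A (star A a)"
proof (cases "cnorm A a = 0")
  case False
  assume a: "a \<in> carrier A"
  have "(cnorm A a)\<^sup>2 \<le> cnorm A (star A a) * cnorm A a"
    using cstar_identity[OF a] cnorm_mult[of "star A a" a] a by simp
  then show ?thesis using False cnorm_nonneg[OF a] by (simp add: power2_eq_square)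
qed (simp add: cnorm_nonneg)

lemma cnorm_star [simp]: "a \<in> carrier A \<Longrightarrow> cnorm A (star A a) = cnorm A a"
  using cnorm_star_le[of a] cnorm_star_le[of "star A a"] by simp

lemma cnorm_one_le: "cnorm A \<one> \<le> 1"
  using cstar_identity[of \<one>] by (auto simp: power2_eq_square)

lemma cnorm_diff_commute: "a \<in> carrier A \<Longrightarrow> b \<in> carrier A \<Longrightarrow> cnorm A (a \<ominus> b) = cnorm A (b \<ominus> a)"
  by (metis minus_closed minus_eq minus_add minus_minus a_comm a_inv_closed cnorm_minus)

lemma cnorm_diff_le: "a \<in> carrier A \<Longrightarrow> b \<in> carrier A \<Longrightarrow> cnorm A (a \<ominus> b) \<le> cnorm A a + cnorm A b"
  using cnorm_add[of a "\<ominus> b"] by (simp add: minus_eq)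

lemma diff_add_diff:
  "a \<in> carrier A \<Longrightarrow> b \<in> carrier A \<Longrightarrow> c \<in> carrier A \<Longrightarrow> (a \<ominus> b) \<oplus> (b \<ominus> c) = a \<ominus> c"
  by (simp add: minus_eq a_assoc r_neg2 a_lcomm[of b] r_neg r_neg1)

lemma minus_diff: "a \<in> carrier A \<Longrightarrow> b \<in> carrier A \<Longrightarrow> \<ominus> (a \<ominus> b) = b \<ominus> a"
  by (simp add: minus_eq minus_add a_comm)

lemma add_diff_add:
  "a \<in> carrier A \<Longrightarrow> b \<in> carrier A \<Longrightarrow> c \<in> carrier A \<Longrightarrow> d \<in> carrier A \<Longrightarrow>
    (a \<oplus> b) \<ominus> (c \<oplus> d) = (a \<ominus> c) \<oplus> (b \<ominus> d)"
  by (simp add: minus_eq minus_add a_ac)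

lemma cnorm_diff_triangle:
  "a \<in> carrier A \<Longrightarrow> b \<in> carrier A \<Longrightarrow> c \<in> carrier A \<Longrightarrow>
    cnorm A (a \<ominus> c) \<le> cnorm A (a \<ominus> b) + cnorm A (b \<ominus> c)"
  using cnorm_add[of "a \<ominus> b" "b \<ominus> c"] by (simp add: diff_add_diff)

lemma r_diff_distr:
  "a \<in> carrier A \<Longrightarrow> b \<in> carrier A \<Longrightarrow> c \<in> carrier A \<Longrightarrow> c \<otimes> (a \<ominus> b) = c \<otimes> a \<ominus> c \<otimes> b"
  by (simp add: minus_eq r_distr r_minus)

lemma l_diff_distr:
  "a \<in> carrier A \<Longrightarrow> b \<in> carrier A \<Longrightarrow> c \<in> carrier A \<Longrightarrow> (a \<ominus> b) \<otimes> c = a \<otimes> c \<ominus> b \<otimes> c"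
  by (simp add: minus_eq l_distr l_minus)

lemma Metric_space_cnorm: "Metric_space (carrier A) (norm_dist A (cnorm A))"
proof
  fix x y z
  show "0 \<le> norm_dist A (cnorm A) x y" by (simp add: norm_dist_def cnorm_nonneg)
  show "norm_dist A (cnorm A) x y = norm_dist A (cnorm A) y x"
    by (auto simp: norm_dist_def cnorm_diff_commute)
  show "x \<in> carrier A \<Longrightarrow> y \<in> carrier A \<Longrightarrow> norm_dist A (cnorm A) x y = 0 \<longleftrightarrow> x = y"
    by (simp add: cnorm_eq_zero diff_eq_zero_iff)
  show "x \<in> carrier A \<Longrightarrow> y \<in> carrier A \<Longrightarrow> z \<in> carrier A \<Longrightarrow>
      norm_dist A (cnorm A) x z \<le> norm_dist A (cnorm A) x y + norm_dist A (cnorm A) y z"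
    by (simp add: cnorm_diff_triangle)
qed

text \<open>
  Convergence in the C*-norm.  The carrier conditions are part of the definition, so that the rules for
  sums, products and adjoints compose without side conditions.
\<close>

definition tends :: "(nat \<Rightarrow> 'a) \<Rightarrow> 'a \<Rightarrow> bool" where
  "tends s x \<longleftrightarrow> (\<forall>n. s n \<in> carrier A) \<and> x \<in> carrier A \<and> (\<lambda>n. cnorm A (s n \<ominus> x)) \<longlonglongrightarrow> 0"

lemma tendsI:
  assumes "\<And>n. s n \<in> carrier A" "x \<in> carrier A"
    and "\<And>n. cnorm A (s n \<ominus> x) \<le> f n" "f \<longlonglongrightarrow> 0"
  shows "tends s x"
  unfolding tends_def
  using assms by (auto intro!: tendsto_sandwich[OF _ _ tendsto_const assms(4)] always_eventually cnorm_nonneg)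

lemma tends_unique: "tends s x \<Longrightarrow> tends s y \<Longrightarrow> x = y"
proof -
  assume s: "tends s x" "tends s y"
  then have c: "\<And>n. s n \<in> carrier A" "x \<in> carrier A" "y \<in> carrier A" by (auto simp: tends_def)
  have "(\<lambda>n. cnorm A (s n \<ominus> x) + cnorm A (s n \<ominus> y)) \<longlonglongrightarrow> 0 + 0"
    using s by (intro tendsto_add) (auto simp: tends_def)
  moreover have "cnorm A (x \<ominus> y) \<le> cnorm A (s n \<ominus> x) + cnorm A (s n \<ominus> y)" for n
    using cnorm_diff_triangle[of x "s n" y] cnorm_diff_commute[of x "s n"] c by simp
  ultimately have "cnorm A (x \<ominus> y) \<le> 0"
    by (intro LIMSEQ_le_const) auto
  then have "cnorm A (x \<ominus> y) = 0" using cnorm_nonneg[of "x \<ominus> y"] c by simp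
  then show ?thesis using c by (simp add: cnorm_eq_zero diff_eq_zero_iff)
qed

lemma tends_const: "x \<in> carrier A \<Longrightarrow> tends (\<lambda>_. x) x"
  by (simp add: tends_def)

lemma tends_Suc: "tends s x \<Longrightarrow> tends (\<lambda>n. s (Suc n)) x"
  by (auto simp: tends_def intro: LIMSEQ_Suc)

lemma tends_add:
  assumes "tends s x" "tends t y" shows "tends (\<lambda>n. s n \<oplus> t n) (x \<oplus> y)"
proof -
  have c: "\<And>n. s n \<in> carrier A" "x \<in> carrier A" "\<And>n. t n \<in> carrier A" "y \<in> carrier A"
    and l: "(\<lambda>n. cnorm A (s n \<ominus> x)) \<longlonglongrightarrow> 0" "(\<lambda>n. cnorm A (t n \<ominus> y)) \<longlonglongrightarrow> 0"
    using assms by (auto simp: tends_def)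
  show ?thesis
  proof (rule tendsI)
    show "(\<lambda>n. cnorm A (s n \<ominus> x) + cnorm A (t n \<ominus> y)) \<longlonglongrightarrow> 0"
      using tendsto_add[OF l] by simp
  qed (use c in \<open>auto simp: add_diff_add intro: cnorm_add\<close>)
qed

lemma tends_smult:
  assumes "tends s x" shows "tends (\<lambda>n. c \<odot> s n) (c \<odot> x)"
proof (rule tendsI)
  show "(\<lambda>n. cmod c * cnorm A (s n \<ominus> x)) \<longlonglongrightarrow> 0"
    using assms by (auto simp: tends_def intro: tendsto_mult_right_zero)
qed (use assms in \<open>auto simp: tends_def cnorm_smult simp flip: smult_diff_right\<close>)

lemma tends_star:
  assumes "tends s x" shows "tends (\<lambda>n. star A (s n)) (star A x)"
proof (rule tendsI)
  show "(\<lambda>n. cnorm A (s n \<ominus> x)) \<longlonglongrightarrow> 0"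
    using assms by (auto simp: tends_def)
qed (use assms in \<open>auto simp: tends_def simp flip: star_diff\<close>)

lemma tends_mult:
  assumes "tends s x" "tends t y" shows "tends (\<lambda>n. s n \<otimes> t n) (x \<otimes> y)"
proof -
  have c: "\<And>n. s n \<in> carrier A" "x \<in> carrier A" "\<And>n. t n \<in> carrier A" "y \<in> carrier A"
    and l: "(\<lambda>n. cnorm A (s n \<ominus> x)) \<longlonglongrightarrow> 0" "(\<lambda>n. cnorm A (t n \<ominus> y)) \<longlonglongrightarrow> 0"
    using assms by (auto simp: tends_def)
  show ?thesis
  proof (rule tendsI)
    show "(\<lambda>n. cnorm A (s n \<ominus> x) * (cnorm A (t n \<ominus> y) + cnorm A y) + cnorm A x * cnorm A (t n \<ominus> y)) \<longlonglongrightarrow> 0"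
      using l by (auto intro!: tendsto_eq_intros)
    fix n
    have "cnorm A (t n) \<le> cnorm A (t n \<ominus> y) + cnorm A y"
      using cnorm_diff_triangle[of "t n" y \<zero>] c by (simp add: minus_eq)
    then have "cnorm A ((s n \<ominus> x) \<otimes> t n) \<le> cnorm A (s n \<ominus> x) * (cnorm A (t n \<ominus> y) + cnorm A y)"
      using c by (intro order_trans[OF cnorm_mult] mult_left_mono) (auto simp: cnorm_nonneg)
    moreover have "cnorm A (x \<otimes> (t n \<ominus> y)) \<le> cnorm A x * cnorm A (t n \<ominus> y)"
      using c by (intro cnorm_mult) auto
    moreover have eq: "s n \<otimes> t n \<ominus> x \<otimes> y = (s n \<ominus> x) \<otimes> t n \<oplus> x \<otimes> (t n \<ominus> y)"
      using c by (simp add: l_diff_distr r_diff_distr diff_add_diff)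
    moreover have "cnorm A ((s n \<ominus> x) \<otimes> t n \<oplus> x \<otimes> (t n \<ominus> y)) \<le> cnorm A ((s n \<ominus> x) \<otimes> t n) + cnorm A (x \<otimes> (t n \<ominus> y))"
      using c by (intro cnorm_add) auto
    ultimately show "cnorm A (s n \<otimes> t n \<ominus> x \<otimes> y) \<le> cnorm A (s n \<ominus> x) * (cnorm A (t n \<ominus> y) + cnorm A y) + cnorm A x * cnorm A (t n \<ominus> y)"
      unfolding eq by linarith
  qed (use c in auto)
qed

lemma tends_norm_le:
  assumes "tends s x" "\<And>n. cnorm A (s n) \<le> r" shows "cnorm A x \<le> r"
proof -
  have "(\<lambda>n. cnorm A (s n \<ominus> x) + r) \<longlonglongrightarrow> 0 + r"
    using assms(1) by (intro tendsto_add) (auto simp: tends_def)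
  moreover have "cnorm A x \<le> cnorm A (s n \<ominus> x) + r" for n
    using cnorm_diff_triangle[of x "s n" \<zero>] cnorm_diff_commute[of x "s n"] assms(1) assms(2)[of n]
    by (simp add: tends_def minus_eq)
  ultimately show ?thesis using LIMSEQ_le_const[of _ "0 + r" "cnorm A x"] by auto
qed

lemma cauchy_tends:
  assumes "\<And>n. s n \<in> carrier A" and "\<And>e. e > 0 \<Longrightarrow> \<exists>M. \<forall>m\<ge>M. \<forall>n\<ge>M. cnorm A (s m \<ominus> s n) < e"
  obtains x where "tends s x"
proof -
  obtain x where "x \<in> carrier A" "\<forall>e>0. \<exists>M. \<forall>n\<ge>M. cnorm A (s n \<ominus> x) < e"
    using complete[unfolded mcomplete_norm_dist_iff[OF Metric_space_cnorm], THEN spec, THEN mp, THEN mp, of s] assms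
    by blast
  then have "tends s x"
    using assms(1) by (simp add: tends_def LIMSEQ_iff cnorm_nonneg)
  then show ?thesis by (rule that)
qed

text \<open>
  A fixed point \<open>y = (x + y\<^sup>2) / 2\<close> satisfies \<open>(1 - y)\<^sup>2 = 1 - x\<close>.
\<close>

primrec sqrt_iter :: "'a \<Rightarrow> nat \<Rightarrow> 'a" where
  "sqrt_iter x 0 = \<zero>"
| "sqrt_iter x (Suc k) = (1 / 2) \<odot> (x \<oplus> sqrt_iter x k \<otimes> sqrt_iter x k)"

text \<open>
  The same iteration for the number \<open>x = 1\<close>.  As the iterates are polynomials in \<open>x\<close> with nonnegative
  coefficients, it dominates the norms of the iterates and of their increments whenever \<open>\<parallel>x\<parallel> \<le> 1\<close>.
\<close>

primrec sqrt_bound :: "nat \<Rightarrow> real" where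
  "sqrt_bound 0 = 0"
| "sqrt_bound (Suc k) = (1 + (sqrt_bound k)\<^sup>2) / 2"

lemma sqrt_bound_range: "0 \<le> sqrt_bound k \<and> sqrt_bound k \<le> 1"
  by (induction k) (auto simp: power_le_one)

lemma sqrt_bound_mono: "sqrt_bound k \<le> sqrt_bound (Suc k)"
  using sum_power2_ge_zero[of "sqrt_bound k - 1" 0] by (simp add: power2_eq_square algebra_simps)

lemma sqrt_iter:
  assumes "x \<in> carrier A" "star A x = x" "cnorm A x \<le> 1"
  shows "sqrt_iter x k \<in> carrier A \<and> star A (sqrt_iter x k) = sqrt_iter x k \<and>
    cnorm A (sqrt_iter x k) \<le> sqrt_bound k \<and>
    (\<forall>z\<in>carrier A. z \<otimes> x = x \<otimes> z \<longrightarrow> z \<otimes> sqrt_iter x k = sqrt_iter x k \<otimes> z)"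
proof (induction k)
  case (Suc k)
  let ?y = "sqrt_iter x k"
  have y: "?y \<in> carrier A" "star A ?y = ?y" "cnorm A ?y \<le> sqrt_bound k"
    and comm: "\<And>z. z \<in> carrier A \<Longrightarrow> z \<otimes> x = x \<otimes> z \<Longrightarrow> z \<otimes> ?y = ?y \<otimes> z"
    using Suc by auto
  have "cnorm A (x \<oplus> ?y \<otimes> ?y) \<le> cnorm A x + cnorm A ?y * cnorm A ?y"
    using y assms by (intro order_trans[OF cnorm_add] add_left_mono cnorm_mult) auto
  also have "\<dots> \<le> 1 + sqrt_bound k * sqrt_bound k"
    using y assms sqrt_bound_range[of k] by (intro add_mono mult_mono) (auto simp: cnorm_nonneg)
  finally have n: "cnorm A (x \<oplus> ?y \<otimes> ?y) \<le> 1 + (sqrt_bound k)\<^sup>2" by (simp add: power2_eq_square)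
  have "z \<otimes> sqrt_iter x (Suc k) = sqrt_iter x (Suc k) \<otimes> z" if z: "z \<in> carrier A" "z \<otimes> x = x \<otimes> z" for z
  proof -
    have "z \<otimes> (?y \<otimes> ?y) = (?y \<otimes> ?y) \<otimes> z"
      using comm[OF z] y(1) z(1) by (metis m_assoc)
    then show ?thesis
      using y(1) z assms(1) by (simp add: smult_mult_left smult_mult_right l_distr r_distr)
  qed
  with n show ?case
    using y assms by (simp add: cnorm_smult star_smult star_add star_mult)
qed (use assms in simp)

declare sqrt_iter.simps [simp del] sqrt_bound.simps [simp del]

lemma commuting_square_diff:
  assumes "a \<in> carrier A" "b \<in> carrier A" "a \<otimes> b = b \<otimes> a"
  shows "a \<otimes> a \<ominus> b \<otimes> b = (a \<oplus> b) \<otimes> (a \<ominus> b)"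
proof -
  have "(a \<oplus> b) \<otimes> (a \<ominus> b) = (a \<otimes> a \<ominus> a \<otimes> b) \<oplus> (a \<otimes> b \<ominus> b \<otimes> b)"
    using assms by (subst l_distr) (auto simp: r_diff_distr)
  then show ?thesis using assms by (simp add: diff_add_diff)
qed

lemma sqrt_iter_step:
  assumes "x \<in> carrier A" "star A x = x" "cnorm A x \<le> 1"
  shows "cnorm A (sqrt_iter x (Suc k) \<ominus> sqrt_iter x k) \<le> sqrt_bound (Suc k) - sqrt_bound k"
proof (induction k)
  case 0
  then show ?case using assms by (simp add: minus_eq cnorm_smult sqrt_iter.simps sqrt_bound.simps)
next
  case (Suc k)
  note I = sqrt_iter[OF assms]
  let ?y = "sqrt_iter x k" and ?y' = "sqrt_iter x (Suc k)"
  have c: "?y \<in> carrier A" "?y' \<in> carrier A" using I[of k] I[of "Suc k"] by blast+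
  have "?y \<otimes> x = x \<otimes> ?y" using I[of k] assms(1) by metis
  then have comm: "?y' \<otimes> ?y = ?y \<otimes> ?y'" using I[of "Suc k"] c by metis
  have step: "sqrt_iter x (Suc (Suc k)) \<ominus> ?y' = (1 / 2) \<odot> ((?y' \<oplus> ?y) \<otimes> (?y' \<ominus> ?y))"
  proof -
    have "sqrt_iter x (Suc (Suc k)) \<ominus> ?y' = (1 / 2) \<odot> (x \<oplus> ?y' \<otimes> ?y') \<ominus> (1 / 2) \<odot> (x \<oplus> ?y \<otimes> ?y)"
      by (simp only: sqrt_iter.simps)
    also have "\<dots> = (1 / 2) \<odot> ((x \<oplus> ?y' \<otimes> ?y') \<ominus> (x \<oplus> ?y \<otimes> ?y))"
      using c assms by (intro smult_diff_right[symmetric]) auto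
    also have "(x \<oplus> ?y' \<otimes> ?y') \<ominus> (x \<oplus> ?y \<otimes> ?y) = ?y' \<otimes> ?y' \<ominus> ?y \<otimes> ?y"
      using c assms by (subst add_diff_add) (auto)
    also have "\<dots> = (?y' \<oplus> ?y) \<otimes> (?y' \<ominus> ?y)"
      by (rule commuting_square_diff[OF c(2,1) comm])
    finally show ?thesis .
  qed
  have "cnorm A ((?y' \<oplus> ?y) \<otimes> (?y' \<ominus> ?y)) \<le> cnorm A (?y' \<oplus> ?y) * cnorm A (?y' \<ominus> ?y)"
    using c by (intro cnorm_mult) auto
  also have "\<dots> \<le> (sqrt_bound (Suc k) + sqrt_bound k) * (sqrt_bound (Suc k) - sqrt_bound k)"
  proof (rule mult_mono)
    show "cnorm A (?y' \<oplus> ?y) \<le> sqrt_bound (Suc k) + sqrt_bound k"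
      using c I[of k] I[of "Suc k"] cnorm_add[OF c(2,1)] by linarith
  qed (use Suc.IH c sqrt_bound_range[of k] sqrt_bound_range[of "Suc k"] in \<open>auto intro!: cnorm_nonneg\<close>)
  also have "\<dots> = (sqrt_bound (Suc k))\<^sup>2 - (sqrt_bound k)\<^sup>2"
    by (simp add: power2_eq_square square_diff_square_factored)
  also have "\<dots> = 2 * (sqrt_bound (Suc (Suc k)) - sqrt_bound (Suc k))"
    by (simp add: sqrt_bound.simps(2)[of "Suc k"]) (simp add: sqrt_bound.simps(2)[of k])
  finally have "cnorm A ((?y' \<oplus> ?y) \<otimes> (?y' \<ominus> ?y)) / 2 \<le> sqrt_bound (Suc (Suc k)) - sqrt_bound (Suc k)"
    by simp
  moreover have "cnorm A ((1 / 2) \<odot> ((?y' \<oplus> ?y) \<otimes> (?y' \<ominus> ?y))) = cnorm A ((?y' \<oplus> ?y) \<otimes> (?y' \<ominus> ?y)) / 2"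
    using c by (subst cnorm_smult) auto
  ultimately show ?case unfolding step by simp
qed

text \<open>
  The bound on \<open>\<one> \<ominus> s\<close> makes it possible to extract a root of \<open>s\<close> itself by the same theorem.
\<close>

theorem sqrt_one_minus:
  assumes x: "x \<in> carrier A" "star A x = x" "cnorm A x \<le> 1"
  obtains s where "s \<in> carrier A" "star A s = s" "s \<otimes> s = \<one> \<ominus> x" "cnorm A (\<one> \<ominus> s) \<le> 1"
    "\<And>z. z \<in> carrier A \<Longrightarrow> z \<otimes> x = x \<otimes> z \<Longrightarrow> z \<otimes> s = s \<otimes> z"
proof -
  note I = sqrt_iter[OF x]
  have c: "sqrt_iter x k \<in> carrier A" for k using I by blast
  have dist: "cnorm A (sqrt_iter x m \<ominus> sqrt_iter x n) \<le> sqrt_bound m - sqrt_bound n" if "n \<le> m" for m n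
    using that
  proof (induction m rule: dec_induct)
    case (step m)
    then show ?case
      using cnorm_diff_triangle[OF c c c, of "Suc m" n m] sqrt_iter_step[OF x, of m] by linarith
  qed (use c in simp)
  have "incseq sqrt_bound" by (intro incseq_SucI sqrt_bound_mono)
  moreover have "\<forall>k. sqrt_bound k \<le> 1" using sqrt_bound_range by blast
  ultimately have "Cauchy sqrt_bound"
    by (metis incseq_convergent LIMSEQ_imp_Cauchy)
  have cau: "\<exists>M. \<forall>m\<ge>M. \<forall>n\<ge>M. cnorm A (sqrt_iter x m \<ominus> sqrt_iter x n) < e" if "e > 0" for e
  proof -
    obtain M where M: "\<And>m n. m \<ge> M \<Longrightarrow> n \<ge> M \<Longrightarrow> norm (sqrt_bound m - sqrt_bound n) < e"
      using CauchyD[OF \<open>Cauchy sqrt_bound\<close> \<open>e > 0\<close>] by metis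
    have "cnorm A (sqrt_iter x m \<ominus> sqrt_iter x n) < e" if mn: "m \<ge> M" "n \<ge> M" for m n
    proof -
      have "cnorm A (sqrt_iter x m \<ominus> sqrt_iter x n) \<le> norm (sqrt_bound m - sqrt_bound n)"
      proof (cases "n \<le> m")
        case True
        from dist[OF True] show ?thesis unfolding real_norm_def by (rule order_trans) (rule abs_ge_self)
      next
        case False
        then have "m \<le> n" by simp
        from dist[OF this] show ?thesis
          unfolding cnorm_diff_commute[OF c c, of m n] real_norm_def abs_minus_commute[of "sqrt_bound m"]
          by (rule order_trans) (rule abs_ge_self)
      qed
      also have "\<dots> < e" by (rule M[OF mn])
      finally show ?thesis .
    qed
    then show ?thesis by blast
  qed
  obtain y where y: "tends (sqrt_iter x) y"
    by (rule cauchy_tends[of "sqrt_iter x"]) (rule c, rule cau)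
  then have yc: "y \<in> carrier A" by (simp add: tends_def)
  have "tends (\<lambda>k. sqrt_iter x (Suc k)) ((1 / 2) \<odot> (x \<oplus> y \<otimes> y))"
    unfolding sqrt_iter.simps by (intro tends_smult tends_add tends_const tends_mult x y)
  then have fix_y: "y = (1 / 2) \<odot> (x \<oplus> y \<otimes> y)"
    using tends_unique[OF tends_Suc[OF y]] by blast
  have star_y: "star A y = y"
    using tends_unique[OF tends_star[OF y]] y I by simp
  have comm_y: "z \<otimes> y = y \<otimes> z" if z: "z \<in> carrier A" "z \<otimes> x = x \<otimes> z" for z
  proof -
    have "(\<lambda>k. z \<otimes> sqrt_iter x k) = (\<lambda>k. sqrt_iter x k \<otimes> z)" using I z by metis
    then show ?thesis
      using tends_unique tends_mult[OF tends_const[OF z(1)] y] tends_mult[OF y tends_const[OF z(1)]] by metis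
  qed
  have norm_y: "cnorm A y \<le> 1"
    using tends_norm_le[OF y, of 1] I sqrt_bound_range order_trans by blast
  have "y \<oplus> y = (1 / 2 + 1 / 2) \<odot> (x \<oplus> y \<otimes> y)"
    using fix_y yc x by (subst smult_add_left) auto
  then have two_y: "y \<oplus> y = x \<oplus> y \<otimes> y" using x yc by simp
  have "(\<one> \<ominus> y) \<otimes> (\<one> \<ominus> y) = (\<one> \<oplus> y \<otimes> y) \<ominus> (y \<oplus> y)"
    using yc by (simp add: minus_eq l_distr r_distr l_minus r_minus minus_add a_ac)
  also have "\<dots> = \<one> \<ominus> x"
    unfolding two_y using x yc by (subst add_diff_add) (auto simp: minus_eq r_neg)
  finally have sq: "(\<one> \<ominus> y) \<otimes> (\<one> \<ominus> y) = \<one> \<ominus> x" .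
  have "\<one> \<ominus> (\<one> \<ominus> y) = y"
    using yc by (simp add: minus_eq minus_add r_neg2)
  then show ?thesis
    using that[of "\<one> \<ominus> y"] sq norm_y yc comm_y
    by (simp add: star_diff star_y l_diff_distr r_diff_distr)
qed

text \<open>
  The element \<open>u = h + \<i> s\<close> satisfies \<open>u\<^sup>* u = r\<^sup>2\<close>, so its norm is at most \<open>r\<close>, and \<open>s\<close> is its imaginary part.
\<close>

lemma commuting_sum_squares_bound:
  assumes s: "s \<in> carrier A" "star A s = s" and h: "h \<in> carrier A" "star A h = h"
    and comm: "s \<otimes> h = h \<otimes> s" and r: "0 \<le> r"
    and sum: "s \<otimes> s \<oplus> h \<otimes> h = complex_of_real (r\<^sup>2) \<odot> \<one>"
  shows "cnorm A s \<le> r"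
proof -
  define u where "u = h \<oplus> \<i> \<odot> s"
  have u: "u \<in> carrier A" using s h by (simp add: u_def)
  have star_u: "star A u = h \<oplus> (- \<i>) \<odot> s"
    using s h by (simp add: u_def star_add star_smult)
  have "star A u \<otimes> u = (h \<otimes> h \<oplus> \<i> \<odot> (h \<otimes> s)) \<oplus> ((- \<i>) \<odot> (h \<otimes> s) \<oplus> s \<otimes> s)"
    unfolding star_u unfolding u_def using s h
    by (simp add: l_distr r_distr smult_mult_left smult_mult_right smult_smult smult_add_right comm a_ac)
  also have "\<dots> = (h \<otimes> h \<oplus> s \<otimes> s) \<oplus> ((\<i> + (- \<i>)) \<odot> (h \<otimes> s))"
    using s h by (subst smult_add_left) (auto simp: a_ac)
  also have "\<dots> = complex_of_real (r\<^sup>2) \<odot> \<one>"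
    using s h sum by (simp add: a_comm)
  finally have "(cnorm A u)\<^sup>2 = r\<^sup>2 * cnorm A \<one>"
    using cstar_identity[OF u] cnorm_smult[of \<one> "complex_of_real (r\<^sup>2)"] by (simp add: norm_power)
  also have "\<dots> \<le> r\<^sup>2 * 1" using cnorm_one_le by (intro mult_left_mono) auto
  finally have nu: "cnorm A u \<le> r" using r by (simp add: power2_le_iff_abs_le abs_le_iff)
  have "u \<ominus> star A u = (h \<ominus> h) \<oplus> (\<i> \<odot> s \<ominus> (- \<i>) \<odot> s)"
    unfolding star_u unfolding u_def using s h by (intro add_diff_add) auto
  also have "\<dots> = (\<i> + \<i>) \<odot> s"
    unfolding smult_add_left[OF s(1)] using s h by (simp add: smult_minus_left minus_eq r_neg)
  finally have "cnorm A ((\<i> + \<i>) \<odot> s) \<le> r + r"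
    using cnorm_diff_le[of u "star A u"] u nu by simp
  moreover have "cmod (\<i> + \<i>) = 2" by (simp add: norm_mult flip: mult_2)
  ultimately show ?thesis using s by (simp add: cnorm_smult)
qed

text \<open>
  Put \<open>s = \<surd>(1 - h\<^sup>2)\<close>.  Then \<open>s\<^sup>2 + h\<^sup>2 = 1\<close>, hence \<open>s\<close> is again a contraction, and
  \<open>m = \<surd>(1 - s\<^sup>2)\<close> is the absolute value of \<open>h\<close>.  Since \<open>\<parallel>1 - m\<parallel> \<le> 1\<close>, a root \<open>n\<close> of \<open>m\<close> exists as well.
  All these elements commute with whatever commutes with \<open>h\<close>.
\<close>

lemma absolute_value_contraction:
  assumes h: "h \<in> carrier A" "star A h = h" "cnorm A h \<le> 1"
  obtains m n where "m \<in> carrier A" "star A m = m" "n \<in> carrier A" "star A n = n"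
    "m \<otimes> m = h \<otimes> h" "n \<otimes> n = m"
    "\<And>z. z \<in> carrier A \<Longrightarrow> z \<otimes> h = h \<otimes> z \<Longrightarrow> z \<otimes> m = m \<otimes> z"
    "\<And>z. z \<in> carrier A \<Longrightarrow> z \<otimes> h = h \<otimes> z \<Longrightarrow> z \<otimes> n = n \<otimes> z"
proof -
  have square_le: "cnorm A (a \<otimes> a) \<le> 1" if "a \<in> carrier A" "cnorm A a \<le> 1" for a
    using cnorm_mult[OF that(1) that(1)] mult_mono[OF that(2) that(2)] cnorm_nonneg[OF that(1)] by simp
  have comm_sq: "z \<otimes> (a \<otimes> a) = (a \<otimes> a) \<otimes> z" if "z \<in> carrier A" "a \<in> carrier A" "z \<otimes> a = a \<otimes> z" for z a
    using that by (metis m_assoc)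
  have cancel: "\<one> \<ominus> (\<one> \<ominus> a) = a" if "a \<in> carrier A" for a
    using that by (simp add: minus_eq minus_add r_neg2)
  have hh: "h \<otimes> h \<in> carrier A" "star A (h \<otimes> h) = h \<otimes> h" "cnorm A (h \<otimes> h) \<le> 1"
    using h square_le[of h] by (simp_all add: star_mult)
  obtain s where s: "s \<in> carrier A" "star A s = s" "s \<otimes> s = \<one> \<ominus> h \<otimes> h"
    "\<And>z. z \<in> carrier A \<Longrightarrow> z \<otimes> (h \<otimes> h) = (h \<otimes> h) \<otimes> z \<Longrightarrow> z \<otimes> s = s \<otimes> z"
    by (rule sqrt_one_minus[OF hh]) (rule that)
  have sh: "h \<otimes> s = s \<otimes> h" using s(4)[of h] h by (simp add: m_assoc)
  have "\<one> \<ominus> h \<otimes> h \<oplus> h \<otimes> h = \<one>" using h by (simp add: minus_eq a_assoc l_neg)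
  then have "cnorm A s \<le> 1"
    using s(1-3) h sh by (intro commuting_sum_squares_bound[of s h 1]) simp_all
  then have ss: "s \<otimes> s \<in> carrier A" "star A (s \<otimes> s) = s \<otimes> s" "cnorm A (s \<otimes> s) \<le> 1"
    using s(1,2) square_le[of s] by (simp_all add: star_mult)
  obtain m where m: "m \<in> carrier A" "star A m = m" "m \<otimes> m = \<one> \<ominus> s \<otimes> s" "cnorm A (\<one> \<ominus> m) \<le> 1"
    "\<And>z. z \<in> carrier A \<Longrightarrow> z \<otimes> (s \<otimes> s) = (s \<otimes> s) \<otimes> z \<Longrightarrow> z \<otimes> m = m \<otimes> z"
    by (rule sqrt_one_minus[OF ss]) (rule that)
  have m1: "\<one> \<ominus> m \<in> carrier A" "star A (\<one> \<ominus> m) = \<one> \<ominus> m"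
    using m(1,2) by (simp_all add: star_diff)
  obtain n where n: "n \<in> carrier A" "star A n = n" "n \<otimes> n = \<one> \<ominus> (\<one> \<ominus> m)"
    "\<And>z. z \<in> carrier A \<Longrightarrow> z \<otimes> (\<one> \<ominus> m) = (\<one> \<ominus> m) \<otimes> z \<Longrightarrow> z \<otimes> n = n \<otimes> z"
    by (rule sqrt_one_minus[OF m1 m(4)]) (rule that)
  have zm: "z \<otimes> m = m \<otimes> z" if "z \<in> carrier A" "z \<otimes> h = h \<otimes> z" for z
    by (rule m(5)[OF that(1) comm_sq[OF that(1) s(1) s(4)[OF that(1) comm_sq[OF that(1) h(1) that(2)]]]])
  have zn: "z \<otimes> n = n \<otimes> z" if "z \<in> carrier A" "z \<otimes> h = h \<otimes> z" for z
    using n(4)[OF that(1)] zm[OF that] that m(1) by (simp add: l_diff_distr r_diff_distr)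
  show ?thesis
  proof (rule that[of m n])
    show "m \<otimes> m = h \<otimes> h" unfolding m(3) s(3) by (rule cancel[OF hh(1)])
    show "n \<otimes> n = m" unfolding n(3) by (rule cancel[OF m(1)])
    show "m \<in> carrier A" "star A m = m" "n \<in> carrier A" "star A n = n" by (fact m n)+
    show "z \<otimes> m = m \<otimes> z" "z \<otimes> n = n \<otimes> z" if "z \<in> carrier A" "z \<otimes> h = h \<otimes> z" for z
      using that by (rule zm, rule zn)
  qed
qed

theorem absolute_value:
  assumes h: "h \<in> carrier A" "star A h = h"
  obtains m n where "m \<in> carrier A" "star A m = m" "n \<in> carrier A" "star A n = n"
    "m \<otimes> m = h \<otimes> h" "n \<otimes> n = m"
    "\<And>z. z \<in> carrier A \<Longrightarrow> z \<otimes> h = h \<otimes> z \<Longrightarrow> z \<otimes> m = m \<otimes> z"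
    "\<And>z. z \<in> carrier A \<Longrightarrow> z \<otimes> h = h \<otimes> z \<Longrightarrow> z \<otimes> n = n \<otimes> z"
proof -
  define r where "r = cnorm A h + 1"
  have r: "r > 0" using cnorm_nonneg[OF h(1)] by (simp add: r_def)
  define k where "k = complex_of_real (1 / r) \<odot> h"
  have k: "k \<in> carrier A" "star A k = k" using h by (simp_all add: k_def star_smult)
  have "cnorm A k = (1 / r) * cnorm A h"
    using h r by (simp add: k_def cnorm_smult norm_divide)
  then have "cnorm A k \<le> 1" using r by (simp add: r_def)
  then obtain m n where mn: "m \<in> carrier A" "star A m = m" "n \<in> carrier A" "star A n = n"
    "m \<otimes> m = k \<otimes> k" "n \<otimes> n = m"
    "\<And>z. z \<in> carrier A \<Longrightarrow> z \<otimes> k = k \<otimes> z \<Longrightarrow> z \<otimes> m = m \<otimes> z"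
    "\<And>z. z \<in> carrier A \<Longrightarrow> z \<otimes> k = k \<otimes> z \<Longrightarrow> z \<otimes> n = n \<otimes> z"
    by (rule absolute_value_contraction[OF k]) (rule that)
  have comm: "z \<otimes> k = k \<otimes> z" if "z \<in> carrier A" "z \<otimes> h = h \<otimes> z" for z
    using that h by (simp add: k_def smult_mult_left smult_mult_right)
  have h_eq: "h = complex_of_real r \<odot> k"
    using h r by (simp add: k_def smult_smult flip: of_real_mult)
  show ?thesis
  proof (rule that[of "complex_of_real r \<odot> m" "complex_of_real (sqrt r) \<odot> n"])
    show "(complex_of_real r \<odot> m) \<otimes> (complex_of_real r \<odot> m) = h \<otimes> h"
      unfolding h_eq using mn(1) k(1) by (simp add: smult_mult_left smult_mult_right mn(5))
    show "(complex_of_real (sqrt r) \<odot> n) \<otimes> (complex_of_real (sqrt r) \<odot> n) = complex_of_real r \<odot> m"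
      using mn(1,3) r by (simp add: smult_mult_left smult_mult_right smult_smult mn(6) flip: of_real_mult)
    show "z \<otimes> (complex_of_real r \<odot> m) = (complex_of_real r \<odot> m) \<otimes> z"
      "z \<otimes> (complex_of_real (sqrt r) \<odot> n) = (complex_of_real (sqrt r) \<odot> n) \<otimes> z"
      if "z \<in> carrier A" "z \<otimes> h = h \<otimes> z" for z
      using mn(7,8)[OF that(1) comm[OF that]] that(1) mn(1,3)
      by (simp_all add: smult_mult_left smult_mult_right)
  qed (use mn(1-4) in \<open>simp_all add: star_smult\<close>)
qed

end

section \<open>Positivity in unital C*-algebras\<close>

lemma sa_simps:
  "x \<in> carrier (sa A) \<longleftrightarrow> x \<in> carrier A \<and> star A x = x"
  "\<one>\<^bsub>sa A\<^esub> = \<one>\<^bsub>A\<^esub>"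
  "\<zero>\<^bsub>sa A\<^esub> = \<zero>\<^bsub>A\<^esub>"
  "x \<oplus>\<^bsub>sa A\<^esub> y = x \<oplus>\<^bsub>A\<^esub> y"
  "r \<odot>\<^bsub>sa A\<^esub> x = complex_of_real r \<odot>\<^bsub>A\<^esub> x"
  "leq (sa A) x y \<longleftrightarrow> cstar_positive A (y \<ominus>\<^bsub>A\<^esub> x)"
  by (simp_all add: sa_def)

locale ordered_cstar_algebra = unital_cstar_algebra A + sa: order_unit_space "sa A"
  for A :: "'a cstar" (structure)
begin

lemma sa_minus: "a \<in> carrier (sa A) \<Longrightarrow> \<ominus>\<^bsub>sa A\<^esub> a = \<ominus> a"
  by (rule sa.minus_equality) (auto simp: sa_simps l_neg star_minus)

lemma sa_diff: "a \<in> carrier (sa A) \<Longrightarrow> b \<in> carrier (sa A) \<Longrightarrow> a \<ominus>\<^bsub>sa A\<^esub> b = a \<ominus> b"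
  by (simp add: sa.minus_eq minus_eq sa_minus sa_simps)

lemma cstar_positive_sa: "cstar_positive A a \<Longrightarrow> a \<in> carrier (sa A)"
  by (auto simp: cstar_positive_def sa_simps star_mult)

lemma cstar_positive_square: "g \<in> carrier A \<Longrightarrow> cstar_positive A (star A g \<otimes> g)"
  by (auto simp: cstar_positive_def)

lemma zero_leq_sa_iff: "a \<in> carrier A \<Longrightarrow> leq (sa A) \<zero> a \<longleftrightarrow> cstar_positive A a"
  by (simp add: sa_simps minus_eq)

lemma cstar_positive_scale:
  assumes "cstar_positive A a" "0 \<le> r" shows "cstar_positive A (complex_of_real r \<odot> a)"
proof -
  have a: "a \<in> carrier (sa A)" using assms cstar_positive_sa by blast
  then have "leq (sa A) (r \<odot>\<^bsub>sa A\<^esub> \<zero>\<^bsub>sa A\<^esub>) (r \<odot>\<^bsub>sa A\<^esub> a)"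
    using assms by (intro sa.leq_smult) (auto simp: sa_simps minus_eq)
  then show ?thesis using a by (simp add: sa_simps minus_eq)
qed

lemma cstar_positive_antisym:
  assumes "cstar_positive A a" "cstar_positive A (\<ominus> a)" shows "a = \<zero>"
proof -
  have a: "a \<in> carrier (sa A)" using assms cstar_positive_sa by blast
  then show ?thesis
    using sa.leq_antisym[of a \<zero>] assms by (simp add: sa_simps minus_eq)
qed

lemma square_eq_zero: "a \<in> carrier A \<Longrightarrow> star A a \<otimes> a = \<zero> \<Longrightarrow> a = \<zero>"
  using cstar_identity[of a] by (simp add: cnorm_eq_zero)

text \<open>
  Let \<open>q = m - k\<close>, twice the negative part of \<open>k = b\<^sup>* b\<close>.  From \<open>k q = - m q\<close> one gets
  \<open>(b q)\<^sup>* (b q) = q k q = - q m q = - (n q)\<^sup>* (n q)\<close>.  So \<open>(n q)\<^sup>* (n q)\<close> and its negative are both positive,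
  and antisymmetry of the order forces \<open>n q = 0\<close>, hence \<open>m q = k q = 0\<close> and \<open>q\<^sup>2 = 0\<close>.
\<close>

theorem absolute_value_of_positive:
  assumes k: "k \<in> carrier A" "cstar_positive A k"
    and m: "m \<in> carrier A" "star A m = m" and n: "n \<in> carrier A" "star A n = n"
    and mm: "m \<otimes> m = k \<otimes> k" and nn: "n \<otimes> n = m"
    and km: "k \<otimes> m = m \<otimes> k" and kn: "k \<otimes> n = n \<otimes> k" and nm: "n \<otimes> m = m \<otimes> n"
  shows "m = k"
proof -
  obtain b where b: "b \<in> carrier A" "k = star A b \<otimes> b"
    using k(2) by (auto simp: cstar_positive_def)
  have star_k: "star A k = k" using b by (simp add: star_mult)
  define q where "q = m \<ominus> k"
  have q: "q \<in> carrier A" "star A q = q" using k m star_k by (simp_all add: q_def star_diff)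
  have kq: "k \<otimes> q = \<ominus> (m \<otimes> q)"
  proof -
    have "k \<otimes> q = m \<otimes> k \<ominus> k \<otimes> k" "m \<otimes> q = k \<otimes> k \<ominus> m \<otimes> k"
      using k(1) m(1) by (simp_all add: q_def r_diff_distr mm km)
    then show ?thesis using k(1) m(1) by (simp add: minus_diff)
  qed
  have qm: "q \<otimes> m = m \<otimes> q" using k m by (simp add: q_def l_diff_distr r_diff_distr km)
  have qn: "n \<otimes> q = q \<otimes> n" using k m n by (simp add: q_def l_diff_distr r_diff_distr kn nm)
  define p where "p = n \<otimes> q"
  have p: "p \<in> carrier A" using n q by (simp add: p_def)
  have "star A p \<otimes> p = q \<otimes> (n \<otimes> n) \<otimes> q"
    using n q by (simp add: p_def star_mult m_assoc)
  then have pp: "star A p \<otimes> p = q \<otimes> m \<otimes> q" by (simp add: nn)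
  have "star A (b \<otimes> q) \<otimes> (b \<otimes> q) = q \<otimes> (k \<otimes> q)"
    using b q by (simp add: star_mult m_assoc)
  also have "\<dots> = \<ominus> (star A p \<otimes> p)"
    using q m by (simp add: kq pp r_minus m_assoc)
  finally have "cstar_positive A (\<ominus> (star A p \<otimes> p))"
    using cstar_positive_square[of "b \<otimes> q"] b q by simp
  then have "star A p \<otimes> p = \<zero>"
    using cstar_positive_antisym cstar_positive_square[OF p] by blast
  then have "p = \<zero>" using p square_eq_zero by blast
  moreover have "m \<otimes> q = n \<otimes> p" using n q by (simp add: p_def m_assoc flip: nn)
  ultimately have mq: "m \<otimes> q = \<zero>" using n by simp
  have "star A q \<otimes> q = m \<otimes> q \<ominus> k \<otimes> q"
    using k m q(1) by (subst q(2)) (simp add: q_def l_diff_distr)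
  also have "\<dots> = \<zero>" using mq kq k by simp
  finally have "q = \<zero>" using q square_eq_zero by blast
  then show ?thesis using k m by (simp add: q_def diff_eq_zero_iff)
qed

lemma positive_sqrt:
  assumes k: "cstar_positive A k"
  obtains g where "g \<in> carrier A" "star A g = g" "g \<otimes> g = k"
    "\<And>z. z \<in> carrier A \<Longrightarrow> z \<otimes> k = k \<otimes> z \<Longrightarrow> z \<otimes> g = g \<otimes> z"
proof -
  have ks: "k \<in> carrier A" "star A k = k" using cstar_positive_sa[OF k] by (auto simp: sa_simps)
  obtain m n where mn: "m \<in> carrier A" "star A m = m" "n \<in> carrier A" "star A n = n"
    "m \<otimes> m = k \<otimes> k" "n \<otimes> n = m"
    "\<And>z. z \<in> carrier A \<Longrightarrow> z \<otimes> k = k \<otimes> z \<Longrightarrow> z \<otimes> m = m \<otimes> z"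
    "\<And>z. z \<in> carrier A \<Longrightarrow> z \<otimes> k = k \<otimes> z \<Longrightarrow> z \<otimes> n = n \<otimes> z"
    by (rule absolute_value[OF ks]) (rule that)
  have kn: "k \<otimes> n = n \<otimes> k" by (rule mn(8)[OF ks(1) refl])
  have "m = k"
    by (rule absolute_value_of_positive[OF ks(1) k mn(1-6) mn(7)[OF ks(1) refl] kn mn(7)[OF mn(3) kn[symmetric]]])
  with mn(6) show ?thesis using that[OF mn(3,4) _ mn(8)] by blast
qed

text \<open>
  \<open>r - a\<close> is the square of \<open>\<surd>r \<surd>(1 - a / r)\<close>.
\<close>

lemma leq_unit_of_cnorm:
  assumes a: "a \<in> carrier (sa A)" and r: "cnorm A a \<le> r" "r > 0"
  shows "leq (sa A) a (r \<odot>\<^bsub>sa A\<^esub> \<one>\<^bsub>sa A\<^esub>)"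
proof -
  define x where "x = complex_of_real (1 / r) \<odot> a"
  have as: "a \<in> carrier A" "star A a = a" using a by (auto simp: sa_simps)
  have x: "x \<in> carrier A" "star A x = x" using as by (simp_all add: x_def star_smult)
  have xn: "cnorm A x \<le> 1" using as r by (simp add: x_def cnorm_smult norm_divide)
  obtain s where s: "s \<in> carrier A" "star A s = s" "s \<otimes> s = \<one> \<ominus> x"
    by (rule sqrt_one_minus[OF x xn]) (rule that)
  have "cstar_positive A (complex_of_real r \<odot> (star A s \<otimes> s))"
    using r by (intro cstar_positive_scale cstar_positive_square s) auto
  also have "complex_of_real r \<odot> (star A s \<otimes> s) = complex_of_real r \<odot> \<one> \<ominus> a"
    using s x as r by (simp add: smult_diff_right x_def smult_smult flip: of_real_mult)
  finally show ?thesis by (simp add: sa_simps)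
qed

text \<open>
  If \<open>- r \<le> a \<le> r\<close>, then \<open>r - a = g\<^sup>2\<close> and \<open>r + a = f\<^sup>2\<close> with roots that commute with each other and with
  \<open>a\<close>, so that \<open>a\<^sup>2 + (g f)\<^sup>2 = r\<^sup>2\<close> and \<open>\<parallel>a\<parallel> \<le> r\<close>.
\<close>

theorem ou_norm_sa:
  assumes a: "a \<in> carrier (sa A)" shows "ou_norm (sa A) a = cnorm A a"
proof (rule antisym)
  have as: "a \<in> carrier A" "star A a = a" using a by (auto simp: sa_simps)
  show "ou_norm (sa A) a \<le> cnorm A a"
  proof (rule field_le_epsilon)
    fix e :: real assume e: "e > 0"
    have r: "cnorm A a + e > 0" using cnorm_nonneg[OF as(1)] e by simp
    have "\<ominus> a \<in> carrier (sa A)" using as by (simp add: sa_simps star_minus)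
    then show "ou_norm (sa A) a \<le> cnorm A a + e"
      using leq_unit_of_cnorm[OF a _ r] leq_unit_of_cnorm[of "\<ominus> a", OF _ _ r] as a r e
      by (simp add: sa.ou_norm_le_iff sa_minus)
  qed
  show "cnorm A a \<le> ou_norm (sa A) a"
  proof (rule field_le_epsilon)
    fix e :: real assume e: "e > 0"
    define r where "r = ou_norm (sa A) a + e"
    have r: "ou_norm (sa A) a \<le> r" "r > 0" using sa.ou_norm_nonneg[OF a] e by (auto simp: r_def)
    define R where "R = complex_of_real r \<odot> \<one>"
    have R: "R \<in> carrier A" by (simp add: R_def)
    have Rz: "R \<otimes> z = complex_of_real r \<odot> z" "z \<otimes> R = complex_of_real r \<odot> z" if "z \<in> carrier A" for z
      using that by (simp_all add: R_def smult_mult_left smult_mult_right)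
    have pos: "cstar_positive A (R \<ominus> a)" "cstar_positive A (R \<oplus> a)"
      using r a as by (auto simp: sa.ou_norm_le_iff sa_minus sa_simps R_def minus_eq)
    obtain g where g: "g \<in> carrier A" "star A g = g" "g \<otimes> g = R \<ominus> a"
      "\<And>z. z \<in> carrier A \<Longrightarrow> z \<otimes> (R \<ominus> a) = (R \<ominus> a) \<otimes> z \<Longrightarrow> z \<otimes> g = g \<otimes> z"
      by (rule positive_sqrt[OF pos(1)]) (rule that)
    obtain f where f: "f \<in> carrier A" "star A f = f" "f \<otimes> f = R \<oplus> a"
      "\<And>z. z \<in> carrier A \<Longrightarrow> z \<otimes> (R \<oplus> a) = (R \<oplus> a) \<otimes> z \<Longrightarrow> z \<otimes> f = f \<otimes> z"
      by (rule positive_sqrt[OF pos(2)]) (rule that)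
    have comm: "z \<otimes> g = g \<otimes> z" "z \<otimes> f = f \<otimes> z" if "z \<in> carrier A" "z \<otimes> a = a \<otimes> z" for z
    proof -
      show "z \<otimes> g = g \<otimes> z"
        by (rule g(4)) (use that R as in \<open>simp_all add: l_diff_distr r_diff_distr Rz\<close>)
      show "z \<otimes> f = f \<otimes> z"
        by (rule f(4)) (use that R as in \<open>simp_all add: l_distr r_distr Rz\<close>)
    qed
    have ag: "a \<otimes> g = g \<otimes> a" and af: "a \<otimes> f = f \<otimes> a" using comm[OF as(1)] by auto
    have gf: "g \<otimes> f = f \<otimes> g" using comm(2)[OF g(1)] ag by simp
    have "a \<otimes> (g \<otimes> f) = (a \<otimes> g) \<otimes> f" using g(1) f(1) as(1) by (simp add: m_assoc)
    also have "\<dots> = g \<otimes> (a \<otimes> f)" unfolding ag using g(1) f(1) as(1) by (simp add: m_assoc)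
    also have "\<dots> = (g \<otimes> f) \<otimes> a" unfolding af using g(1) f(1) as(1) by (simp add: m_assoc)
    finally have "a \<otimes> (g \<otimes> f) = (g \<otimes> f) \<otimes> a" .
    moreover have "star A (g \<otimes> f) = g \<otimes> f" using g(1,2) f(1,2) gf by (simp add: star_mult)
    moreover have "a \<otimes> a \<oplus> (g \<otimes> f) \<otimes> (g \<otimes> f) = complex_of_real (r\<^sup>2) \<odot> \<one>"
    proof -
      have "(g \<otimes> f) \<otimes> (g \<otimes> f) = (f \<otimes> g) \<otimes> (f \<otimes> g)" by (simp only: gf)
      also have "\<dots> = f \<otimes> (g \<otimes> f) \<otimes> g" using g(1) f(1) by (simp add: m_assoc)
      also have "\<dots> = (f \<otimes> f) \<otimes> (g \<otimes> g)"
        unfolding gf using g(1) f(1) by (simp add: m_assoc)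
      also have "\<dots> = R \<otimes> R \<ominus> a \<otimes> a"
        unfolding g(3) f(3) using R as by (intro commuting_square_diff[symmetric]) (simp_all add: Rz)
      finally have "a \<otimes> a \<oplus> (g \<otimes> f) \<otimes> (g \<otimes> f) = R \<otimes> R"
        using R as by (simp add: minus_eq a_lcomm[of "a \<otimes> a"] r_neg)
      then show ?thesis by (simp add: R_def smult_mult_left smult_mult_right smult_smult power2_eq_square)
    qed
    ultimately have "cnorm A a \<le> r"
      using as g(1) f(1) r by (intro commuting_sum_squares_bound[of a "g \<otimes> f"]) auto
    then show "cnorm A a \<le> ou_norm (sa A) a + e" by (simp add: r_def)
  qed
qed

text \<open>
  \<open>a = ((1 + a) / 2)\<^sup>2 - ((1 - a) / 2)\<^sup>2\<close>.  It follows that every positive linear map preserves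
  self-adjointness.
\<close>

lemma sa_difference_of_squares:
  assumes a: "a \<in> carrier (sa A)"
  obtains p q where "cstar_positive A p" "cstar_positive A q" "a = p \<ominus> q"
proof -
  have as: "a \<in> carrier A" "star A a = a" using a by (auto simp: sa_simps)
  define c where "c = (1 / 2) \<odot> (\<one> \<oplus> a)"
  define d where "d = (1 / 2) \<odot> (\<one> \<ominus> a)"
  have c: "c \<in> carrier A" "star A c = c" and d: "d \<in> carrier A" "star A d = d"
    using as by (simp_all add: c_def d_def star_smult star_add star_diff)
  have cd: "c \<oplus> d = \<one>"
  proof -
    have "c \<oplus> d = (1 / 2) \<odot> ((\<one> \<oplus> a) \<oplus> (\<one> \<ominus> a))"
      using as by (simp add: c_def d_def smult_add_right)
    also have "(\<one> \<oplus> a) \<oplus> (\<one> \<ominus> a) = \<one> \<oplus> \<one>"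
      using as by (simp add: minus_eq a_assoc a_lcomm[of a \<one>] r_neg)
    also have "(1 / 2) \<odot> (\<one> \<oplus> \<one>) = (1 / 2 + 1 / 2) \<odot> \<one>"
      by (simp only: smult_add_left smult_add_right one_closed)
    finally show ?thesis by simp
  qed
  have "(c \<oplus> d) \<ominus> c = d" using c d by (simp add: minus_eq a_comm[of c d] a_assoc r_neg)
  then have "d = \<one> \<ominus> c" by (simp add: cd)
  then have "c \<otimes> d = d \<otimes> c" using c by (simp add: l_diff_distr r_diff_distr)
  then have "c \<otimes> c \<ominus> d \<otimes> d = (c \<oplus> d) \<otimes> (c \<ominus> d)"
    by (intro commuting_square_diff c d)
  also note cd
  also have "c \<ominus> d = a"
  proof -
    have "c \<ominus> d = (1 / 2) \<odot> ((\<one> \<oplus> a) \<ominus> (\<one> \<ominus> a))"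
      using as by (simp add: c_def d_def smult_diff_right)
    also have "(\<one> \<oplus> a) \<ominus> (\<one> \<ominus> a) = a \<oplus> a"
      using as by (simp add: minus_eq minus_add a_ac r_neg r_neg2 r_neg1)
    also have "(1 / 2) \<odot> (a \<oplus> a) = (1 / 2 + 1 / 2) \<odot> a"
      using as by (simp only: smult_add_left smult_add_right)
    finally show ?thesis using as by simp
  qed
  finally have "a = star A c \<otimes> c \<ominus> star A d \<otimes> d" using as c d by simp
  then show ?thesis by (rule that[OF cstar_positive_square[OF c(1)] cstar_positive_square[OF d(1)]])
qed

end

section \<open>Homomorphisms and conditional expectations\<close>

locale ordered_cstar_hom = A: ordered_cstar_algebra A + B: ordered_cstar_algebra B
  for A :: "'a cstar" and B :: "'b cstar" and h :: "'a \<Rightarrow> 'b" +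
  assumes star_hom: "unital_star_hom A B h"
begin

lemma hom_closed [simp, intro]: "a \<in> carrier A \<Longrightarrow> h a \<in> carrier B"
  and hom_add: "a \<in> carrier A \<Longrightarrow> b \<in> carrier A \<Longrightarrow> h (a \<oplus>\<^bsub>A\<^esub> b) = h a \<oplus>\<^bsub>B\<^esub> h b"
  and hom_mult: "a \<in> carrier A \<Longrightarrow> b \<in> carrier A \<Longrightarrow> h (a \<otimes>\<^bsub>A\<^esub> b) = h a \<otimes>\<^bsub>B\<^esub> h b"
  and hom_one [simp]: "h \<one>\<^bsub>A\<^esub> = \<one>\<^bsub>B\<^esub>"
  and hom_smult: "a \<in> carrier A \<Longrightarrow> h (c \<odot>\<^bsub>A\<^esub> a) = c \<odot>\<^bsub>B\<^esub> h a"
  and hom_star: "a \<in> carrier A \<Longrightarrow> h (star A a) = star B (h a)"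
  using star_hom by (auto simp: unital_star_hom_def ring_hom_def)

lemma ou_morphism_hom: "ou_morphism (sa A) (sa B) h"
proof
  fix a assume a: "a \<in> carrier (sa A)" "leq (sa A) \<zero>\<^bsub>sa A\<^esub> a"
  then have "cstar_positive A a" using A.zero_leq_sa_iff[of a] by (simp add: sa_simps)
  then obtain b where "b \<in> carrier A" "a = star A b \<otimes>\<^bsub>A\<^esub> b" by (auto simp: cstar_positive_def)
  then have "cstar_positive B (h a)"
    using B.cstar_positive_square[of "h b"] by (simp add: hom_mult hom_star)
  then show "leq (sa B) \<zero>\<^bsub>sa B\<^esub> (h a)"
    using a B.zero_leq_sa_iff[of "h a"] by (simp add: sa_simps)
qed (auto simp: sa_simps hom_add hom_smult simp flip: hom_star)

text \<open>
  The absolute value \<open>m\<close> of \<open>a\<close> and its root are taken in \<open>A\<close>.  Their images are an absolute value of \<open>h a\<close> and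
  a root of it in \<open>B\<close>.  As \<open>h a\<close> is positive, \<open>h m = h a\<close>, and by injectivity \<open>a = m\<close>, a square.
\<close>

theorem reflects_positive:
  assumes inj: "inj_on h (carrier A)" and a: "a \<in> carrier (sa A)" and pos: "cstar_positive B (h a)"
  shows "cstar_positive A a"
proof -
  have as: "a \<in> carrier A" "star A a = a" using a by (auto simp: sa_simps)
  obtain m n where mn: "m \<in> carrier A" "star A m = m" "n \<in> carrier A" "star A n = n"
    "m \<otimes>\<^bsub>A\<^esub> m = a \<otimes>\<^bsub>A\<^esub> a" "n \<otimes>\<^bsub>A\<^esub> n = m"
    "\<And>z. z \<in> carrier A \<Longrightarrow> z \<otimes>\<^bsub>A\<^esub> a = a \<otimes>\<^bsub>A\<^esub> z \<Longrightarrow> z \<otimes>\<^bsub>A\<^esub> m = m \<otimes>\<^bsub>A\<^esub> z"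
    "\<And>z. z \<in> carrier A \<Longrightarrow> z \<otimes>\<^bsub>A\<^esub> a = a \<otimes>\<^bsub>A\<^esub> z \<Longrightarrow> z \<otimes>\<^bsub>A\<^esub> n = n \<otimes>\<^bsub>A\<^esub> z"
    by (rule A.absolute_value[OF as]) (rule that)
  have am: "a \<otimes>\<^bsub>A\<^esub> m = m \<otimes>\<^bsub>A\<^esub> a" by (rule mn(7)[OF as(1) refl])
  have an: "a \<otimes>\<^bsub>A\<^esub> n = n \<otimes>\<^bsub>A\<^esub> a" by (rule mn(8)[OF as(1) refl])
  have nm: "n \<otimes>\<^bsub>A\<^esub> m = m \<otimes>\<^bsub>A\<^esub> n" by (rule mn(7)[OF mn(3) an[symmetric]])
  have "h m = h a"
  proof (rule B.absolute_value_of_positive[where n = "h n"])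
    show "star B (h m) = h m" "star B (h n) = h n" using mn(1-4) by (simp_all flip: hom_star)
    show "h m \<otimes>\<^bsub>B\<^esub> h m = h a \<otimes>\<^bsub>B\<^esub> h a" "h n \<otimes>\<^bsub>B\<^esub> h n = h m"
      "h a \<otimes>\<^bsub>B\<^esub> h m = h m \<otimes>\<^bsub>B\<^esub> h a" "h a \<otimes>\<^bsub>B\<^esub> h n = h n \<otimes>\<^bsub>B\<^esub> h a" "h n \<otimes>\<^bsub>B\<^esub> h m = h m \<otimes>\<^bsub>B\<^esub> h n"
      using mn(1,3,5,6) as(1) am an nm by (simp_all flip: hom_mult)
  qed (use mn(1,3) as(1) pos in auto)
  then have "m = a" using inj mn(1) as(1) by (simp add: inj_on_eq_iff)
  then show ?thesis
    using A.cstar_positive_square[OF mn(3)] mn(4,6) by simp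
qed

end

locale cstar_expectation = ordered_cstar_hom A B h
  for A :: "'a cstar" and B :: "'b cstar" and h :: "'a \<Rightarrow> 'b" +
  fixes E :: "'b \<Rightarrow> 'b"
  assumes inj: "inj_on h (carrier A)"
    and expectation: "conditional_expectation B (h ` carrier A) E"
begin

lemma E_range: "b \<in> carrier B \<Longrightarrow> E b \<in> h ` carrier A"
  using expectation by (simp add: conditional_expectation_def Pi_iff)

lemma E_add: "b \<in> carrier B \<Longrightarrow> c \<in> carrier B \<Longrightarrow> E (b \<oplus>\<^bsub>B\<^esub> c) = E b \<oplus>\<^bsub>B\<^esub> E c"
  using expectation by (simp add: conditional_expectation_def)

lemma E_smult: "b \<in> carrier B \<Longrightarrow> E (z \<odot>\<^bsub>B\<^esub> b) = z \<odot>\<^bsub>B\<^esub> E b"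
  using expectation by (simp add: conditional_expectation_def)

lemma E_hom: "a \<in> carrier A \<Longrightarrow> E (h a) = h a"
  using expectation by (simp add: conditional_expectation_def)

lemma E_pos: "b \<in> carrier B \<Longrightarrow> cstar_positive B b \<Longrightarrow> cstar_positive B (E b)"
  using expectation by (simp add: conditional_expectation_def)

lemma E_closed [simp, intro]: "b \<in> carrier B \<Longrightarrow> E b \<in> carrier B"
  using E_range[of b] by auto

lemma E_diff: "a \<in> carrier B \<Longrightarrow> b \<in> carrier B \<Longrightarrow> E (a \<ominus>\<^bsub>B\<^esub> b) = E a \<ominus>\<^bsub>B\<^esub> E b"
  using E_add[of a "(-1) \<odot>\<^bsub>B\<^esub> b"] E_smult[of b "-1"]
  by (simp add: B.minus_eq B.smult_minus_left)

lemma E_sa: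
  assumes "b \<in> carrier (sa B)" shows "E b \<in> carrier (sa B)"
proof -
  obtain p q where pq: "cstar_positive B p" "cstar_positive B q" "b = p \<ominus>\<^bsub>B\<^esub> q"
    using B.sa_difference_of_squares[OF assms] .
  have c: "p \<in> carrier B" "q \<in> carrier B"
    using pq(1,2) B.cstar_positive_sa by (auto simp: sa_simps)
  have "E p \<in> carrier (sa B)" "E q \<in> carrier (sa B)"
    using pq(1,2) c E_pos B.cstar_positive_sa by blast+
  then have "E p \<ominus>\<^bsub>B\<^esub> E q \<in> carrier (sa B)" by (simp add: sa_simps B.star_diff)
  then show ?thesis using c by (simp add: pq(3) E_diff)
qed

definition retraction :: "'b \<Rightarrow> 'a" where
  "retraction b = inv_into (carrier A) h (E b)"

lemma retraction_closed [simp, intro]: "b \<in> carrier B \<Longrightarrow> retraction b \<in> carrier A"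
  and hom_retraction: "b \<in> carrier B \<Longrightarrow> h (retraction b) = E b"
  using E_range by (auto simp: retraction_def inv_into_into f_inv_into_f)

lemma retraction_hom: "a \<in> carrier A \<Longrightarrow> retraction (h a) = a"
  using inj by (simp add: retraction_def E_hom)

lemma retraction_eqI: "b \<in> carrier B \<Longrightarrow> a \<in> carrier A \<Longrightarrow> E b = h a \<Longrightarrow> retraction b = a"
  using inj by (simp add: retraction_def)

lemma ou_morphism_retraction: "ou_morphism (sa B) (sa A) retraction"
proof
  fix b c r assume b: "b \<in> carrier (sa B)"
  then have bc: "b \<in> carrier B" by (simp add: sa_simps)
  have "E b = h (star A (retraction b))"
    using E_sa[OF b] bc by (simp add: hom_star hom_retraction sa_simps)
  then have "star A (retraction b) = retraction b"
    using bc by (intro retraction_eqI[symmetric]) auto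
  with bc show sa: "retraction b \<in> carrier (sa A)" by (simp add: sa_simps)
  show "retraction (r \<odot>\<^bsub>sa B\<^esub> b) = r \<odot>\<^bsub>sa A\<^esub> retraction b"
    unfolding sa_simps using bc by (intro retraction_eqI) (auto simp: E_smult hom_smult hom_retraction)
  show "c \<in> carrier (sa B) \<Longrightarrow> retraction (b \<oplus>\<^bsub>sa B\<^esub> c) = retraction b \<oplus>\<^bsub>sa A\<^esub> retraction c"
    unfolding sa_simps using bc by (intro retraction_eqI) (auto simp: E_add hom_add hom_retraction)
  assume "leq (sa B) \<zero>\<^bsub>sa B\<^esub> b"
  then have "cstar_positive B b" using bc B.zero_leq_sa_iff[of b] by (simp add: sa_simps)
  then have "cstar_positive B (h (retraction b))" using bc by (simp add: hom_retraction E_pos)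
  then have "cstar_positive A (retraction b)" by (rule reflects_positive[OF inj sa])
  then show "leq (sa A) \<zero>\<^bsub>sa A\<^esub> (retraction b)"
    using bc A.zero_leq_sa_iff[of "retraction b"] by (simp add: sa_simps)
next
  show "retraction \<one>\<^bsub>sa B\<^esub> = \<one>\<^bsub>sa A\<^esub>"
    using retraction_hom[of "\<one>\<^bsub>A\<^esub>"] by (simp add: sa_simps)
qed

end

section \<open>Extending a Lip-norm along a retraction\<close>

text \<open>
  Enlarging the seminorm shrinks its unit ball and hence the distance of states, so finiteness and
  continuity are inherited from \<open>L\<close>.  The equality of domains keeps the domain dense.
\<close>

theorem quantum_metric_dominating:
  assumes q: "quantum_metric_ous V L" and S: "ou_seminorm V S" and k: "k > 0"
    and dom: "\<And>a. a \<in> carrier V \<Longrightarrow> ennreal k * L a \<le> S a"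
    and finite: "\<And>a. a \<in> carrier V \<Longrightarrow> L a < \<infinity> \<Longrightarrow> S a < \<infinity>"
    and unit: "S \<one>\<^bsub>V\<^esub> = 0"
    and closed: "\<And>a. a \<in> carrier V \<Longrightarrow>
      (\<And>e. e > 0 \<Longrightarrow> \<exists>b\<in>carrier V. S b \<le> 1 \<and> norm_diff V a b < e) \<Longrightarrow> S a \<le> 1"
  shows "quantum_metric_ous V S"
proof -
  interpret order_unit_space V using q by (simp add: quantum_metric_ous_def)
  have L: "lip_norm V L" using q by (simp add: quantum_metric_ous_def)
  have mk_le: "mk V S \<phi> \<psi> \<le> ennreal e"
    if "\<phi> \<in> states V" "\<psi> \<in> states V" "0 \<le> e" "mk V L \<phi> \<psi> \<le> ennreal (k * e)" for \<phi> \<psi> e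
  proof (rule mk_leI)
    fix a assume a: "a \<in> carrier V" "S a \<le> 1"
    have "L (k \<odot>\<^bsub>V\<^esub> a) = ennreal k * L a" using lip_normD(1)[OF L] a k by (simp add: ou_seminorm_def)
    also have "\<dots> \<le> 1" using dom[OF a(1)] a(2) by (rule order_trans)
    finally have "\<bar>\<phi> (k \<odot>\<^bsub>V\<^esub> a) - \<psi> (k \<odot>\<^bsub>V\<^esub> a)\<bar> \<le> k * e"
      using that a k by (intro mk_leD[OF that(4)]) auto
    then have "k * \<bar>\<phi> a - \<psi> a\<bar> \<le> k * e"
      using that a k by (simp add: state_smult abs_mult flip: right_diff_distrib)
    then show "\<bar>\<phi> a - \<psi> a\<bar> \<le> e" using k by simp
  qed
  have "lip_norm V S"
  proof (rule lip_normI[OF S])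
    show "\<exists>b\<in>carrier V. S b < \<infinity> \<and> norm_diff V a b < e" if "a \<in> carrier V" "e > 0" for a e
      using lip_normD(2)[OF L that] finite by blast
    show "\<exists>r. a = r \<odot>\<^bsub>V\<^esub> \<one>\<^bsub>V\<^esub>" if "a \<in> carrier V" "S a = 0" for a
    proof -
      have "ennreal k * L a = 0" using dom[OF that(1)] that(2) by simp
      then show ?thesis using lip_normD(3)[OF L that(1)] k by (auto simp: ennreal_eq_0_iff)
    qed
    show "mk V S \<phi> \<psi> < \<infinity>" if s: "\<phi> \<in> states V" "\<psi> \<in> states V" for \<phi> \<psi>
    proof -
      have "mk V L \<phi> \<psi> = ennreal (k * (enn2real (mk V L \<phi> \<psi>) / k))"
        using lip_normD(5)[OF L s] k by simp
      then have "mk V S \<phi> \<psi> \<le> ennreal (enn2real (mk V L \<phi> \<psi>) / k)"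
        using k by (intro mk_le s) auto
      also have "\<dots> < \<infinity>" by simp
      finally show ?thesis .
    qed
    show "mk_continuous V S"
      unfolding mk_continuous_def
    proof (intro ballI allI impI)
      fix \<phi> and e :: real assume \<phi>: "\<phi> \<in> states V" and e: "e > 0"
      have "k * e > 0" using k e by simp
      then obtain U where U: "openin (weak_star V) U" "\<phi> \<in> U" "\<forall>\<psi>\<in>U. mk V L \<phi> \<psi> \<le> ennreal (k * e)"
        using lip_norm_imp_mk_continuous[OF L] \<phi> unfolding mk_continuous_def by meson
      moreover have "\<psi> \<in> states V" if "\<psi> \<in> U" for \<psi> using openin_subset[OF U(1)] that by auto
      ultimately show "\<exists>U. openin (weak_star V) U \<and> \<phi> \<in> U \<and> (\<forall>\<psi>\<in>U. mk V S \<phi> \<psi> \<le> ennreal e)"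
        using mk_le \<phi> e by (intro exI[of _ U]) auto
    qed
  qed (use unit closed in auto)
  then show ?thesis using q by (simp add: quantum_metric_ous_def)
qed

text \<open>
  The recursion step: \<open>S\<^sub>V\<close> is the Lip-norm constructed so far, \<open>L\<^sub>W\<close> the given one on the next space, and
  \<open>S\<^sub>W\<close> the next Lip-norm.
\<close>

locale lip_extension = j: ou_morphism V W j + p: ou_morphism W V p
  for V :: "'a ous" and W :: "'b ous" and j p +
  fixes S\<^sub>V L\<^sub>W S\<^sub>W and k \<epsilon> :: real
  assumes qV: "quantum_metric_ous V S\<^sub>V" and qW: "quantum_metric_ous W L\<^sub>W"
    and retract: "a \<in> carrier V \<Longrightarrow> p (j a) = a"
    and k_pos: "k > 0" and eps_pos: "\<epsilon> > 0"
    and lip_j: "a \<in> carrier V \<Longrightarrow> ennreal k * L\<^sub>W (j a) \<le> S\<^sub>V a"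
    and finite_p: "b \<in> carrier W \<Longrightarrow> L\<^sub>W b < \<infinity> \<Longrightarrow> S\<^sub>V (p b) < \<infinity>"
    and S_eq: "b \<in> carrier W \<Longrightarrow>
      S\<^sub>W b = max (ennreal k * L\<^sub>W b) (max (S\<^sub>V (p b)) (ennreal (norm_diff W b (j (p b)) / \<epsilon>)))"
begin

lemma lip_V: "lip_norm V S\<^sub>V" and lip_W: "lip_norm W L\<^sub>W"
  using qV qW by (auto simp: quantum_metric_ous_def)

lemma ou_seminorm_extension: "ou_seminorm W S\<^sub>W"
proof -
  have "ou_seminorm W (\<lambda>b. ennreal k * L\<^sub>W b)"
    using lip_W by (intro ou_seminorm_scale) (simp add: lip_norm_def)
  moreover have "ou_seminorm W (\<lambda>b. S\<^sub>V (p b))"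
    using lip_V by (auto simp: ou_seminorm_def lip_norm_def p.add p.smult)
  moreover have "ou_seminorm W (\<lambda>b. ennreal (norm_diff W b (j (p b)) / \<epsilon>))"
    by (rule j.W.ou_seminorm_norm)
      (auto simp: p.add p.smult j.add j.smult j.W.add_diff_add j.W.smult_diff_right eps_pos)
  ultimately have "ou_seminorm W (\<lambda>b. max (ennreal k * L\<^sub>W b) (max (S\<^sub>V (p b)) (ennreal (norm_diff W b (j (p b)) / \<epsilon>))))"
    by (intro ou_seminorm_max)
  then show ?thesis by (simp add: ou_seminorm_def S_eq)
qed

lemma extension_le_1_iff:
  "b \<in> carrier W \<Longrightarrow> S\<^sub>W b \<le> 1 \<longleftrightarrow>
    ennreal k * L\<^sub>W b \<le> 1 \<and> S\<^sub>V (p b) \<le> 1 \<and> norm_diff W b (j (p b)) \<le> \<epsilon>"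
  using eps_pos by (simp add: S_eq field_simps flip: ennreal_1)

theorem quantum_metric_extension: "quantum_metric_ous W S\<^sub>W"
proof (rule quantum_metric_dominating[OF qW ou_seminorm_extension k_pos])
  fix b assume b: "b \<in> carrier W"
  show "ennreal k * L\<^sub>W b \<le> S\<^sub>W b" using b by (simp add: S_eq)
  show "L\<^sub>W b < \<infinity> \<Longrightarrow> S\<^sub>W b < \<infinity>"
    using b finite_p[OF b] by (auto simp: S_eq ennreal_mult_less_top)
  assume lim: "\<And>e. e > 0 \<Longrightarrow> \<exists>c\<in>carrier W. S\<^sub>W c \<le> 1 \<and> norm_diff W b c < e"
  have scale: "ennreal k * L\<^sub>W c = L\<^sub>W (k \<odot>\<^bsub>W\<^esub> c)" if "c \<in> carrier W" for c
    using j.W.lip_normD(1)[OF lip_W] that k_pos by (simp add: ou_seminorm_def)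
  have "L\<^sub>W (k \<odot>\<^bsub>W\<^esub> b) \<le> 1"
  proof (rule j.W.lip_normD(6)[OF lip_W])
    fix e :: real assume "e > 0"
    then obtain c where c: "c \<in> carrier W" "S\<^sub>W c \<le> 1" "norm_diff W b c < e / k"
      using lim[of "e / k"] k_pos by auto
    have "norm_diff W (k \<odot>\<^bsub>W\<^esub> b) (k \<odot>\<^bsub>W\<^esub> c) = k * norm_diff W b c"
      using b c k_pos by (simp add: j.W.ou_norm_smult flip: j.W.smult_diff_right)
    also have "\<dots> < e" using c(3) k_pos by (simp add: field_simps)
    finally show "\<exists>x\<in>carrier W. L\<^sub>W x \<le> 1 \<and> norm_diff W (k \<odot>\<^bsub>W\<^esub> b) x < e"
      using c by (intro bexI[of _ "k \<odot>\<^bsub>W\<^esub> c"]) (auto simp: extension_le_1_iff scale)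
  qed (use b in auto)
  moreover have "S\<^sub>V (p b) \<le> 1"
  proof (rule j.V.lip_normD(6)[OF lip_V])
    fix e :: real assume "e > 0"
    then obtain c where c: "c \<in> carrier W" "S\<^sub>W c \<le> 1" "norm_diff W b c < e"
      using lim by blast
    have "norm_diff V (p b) (p c) < e"
      using p.norm_le[of "b \<ominus>\<^bsub>W\<^esub> c"] b c by (simp add: p.diff)
    then show "\<exists>x\<in>carrier V. S\<^sub>V x \<le> 1 \<and> norm_diff V (p b) x < e"
      using c by (intro bexI[of _ "p c"]) (auto simp: extension_le_1_iff)
  qed (use b in auto)
  moreover have "norm_diff W b (j (p b)) \<le> \<epsilon>"
  proof (rule field_le_epsilon)
    fix e :: real assume "e > 0"
    then obtain c where c: "c \<in> carrier W" "S\<^sub>W c \<le> 1" "norm_diff W b c < e / 2"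
      using lim[of "e / 2"] by auto
    have "norm_diff W (j (p c)) (j (p b)) \<le> norm_diff V (p c) (p b)"
      using j.norm_le[of "p c \<ominus>\<^bsub>V\<^esub> p b"] b c by (simp add: j.diff)
    also have "\<dots> \<le> norm_diff W c b"
      using p.norm_le[of "c \<ominus>\<^bsub>W\<^esub> b"] b c by (simp add: p.diff)
    also have "\<dots> = norm_diff W b c" using b c by (simp add: j.W.ou_norm_diff_commute)
    finally have "norm_diff W (j (p c)) (j (p b)) \<le> norm_diff W b c" .
    moreover have "norm_diff W b (j (p b)) \<le> norm_diff W b c
        + (norm_diff W c (j (p c)) + norm_diff W (j (p c)) (j (p b)))"
      using b c j.W.ou_norm_diff_triangle[of b c "j (p b)"]
        j.W.ou_norm_diff_triangle[of c "j (p c)" "j (p b)"] by simp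
    moreover have "norm_diff W c (j (p c)) \<le> \<epsilon>" using c by (simp add: extension_le_1_iff)
    ultimately show "norm_diff W b (j (p b)) \<le> \<epsilon> + e" using c by linarith
  qed
  ultimately show "S\<^sub>W b \<le> 1" using b by (simp add: extension_le_1_iff scale)
next
  show "S\<^sub>W \<one>\<^bsub>W\<^esub> = 0"
    using j.V.lip_normD(4)[OF lip_V] j.W.lip_normD(4)[OF lip_W] by (simp add: S_eq p.unit j.unit)
qed

theorem lip_retraction_extension: "lip_retraction V W j p S\<^sub>V S\<^sub>W \<epsilon>"
proof (intro lip_retraction.intro lip_retraction_axioms.intro j.ou_morphism_axioms p.ou_morphism_axioms
    qV quantum_metric_extension retract eps_pos)
  show "S\<^sub>W (j a) \<le> S\<^sub>V a" if "a \<in> carrier V" for a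
    using that lip_j[OF that] by (simp add: S_eq retract)
qed (auto simp: S_eq le_max_iff_disj)

end

section \<open>Leibniz inequalities\<close>

definition jordan :: "'a cstar \<Rightarrow> 'a \<Rightarrow> 'a \<Rightarrow> 'a" where
  "jordan A a b = (1 / 2) \<odot>\<^bsub>A\<^esub> (a \<otimes>\<^bsub>A\<^esub> b \<oplus>\<^bsub>A\<^esub> b \<otimes>\<^bsub>A\<^esub> a)"

definition lie :: "'a cstar \<Rightarrow> 'a \<Rightarrow> 'a \<Rightarrow> 'a" where
  "lie A a b = (1 / (2 * \<i>)) \<odot>\<^bsub>A\<^esub> (a \<otimes>\<^bsub>A\<^esub> b \<ominus>\<^bsub>A\<^esub> b \<otimes>\<^bsub>A\<^esub> a)"

text \<open>
  The Jordan and the Lie product are always treated alike; quantifying over the operation avoids stating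
  each estimate twice.
\<close>

lemma leibniz_qcms_iff:
  "leibniz_qcms F A L \<longleftrightarrow> leibniz_function F \<and> unital_cstar_algebra A \<and> quantum_metric_ous (sa A) L \<and>
    (\<forall>a\<in>carrier (sa A). \<forall>b\<in>carrier (sa A). L a < \<infinity> \<longrightarrow> L b < \<infinity> \<longrightarrow>
       (\<forall>op\<in>{jordan, lie}. L (op A a b) \<le> ennreal (F (cnorm A a) (cnorm A b) (enn2real (L a)) (enn2real (L b)))))"
  by (simp add: leibniz_qcms_def jordan_def lie_def)

context unital_cstar_algebra
begin

lemma sa_products:
  assumes "op \<in> {jordan, lie}" "a \<in> carrier (sa A)" "b \<in> carrier (sa A)"
  shows "op A a b \<in> carrier (sa A)" "cnorm A (op A a b) \<le> cnorm A a * cnorm A b"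
proof -
  have ab: "a \<in> carrier A" "b \<in> carrier A" "star A a = a" "star A b = b"
    using assms by (auto simp: sa_simps)
  have "star A (lie A a b) = (- (1 / (2 * \<i>))) \<odot> (\<ominus> (a \<otimes> b \<ominus> b \<otimes> a))"
    using ab by (simp add: lie_def star_smult star_diff star_mult minus_diff)
  also have "\<dots> = lie A a b"
    unfolding lie_def using ab by (intro smult_minus_minus) auto
  finally show "op A a b \<in> carrier (sa A)"
    using assms(1) ab by (auto simp: sa_simps jordan_def lie_def star_smult star_add star_mult a_comm)
  have "cnorm A (a \<otimes> b) + cnorm A (b \<otimes> a) \<le> cnorm A a * cnorm A b + cnorm A b * cnorm A a"
    using ab by (intro add_mono cnorm_mult)
  then have "cnorm A (a \<otimes> b \<oplus> b \<otimes> a) \<le> 2 * (cnorm A a * cnorm A b)"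
    "cnorm A (a \<otimes> b \<ominus> b \<otimes> a) \<le> 2 * (cnorm A a * cnorm A b)"
    using cnorm_add[of "a \<otimes> b" "b \<otimes> a"] cnorm_diff_le[of "a \<otimes> b" "b \<otimes> a"] ab by auto
  then show "cnorm A (op A a b) \<le> cnorm A a * cnorm A b"
    using assms(1) ab by (auto simp: jordan_def lie_def cnorm_smult norm_divide norm_mult)
qed

end

lemma leibniz_functionD:
  assumes "leibniz_function F" "0 \<le> x" "0 \<le> y" "0 \<le> z" "0 \<le> w"
  shows "0 \<le> F x y z w"
    and "x \<le> x' \<Longrightarrow> y \<le> y' \<Longrightarrow> z \<le> z' \<Longrightarrow> w \<le> w' \<Longrightarrow> F x y z w \<le> F x' y' z' w'"
  using assms by (auto simp: leibniz_function_def)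

lemma leibniz_qcmsD:
  assumes "leibniz_qcms F A L" "op \<in> {jordan, lie}"
    and "a \<in> carrier (sa A)" "b \<in> carrier (sa A)" "L a < \<infinity>" "L b < \<infinity>"
    and "cnorm A a \<le> x" "cnorm A b \<le> y" "enn2real (L a) \<le> z" "enn2real (L b) \<le> w"
  shows "L (op A a b) \<le> ennreal (F x y z w)"
proof -
  have F: "leibniz_function F" and "unital_cstar_algebra A" using assms(1) by (auto simp: leibniz_qcms_def)
  then have nn: "0 \<le> cnorm A a" "0 \<le> cnorm A b"
    using assms(3,4) by (auto simp: sa_simps unital_cstar_algebra.cnorm_nonneg)
  have "L (op A a b) \<le> ennreal (F (cnorm A a) (cnorm A b) (enn2real (L a)) (enn2real (L b)))"
    using assms(1-6) unfolding leibniz_qcms_iff by blast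
  also have "\<dots> \<le> ennreal (F x y z w)"
    using assms nn by (intro ennreal_leI leibniz_functionD(2)[OF F]) auto
  finally show ?thesis .
qed

text \<open>
  By \<open>upper\<close>, the value of \<open>S\<close> at a product is controlled by \<open>L\<close> and the norm of the product.  The former is
  bounded by the Leibniz inequality for \<open>L\<close>, in which \<open>L\<close> is at most \<open>S / k\<close> by \<open>lower\<close>; the latter by
  submultiplicativity.
\<close>

theorem leibniz_dominated:
  fixes A :: "'a cstar"
  assumes L: "leibniz_qcms F A L" and S: "quantum_metric_ous (sa A) S"
    and k: "k > 0" and K: "K \<ge> 0"
    and lower: "\<And>a. a \<in> carrier (sa A) \<Longrightarrow> ennreal k * L a \<le> S a"
    and upper: "\<And>a. a \<in> carrier (sa A) \<Longrightarrow> S a \<le> ennreal K * (L a + ennreal (cnorm A a))"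
  shows "leibniz_qcms (\<lambda>x y z w. K * (F x y (z / k) (w / k) + x * y)) A S"
  unfolding leibniz_qcms_iff
proof (intro conjI ballI impI)
  have F: "leibniz_function F" and A: "unital_cstar_algebra A" using L by (auto simp: leibniz_qcms_def)
  interpret unital_cstar_algebra A by (rule A)
  show "unital_cstar_algebra A" "quantum_metric_ous (sa A) S" by (fact A S)+
  show "leibniz_function (\<lambda>x y z w. K * (F x y (z / k) (w / k) + x * y))"
    unfolding leibniz_function_def
  proof (intro conjI allI impI)
    fix x y z w :: real assume nn: "0 \<le> x" "0 \<le> y" "0 \<le> z" "0 \<le> w"
    show "0 \<le> K * (F x y (z / k) (w / k) + x * y)"
      using nn k K leibniz_functionD(1)[OF F, of x y "z / k" "w / k"] by simp
    fix x' y' z' w' assume le: "x \<le> x'" "y \<le> y'" "z \<le> z'" "w \<le> w'"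
    show "K * (F x y (z / k) (w / k) + x * y) \<le> K * (F x' y' (z' / k) (w' / k) + x' * y')"
      using nn k K le
      by (intro mult_left_mono add_mono leibniz_functionD(2)[OF F] mult_mono divide_right_mono) auto
  qed
  fix a b and op :: "'a cstar \<Rightarrow> 'a \<Rightarrow> 'a \<Rightarrow> 'a"
  assume a: "a \<in> carrier (sa A)" "S a < \<infinity>" and b: "b \<in> carrier (sa A)" "S b < \<infinity>"
    and op: "op \<in> {jordan, lie}"
  have fin: "L c < \<infinity> \<and> enn2real (L c) \<le> enn2real (S c) / k" if c: "c \<in> carrier (sa A)" "S c < \<infinity>" for c
  proof -
    have kL: "ennreal k * L c < \<infinity>" using lower[OF c(1)] c(2) by (rule le_less_trans)
    then have fin: "L c < \<infinity>" using k by (auto simp: ennreal_mult_less_top ennreal_eq_0_iff)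
    have "enn2real (ennreal k * L c) \<le> enn2real (S c)"
      using lower[OF c(1)] c(2) by (intro enn2real_mono) auto
    then show ?thesis using fin k by (simp add: enn2real_mult field_simps)
  qed
  have "L (op A a b) \<le> ennreal (F (cnorm A a) (cnorm A b) (enn2real (S a) / k) (enn2real (S b) / k))"
    using fin[OF a] fin[OF b] by (intro leibniz_qcmsD[OF L op a(1) b(1)]) auto
  then have "L (op A a b) + ennreal (cnorm A (op A a b)) \<le>
      ennreal (F (cnorm A a) (cnorm A b) (enn2real (S a) / k) (enn2real (S b) / k)) + ennreal (cnorm A a * cnorm A b)"
    using sa_products(2)[OF op a(1) b(1)] by (intro add_mono ennreal_leI)
  also have "\<dots> = ennreal (F (cnorm A a) (cnorm A b) (enn2real (S a) / k) (enn2real (S b) / k) + cnorm A a * cnorm A b)"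
    using a b k by (intro ennreal_plus[symmetric] leibniz_functionD(1)[OF F]) (auto simp: sa_simps cnorm_nonneg)
  finally have "ennreal K * (L (op A a b) + ennreal (cnorm A (op A a b))) \<le> ennreal K * \<dots>"
    by (rule mult_left_mono) simp
  then show "S (op A a b) \<le> ennreal (K * (F (cnorm A a) (cnorm A b) (enn2real (S a) / k) (enn2real (S b) / k) + cnorm A a * cnorm A b))"
    using upper[OF sa_products(1)[OF op a(1) b(1)]] K by (simp add: ennreal_mult')
qed

section \<open>Direct sums of C*-algebras and tunnels\<close>

definition cstar_sum :: "'a cstar \<Rightarrow> 'b cstar \<Rightarrow> ('a \<times> 'b) cstar" where
  "cstar_sum A B = \<lparr>
     carrier = carrier A \<times> carrier B,
     monoid.mult = (\<lambda>(a, b) (a', b'). (a \<otimes>\<^bsub>A\<^esub> a', b \<otimes>\<^bsub>B\<^esub> b')),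
     one = (\<one>\<^bsub>A\<^esub>, \<one>\<^bsub>B\<^esub>),
     zero = (\<zero>\<^bsub>A\<^esub>, \<zero>\<^bsub>B\<^esub>),
     add = (\<lambda>(a, b) (a', b'). (a \<oplus>\<^bsub>A\<^esub> a', b \<oplus>\<^bsub>B\<^esub> b')),
     smult = (\<lambda>c (a, b). (c \<odot>\<^bsub>A\<^esub> a, c \<odot>\<^bsub>B\<^esub> b)),
     star = (\<lambda>(a, b). (star A a, star B b)),
     cnorm = (\<lambda>(a, b). max (cnorm A a) (cnorm B b)) \<rparr>"

lemma cstar_sum_simps:
  "carrier (cstar_sum A B) = carrier A \<times> carrier B"
  "(a, b) \<otimes>\<^bsub>cstar_sum A B\<^esub> (a', b') = (a \<otimes>\<^bsub>A\<^esub> a', b \<otimes>\<^bsub>B\<^esub> b')"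
  "\<one>\<^bsub>cstar_sum A B\<^esub> = (\<one>\<^bsub>A\<^esub>, \<one>\<^bsub>B\<^esub>)"
  "\<zero>\<^bsub>cstar_sum A B\<^esub> = (\<zero>\<^bsub>A\<^esub>, \<zero>\<^bsub>B\<^esub>)"
  "(a, b) \<oplus>\<^bsub>cstar_sum A B\<^esub> (a', b') = (a \<oplus>\<^bsub>A\<^esub> a', b \<oplus>\<^bsub>B\<^esub> b')"
  "c \<odot>\<^bsub>cstar_sum A B\<^esub> (a, b) = (c \<odot>\<^bsub>A\<^esub> a, c \<odot>\<^bsub>B\<^esub> b)"
  "star (cstar_sum A B) (a, b) = (star A a, star B b)"
  "cnorm (cstar_sum A B) (a, b) = max (cnorm A a) (cnorm B b)"
  by (simp_all add: cstar_sum_def)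

locale cstar_pair = A: unital_cstar_algebra A + B: unital_cstar_algebra B
  for A :: "'a cstar" and B :: "'b cstar"
begin

abbreviation "D \<equiv> cstar_sum A B"

lemma ring_sum: "Ring.ring D"
proof (rule ringI)
  show "abelian_group D"
  proof (rule abelian_groupI)
    fix x assume "x \<in> carrier D"
    then show "\<exists>y\<in>carrier D. y \<oplus>\<^bsub>D\<^esub> x = \<zero>\<^bsub>D\<^esub>"
      by (cases x) (auto simp: cstar_sum_simps A.l_neg B.l_neg intro!: bexI[of _ "(\<ominus>\<^bsub>A\<^esub> fst x, \<ominus>\<^bsub>B\<^esub> snd x)"])
  qed (auto simp: cstar_sum_simps A.a_assoc B.a_assoc intro: A.a_comm B.a_comm)
  show "Group.monoid D"
    by (rule monoidI) (auto simp: cstar_sum_simps A.m_assoc B.m_assoc)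
qed (auto simp: cstar_sum_simps A.l_distr B.l_distr A.r_distr B.r_distr)

lemma diff_sum:
  assumes "a \<in> carrier A" "b \<in> carrier B" "a' \<in> carrier A" "b' \<in> carrier B"
  shows "(a, b) \<ominus>\<^bsub>D\<^esub> (a', b') = (a \<ominus>\<^bsub>A\<^esub> a', b \<ominus>\<^bsub>B\<^esub> b')"
proof -
  interpret D: ring D by (rule ring_sum)
  have "\<ominus>\<^bsub>D\<^esub> (a', b') = (\<ominus>\<^bsub>A\<^esub> a', \<ominus>\<^bsub>B\<^esub> b')"
    using assms by (intro D.minus_equality) (auto simp: cstar_sum_simps A.l_neg B.l_neg)
  then show ?thesis
    by (simp add: D.minus_eq A.minus_eq B.minus_eq cstar_sum_simps)
qed

lemma complete_sum: "Metric_space.mcomplete (carrier D) (norm_dist D (cnorm D))"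
proof -
  interpret D: ring D by (rule ring_sum)
  have M: "Metric_space (carrier D) (norm_dist D (cnorm D))"
  proof
    fix x y z :: "'a \<times> 'b"
    obtain a b a' b' a'' b'' where [simp]: "x = (a, b)" "y = (a', b')" "z = (a'', b'')" by (metis surj_pair)
    show "0 \<le> norm_dist D (cnorm D) x y"
      by (auto simp: norm_dist_def cstar_sum_simps diff_sum le_max_iff_disj A.cnorm_nonneg)
    show "norm_dist D (cnorm D) x y = norm_dist D (cnorm D) y x"
      by (auto simp: norm_dist_def cstar_sum_simps diff_sum A.cnorm_diff_commute B.cnorm_diff_commute)
    show "x \<in> carrier D \<Longrightarrow> y \<in> carrier D \<Longrightarrow> norm_dist D (cnorm D) x y = 0 \<longleftrightarrow> x = y"
      using A.cnorm_nonneg[of "a \<ominus>\<^bsub>A\<^esub> a'"] B.cnorm_nonneg[of "b \<ominus>\<^bsub>B\<^esub> b'"]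
      by (auto simp: cstar_sum_simps diff_sum max_def A.cnorm_eq_zero B.cnorm_eq_zero
          A.diff_eq_zero_iff B.diff_eq_zero_iff split: if_splits)
    show "x \<in> carrier D \<Longrightarrow> y \<in> carrier D \<Longrightarrow> z \<in> carrier D \<Longrightarrow>
        norm_dist D (cnorm D) x z \<le> norm_dist D (cnorm D) x y + norm_dist D (cnorm D) y z"
      using A.cnorm_diff_triangle[of a a' a''] B.cnorm_diff_triangle[of b b' b'']
      by (auto simp: cstar_sum_simps diff_sum)
  qed
  show ?thesis
    unfolding mcomplete_norm_dist_iff[OF M]
  proof (intro allI impI)
    fix s :: "nat \<Rightarrow> 'a \<times> 'b"
    assume s: "\<forall>n. s n \<in> carrier D"
      and cauchy: "\<forall>e>0. \<exists>M. \<forall>m\<ge>M. \<forall>n\<ge>M. cnorm D (s m \<ominus>\<^bsub>D\<^esub> s n) < e"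
    define a b where "a n = fst (s n)" and "b n = snd (s n)" for n
    have ab: "s n = (a n, b n)" "a n \<in> carrier A" "b n \<in> carrier B" for n
      using s[rule_format, of n] by (auto simp: a_def b_def cstar_sum_simps)
    have cauchy': "\<forall>e>0. \<exists>M. \<forall>m\<ge>M. \<forall>n\<ge>M. cnorm A (a m \<ominus>\<^bsub>A\<^esub> a n) < e \<and> cnorm B (b m \<ominus>\<^bsub>B\<^esub> b n) < e"
      using cauchy ab by (simp add: diff_sum cstar_sum_simps)
    obtain x where x: "A.tends a x"
      by (rule A.cauchy_tends[of a]) (use ab cauchy' in meson)+
    obtain y where y: "B.tends b y"
      by (rule B.cauchy_tends[of b]) (use ab cauchy' in meson)+
    have xy: "x \<in> carrier A" "y \<in> carrier B" using x y by (auto simp: A.tends_def B.tends_def)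
    have lim: "(\<lambda>n. max (cnorm A (a n \<ominus>\<^bsub>A\<^esub> x)) (cnorm B (b n \<ominus>\<^bsub>B\<^esub> y))) \<longlonglongrightarrow> max 0 0"
      using x y by (intro tendsto_max) (auto simp: A.tends_def B.tends_def)
    show "\<exists>x\<in>carrier D. \<forall>e>0. \<exists>M. \<forall>n\<ge>M. cnorm D (s n \<ominus>\<^bsub>D\<^esub> x) < e"
    proof (intro bexI[of _ "(x, y)"] allI impI)
      fix e :: real assume "e > 0"
      then have "\<forall>\<^sub>F n in sequentially. max (cnorm A (a n \<ominus>\<^bsub>A\<^esub> x)) (cnorm B (b n \<ominus>\<^bsub>B\<^esub> y)) < e"
        using order_tendstoD(2)[OF lim, of e] by simp
      then show "\<exists>M. \<forall>n\<ge>M. cnorm D (s n \<ominus>\<^bsub>D\<^esub> (x, y)) < e"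
        using ab xy by (simp add: eventually_sequentially diff_sum cstar_sum_simps)
    qed (use xy in \<open>simp add: cstar_sum_simps\<close>)
  qed
qed

theorem unital_cstar_algebra_sum: "unital_cstar_algebra D"
proof (rule unital_cstar_algebra.intro)
  interpret D: ring D by (rule ring_sum)
  show "Module.module (ring_of_type_algebra :: complex ring) D"
    by (intro moduleI cring_from_type_algebra D.abelian_group_axioms)
      (auto simp: cstar_sum_simps A.smult_add_left B.smult_add_left A.smult_add_right B.smult_add_right
        A.smult_smult B.smult_smult)
next
  fix x assume "x \<in> carrier D"
  then obtain a b where [simp]: "x = (a, b)" "a \<in> carrier A" "b \<in> carrier B" by (auto simp: cstar_sum_simps)
  show "0 \<le> cnorm D x" by (simp add: cstar_sum_simps le_max_iff_disj A.cnorm_nonneg)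
  show "cnorm D x = 0 \<longleftrightarrow> x = \<zero>\<^bsub>D\<^esub>"
    using A.cnorm_nonneg[of a] B.cnorm_nonneg[of b]
    by (auto simp: cstar_sum_simps max_def A.cnorm_eq_zero B.cnorm_eq_zero split: if_splits)
  show "cnorm D (c \<odot>\<^bsub>D\<^esub> x) = cmod c * cnorm D x" for c
    by (simp add: cstar_sum_simps A.cnorm_smult B.cnorm_smult max_mult_distrib_left)
  show "cnorm D (star D x \<otimes>\<^bsub>D\<^esub> x) = (cnorm D x)\<^sup>2"
    using A.cnorm_nonneg[of a] B.cnorm_nonneg[of b]
    by (auto simp: cstar_sum_simps A.cstar_identity B.cstar_identity max_def power_mono dest: power2_le_imp_le)
next
  fix x y assume "x \<in> carrier D" "y \<in> carrier D"
  then obtain a b a' b' where [simp]: "x = (a, b)" "a \<in> carrier A" "b \<in> carrier B"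
    "y = (a', b')" "a' \<in> carrier A" "b' \<in> carrier B" by (auto simp: cstar_sum_simps)
  show "cnorm D (x \<oplus>\<^bsub>D\<^esub> y) \<le> cnorm D x + cnorm D y"
    using A.cnorm_add[of a a'] B.cnorm_add[of b b'] by (auto simp: cstar_sum_simps)
  have "cnorm A (a \<otimes>\<^bsub>A\<^esub> a') \<le> max (cnorm A a) (cnorm B b) * max (cnorm A a') (cnorm B b')"
    by (rule order_trans[OF A.cnorm_mult mult_mono]) (auto simp: A.cnorm_nonneg le_max_iff_disj)
  moreover have "cnorm B (b \<otimes>\<^bsub>B\<^esub> b') \<le> max (cnorm A a) (cnorm B b) * max (cnorm A a') (cnorm B b')"
    by (rule order_trans[OF B.cnorm_mult mult_mono]) (auto simp: A.cnorm_nonneg B.cnorm_nonneg le_max_iff_disj)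
  ultimately show "cnorm D (x \<otimes>\<^bsub>D\<^esub> y) \<le> cnorm D x * cnorm D y"
    by (simp add: cstar_sum_simps)
next
  show "Metric_space.mcomplete (carrier D) (norm_dist D (cnorm D))" by (rule complete_sum)
qed (auto simp: ring_sum cstar_sum_simps A.smult_mult_left B.smult_mult_left
    A.smult_mult_right B.smult_mult_right A.star_add B.star_add A.star_smult B.star_smult A.star_mult B.star_mult)

lemma cstar_positive_sum:
  "cstar_positive D (a, b) \<longleftrightarrow> cstar_positive A a \<and> cstar_positive B b"
  by (auto simp: cstar_positive_def cstar_sum_simps)

lemma ous_direct_sum_sa:
  assumes "order_unit_space (sa A)" "order_unit_space (sa B)"
  shows "ous_direct_sum (sa A) (sa B) (sa D)"
  using assms
  by (auto simp: ous_direct_sum_def ous_direct_sum_axioms_def sa_def cstar_sum_simps diff_sum cstar_positive_sum)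

lemma products_sum:
  assumes "a \<in> carrier A" "b \<in> carrier B" "a' \<in> carrier A" "b' \<in> carrier B"
  shows "jordan D (a, b) (a', b') = (jordan A a a', jordan B b b')"
    and "lie D (a, b) (a', b') = (lie A a a', lie B b b')"
  using assms by (simp_all add: jordan_def lie_def cstar_sum_simps diff_sum)

end

locale cstar_lip_retraction =
  A: ordered_cstar_algebra A + B: ordered_cstar_algebra B +
  lip_retraction "sa A" "sa B" j p S\<^sub>A S\<^sub>B \<epsilon>
  for A :: "'a cstar" and B :: "'b cstar" and j p S\<^sub>A S\<^sub>B \<epsilon> +
  fixes G\<^sub>A G\<^sub>B
  assumes leibniz_A: "leibniz_qcms G\<^sub>A A S\<^sub>A" and leibniz_B: "leibniz_qcms G\<^sub>B B S\<^sub>B"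
begin

sublocale cstar_pair A B ..

sublocale ous_direct_sum "sa A" "sa B" "sa D"
  by (rule ous_direct_sum_sa) unfold_locales

sublocale lip_retraction_sum "sa A" "sa B" j p S\<^sub>A S\<^sub>B \<epsilon> "sa D" ..

text \<open>
  The last summand takes care of \<open>\<parallel>v - j u\<parallel> / \<epsilon>\<close> for products \<open>u\<close> and \<open>v\<close> in the two coordinates: both have
  norm at most \<open>x y\<close>.
\<close>

definition sum_leibniz :: "real \<Rightarrow> real \<Rightarrow> real \<Rightarrow> real \<Rightarrow> real" where
  "sum_leibniz x y z w = G\<^sub>A x y z w + G\<^sub>B x y z w + 2 / \<epsilon> * (x * y)"

lemma leibniz_function_A: "leibniz_function G\<^sub>A" and leibniz_function_B: "leibniz_function G\<^sub>B"
  using leibniz_A leibniz_B by (auto simp: leibniz_qcms_def)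

lemma leibniz_function_sum: "leibniz_function sum_leibniz"
  unfolding leibniz_function_def
proof (intro conjI allI impI)
  fix x y z w :: real assume nn: "0 \<le> x" "0 \<le> y" "0 \<le> z" "0 \<le> w"
  show "0 \<le> sum_leibniz x y z w"
    using nn eps_pos leibniz_functionD(1)[OF leibniz_function_A nn] leibniz_functionD(1)[OF leibniz_function_B nn]
    by (simp add: sum_leibniz_def)
  fix x' y' z' w' assume le: "x \<le> x'" "y \<le> y'" "z \<le> z'" "w \<le> w'"
  have "x * y \<le> x' * y'" using nn le by (intro mult_mono) auto
  then have "2 / \<epsilon> * (x * y) \<le> 2 / \<epsilon> * (x' * y')" using eps_pos by (intro mult_left_mono) auto
  then show "sum_leibniz x y z w \<le> sum_leibniz x' y' z' w'"
    unfolding sum_leibniz_def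
    by (intro add_mono leibniz_functionD(2)[OF leibniz_function_A nn le] leibniz_functionD(2)[OF leibniz_function_B nn le])
qed

lemma sum_lip_product_le:
  assumes u: "u \<in> carrier (sa A)" and v: "v \<in> carrier (sa B)"
    and nn: "0 \<le> x" "0 \<le> y" "0 \<le> z" "0 \<le> w"
    and Su: "S\<^sub>A u \<le> ennreal (G\<^sub>A x y z w)" and Sv: "S\<^sub>B v \<le> ennreal (G\<^sub>B x y z w)"
    and nu: "cnorm A u \<le> x * y" and nv: "cnorm B v \<le> x * y"
  shows "sum_lip (u, v) \<le> ennreal (sum_leibniz x y z w)"
proof -
  have G: "0 \<le> G\<^sub>A x y z w" "0 \<le> G\<^sub>B x y z w" "0 \<le> 2 / \<epsilon> * (x * y)"
    using leibniz_functionD(1)[OF leibniz_function_A nn] leibniz_functionD(1)[OF leibniz_function_B nn] nn eps_pos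
    by auto
  have "norm_diff (sa B) v (j u) \<le> ou_norm (sa B) v + ou_norm (sa B) (j u)"
    using B.sa.ou_norm_add[of v "\<ominus>\<^bsub>sa B\<^esub> j u"] u v by (simp add: B.sa.minus_eq)
  also have "\<dots> \<le> x * y + x * y"
    using j.norm_le[OF u] nu nv u v by (simp add: A.ou_norm_sa B.ou_norm_sa)
  finally have "norm_diff (sa B) v (j u) / \<epsilon> \<le> 2 / \<epsilon> * (x * y)"
    using eps_pos by (simp add: divide_right_mono)
  then have "ennreal (norm_diff (sa B) v (j u) / \<epsilon>) \<le> ennreal (sum_leibniz x y z w)"
    using G by (intro ennreal_leI) (simp add: sum_leibniz_def)
  moreover have "S\<^sub>A u \<le> ennreal (sum_leibniz x y z w)" "S\<^sub>B v \<le> ennreal (sum_leibniz x y z w)"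
    using G by (auto intro!: order_trans[OF Su] order_trans[OF Sv] ennreal_leI simp: sum_leibniz_def)
  ultimately show ?thesis by (simp add: sum_lip_def)
qed

theorem leibniz_sum: "leibniz_qcms sum_leibniz D sum_lip"
  unfolding leibniz_qcms_iff
proof (intro conjI ballI impI leibniz_function_sum unital_cstar_algebra_sum quantum_metric_sum)
  fix s t and op :: "('a \<times> 'b) cstar \<Rightarrow> 'a \<times> 'b \<Rightarrow> 'a \<times> 'b \<Rightarrow> 'a \<times> 'b"
  assume s: "s \<in> carrier (sa D)" "sum_lip s < \<infinity>" and t: "t \<in> carrier (sa D)" "sum_lip t < \<infinity>"
    and op: "op \<in> {jordan, lie}"
  obtain a b a' b' where [simp]: "s = (a, b)" "t = (a', b')" by (metis surj_pair)
  have c: "a \<in> carrier (sa A)" "b \<in> carrier (sa B)" "a' \<in> carrier (sa A)" "b' \<in> carrier (sa B)"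
    using s t by (auto simp: carrier_sum)
  then have c': "a \<in> carrier A" "b \<in> carrier B" "a' \<in> carrier A" "b' \<in> carrier B"
    by (auto simp: sa_simps)
  have fin: "S\<^sub>A a < \<infinity>" "S\<^sub>B b < \<infinity>" "S\<^sub>A a' < \<infinity>" "S\<^sub>B b' < \<infinity>"
    using s t by (auto simp: sum_lip_def)
  define x y z w where "x = cnorm D s" and "y = cnorm D t"
    and "z = enn2real (sum_lip s)" and "w = enn2real (sum_lip t)"
  have n: "cnorm A a \<le> x" "cnorm B b \<le> x" "cnorm A a' \<le> y" "cnorm B b' \<le> y"
    by (auto simp: x_def y_def cstar_sum_simps)
  have l: "enn2real (S\<^sub>A a) \<le> z" "enn2real (S\<^sub>B b) \<le> z" "enn2real (S\<^sub>A a') \<le> w" "enn2real (S\<^sub>B b') \<le> w"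
    unfolding z_def w_def using s t by (auto intro!: enn2real_mono simp: sum_lip_def le_max_iff_disj)
  have nn0: "0 \<le> cnorm A a" "0 \<le> cnorm B b" "0 \<le> cnorm A a'" "0 \<le> cnorm B b'"
    using c' A.cnorm_nonneg B.cnorm_nonneg by auto
  have nn: "0 \<le> x" "0 \<le> y" "0 \<le> z" "0 \<le> w" using n nn0 by (auto simp: z_def w_def)
  have prod: "cnorm A a * cnorm A a' \<le> x * y" "cnorm B b * cnorm B b' \<le> x * y"
    using n nn0 nn by (auto intro!: mult_mono)
  have pA: "S\<^sub>A (op' A a a') \<le> ennreal (G\<^sub>A x y z w)" "cnorm A (op' A a a') \<le> x * y" "op' A a a' \<in> carrier (sa A)"
    if "op' \<in> {jordan, lie}" for op'
    using leibniz_qcmsD[OF leibniz_A that c(1,3) fin(1,3) n(1,3) l(1,3)] A.sa_products[OF that c(1,3)] prod by auto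
  have pB: "S\<^sub>B (op' B b b') \<le> ennreal (G\<^sub>B x y z w)" "cnorm B (op' B b b') \<le> x * y" "op' B b b' \<in> carrier (sa B)"
    if "op' \<in> {jordan, lie}" for op'
    using leibniz_qcmsD[OF leibniz_B that c(2,4) fin(2,4) n(2,4) l(2,4)] B.sa_products[OF that c(2,4)] prod by auto
  have "sum_lip (jordan D s t) \<le> ennreal (sum_leibniz x y z w)"
    using pA[of jordan] pB[of jordan] c' nn by (simp add: products_sum sum_lip_product_le)
  moreover have "sum_lip (lie D s t) \<le> ennreal (sum_leibniz x y z w)"
    using pA[of lie] pB[of lie] c' nn by (simp add: products_sum sum_lip_product_le)
  ultimately show "sum_lip (op D s t) \<le> ennreal (sum_leibniz (cnorm D s) (cnorm D t) (enn2real (sum_lip s)) (enn2real (sum_lip t)))"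
    using op unfolding x_def y_def z_def w_def by auto
qed

lemma star_hom_fst: "unital_star_hom D A fst"
  by (auto simp: unital_star_hom_def ring_hom_def cstar_sum_simps)

lemma star_hom_snd: "unital_star_hom D B snd"
  by (auto simp: unital_star_hom_def ring_hom_def cstar_sum_simps)

theorem is_tunnel_sum: "is_tunnel sum_leibniz A S\<^sub>A B S\<^sub>B D sum_lip fst snd"
  unfolding is_tunnel_def
proof (intro conjI ballI leibniz_sum star_hom_fst star_hom_snd)
  show "fst ` carrier D = carrier A" "snd ` carrier D = carrier B"
    using A.zero_closed B.zero_closed by (auto simp: cstar_sum_simps image_iff)
  fix a assume a: "a \<in> carrier (sa A)"
  then have "{d \<in> carrier (sa D). fst d = a} = Pair a ` carrier (sa B)" by (auto simp: carrier_sum)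
  then show "S\<^sub>A a = (INF d\<in>{d \<in> carrier (sa D). fst d = a}. sum_lip d)"
    using sum_lip_quotient_left[OF a] by (simp add: image_image)
next
  fix b assume b: "b \<in> carrier (sa B)"
  then have "{d \<in> carrier (sa D). snd d = b} = (\<lambda>a. (a, b)) ` carrier (sa A)" by (auto simp: carrier_sum)
  then show "S\<^sub>B b = (INF d\<in>{d \<in> carrier (sa D). snd d = b}. sum_lip d)"
    using sum_lip_quotient_right[OF b] by (simp add: image_image)
qed

theorem propinquity_le: "propinquity A S\<^sub>A B S\<^sub>B \<le> ennreal \<epsilon>"
proof -
  have "propinquity A S\<^sub>A B S\<^sub>B \<le> extent A B D sum_lip fst snd"
    unfolding propinquity_def using is_tunnel_sum by (intro Inf_lower) blast
  also have "\<dots> \<le> ennreal \<epsilon>"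
    unfolding extent_def using haus_left haus_right by simp
  finally show ?thesis .
qed

end

section \<open>The inductive sequence\<close>

text \<open>
  The hypotheses of the theorem, with every index \<open>n \<ge> 1\<close> written as a successor.
\<close>

locale lip_inductive_sequence =
  fixes A :: "nat \<Rightarrow> 'a cstar"
    and \<alpha> :: "nat \<Rightarrow> 'a \<Rightarrow> 'a"
    and F :: "nat \<Rightarrow> real \<Rightarrow> real \<Rightarrow> real \<Rightarrow> real \<Rightarrow> real"
    and L :: "nat \<Rightarrow> 'a \<Rightarrow> ennreal"
    and E :: "nat \<Rightarrow> 'a \<Rightarrow> 'a"
    and c d :: "nat \<Rightarrow> real"
  assumes hom: "unital_star_hom (A n) (A (Suc n)) (\<alpha> n)"
    and inj: "inj_on (\<alpha> n) (carrier (A n))"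
    and lip: "leibniz_qcms (F n) (A n) (L n)"
    and expectation: "conditional_expectation (A (Suc n)) (\<alpha> n ` carrier (A n)) (E (Suc n))"
    and lip_expectation: "a \<in> carrier (sa (A (Suc n))) \<Longrightarrow> L (Suc n) (E (Suc n) a) \<le> L (Suc n) a"
    and c_pos: "c (Suc n) > 0"
    and d_pos: "d (Suc n) > 0"
    and lip_lower: "a \<in> carrier (sa (A n)) \<Longrightarrow> ennreal (c (Suc n)) * L n a \<le> L (Suc n) (\<alpha> n a)"
    and lip_upper: "a \<in> carrier (sa (A n)) \<Longrightarrow> L (Suc n) (\<alpha> n a) \<le> ennreal (d (Suc n)) * L n a"
begin

abbreviation "S \<equiv> ind_lip A \<alpha> L E d"

lemma quantum_metric_L: "quantum_metric_ous (sa (A n)) (L n)"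
  using lip by (simp add: leibniz_qcms_def)

lemma ordered_cstar: "ordered_cstar_algebra (A n)"
  using lip[of n] by (simp add: ordered_cstar_algebra_def leibniz_qcms_def quantum_metric_ous_def)

sublocale A: ordered_cstar_algebra "A n" for n
  by (rule ordered_cstar)

sublocale X: cstar_expectation "A n" "A (Suc n)" "\<alpha> n" "E (Suc n)" for n
  by (intro cstar_expectation.intro ordered_cstar_hom.intro ordered_cstar ordered_cstar_hom_axioms.intro
      cstar_expectation_axioms.intro hom inj expectation)

lemma S_Suc:
  assumes b: "b \<in> carrier (sa (A (Suc n)))"
  shows "S (Suc n) b = max (ennreal (varkappa d (Suc n)) * L (Suc n) b)
    (max (S n (X.retraction n b))
      (ennreal (ou_norm (sa (A (Suc n))) (b \<ominus>\<^bsub>sa (A (Suc n))\<^esub> \<alpha> n (X.retraction n b)) / (1 / 2 ^ Suc n))))"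
proof -
  have bc: "b \<in> carrier (A (Suc n))" using b by (simp add: sa_simps)
  have "b \<ominus>\<^bsub>sa (A (Suc n))\<^esub> \<alpha> n (X.retraction n b) = b \<ominus>\<^bsub>A (Suc n)\<^esub> E (Suc n) b"
    using b bc X.E_sa[OF b] by (simp add: X.hom_retraction A.sa_diff)
  moreover have "b \<ominus>\<^bsub>A (Suc n)\<^esub> E (Suc n) b \<in> carrier (sa (A (Suc n)))"
    using b bc X.E_sa[OF b] by (simp add: sa_simps A.star_diff)
  ultimately show ?thesis
    by (simp add: A.ou_norm_sa X.retraction_def mult.commute)
qed

declare ind_lip.simps(2) [simp del]

lemma varkappa_pos: "varkappa d n > 0"
proof -
  have "d j > 0" if "j \<in> {1..n}" for j
    using d_pos[of "j - 1"] that by simp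
  then show ?thesis unfolding varkappa_def by (intro prod_pos) simp
qed

lemma varkappa_Suc: "varkappa d (Suc n) * d (Suc n) = varkappa d n"
  using d_pos[of n] by (simp add: varkappa_def)

lemma retraction_sa: "b \<in> carrier (sa (A (Suc n))) \<Longrightarrow> X.retraction n b \<in> carrier (sa (A n))"
  using ou_morphism.closed[OF X.ou_morphism_retraction] .

lemma lip_retraction_le:
  assumes b: "b \<in> carrier (sa (A (Suc n)))"
  shows "ennreal (c (Suc n)) * L n (X.retraction n b) \<le> L (Suc n) b"
proof -
  have "b \<in> carrier (A (Suc n))" using b by (simp add: sa_simps)
  then show ?thesis
    using lip_lower[OF retraction_sa[OF b]] lip_expectation[OF b] by (simp add: X.hom_retraction)
qed

text \<open>
  The invariant of the recursion.  The lower bound cancels the Lipschitz constant of the next \<open>\<alpha> n\<close>; the upper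
  bound shows that \<open>S n\<close> and \<open>L n\<close> have the same domain, and the norm in it accounts for the term
  \<open>\<parallel>b - E b\<parallel>\<close>.
\<close>

definition controlled :: "nat \<Rightarrow> bool" where
  "controlled n \<longleftrightarrow> quantum_metric_ous (sa (A n)) (S n) \<and>
     (\<forall>a\<in>carrier (sa (A n)). ennreal (varkappa d n) * L n a \<le> S n a) \<and>
     (\<exists>K\<ge>0. \<forall>a\<in>carrier (sa (A n)). S n a \<le> ennreal K * (L n a + ennreal (cnorm (A n) a)))"

lemma lip_extension_step:
  assumes "controlled n"
  shows "lip_extension (sa (A n)) (sa (A (Suc n))) (\<alpha> n) (X.retraction n) (S n) (L (Suc n)) (S (Suc n))
    (varkappa d (Suc n)) (1 / 2 ^ Suc n)"
proof (intro lip_extension.intro lip_extension_axioms.intro X.ou_morphism_hom X.ou_morphism_retraction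
    quantum_metric_L varkappa_pos S_Suc)
  show "quantum_metric_ous (sa (A n)) (S n)" using assms by (simp add: controlled_def)
  show "X.retraction n (\<alpha> n a) = a" if "a \<in> carrier (sa (A n))" for a
    using that by (simp add: sa_simps X.retraction_hom)
  show "ennreal (varkappa d (Suc n)) * L (Suc n) (\<alpha> n a) \<le> S n a" if a: "a \<in> carrier (sa (A n))" for a
  proof -
    have "ennreal (varkappa d (Suc n)) * L (Suc n) (\<alpha> n a) \<le>
        ennreal (varkappa d (Suc n)) * (ennreal (d (Suc n)) * L n a)"
      by (intro mult_left_mono lip_upper a) auto
    also have "\<dots> = ennreal (varkappa d (Suc n) * d (Suc n)) * L n a"
      using d_pos[of n] varkappa_pos[of "Suc n"] by (simp add: ennreal_mult mult.assoc)
    also have "\<dots> \<le> S n a"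
      unfolding varkappa_Suc using assms a by (simp add: controlled_def)
    finally show ?thesis .
  qed
  fix b assume b: "b \<in> carrier (sa (A (Suc n)))" "L (Suc n) b < \<infinity>"
  obtain K where K: "\<forall>a\<in>carrier (sa (A n)). S n a \<le> ennreal K * (L n a + ennreal (cnorm (A n) a))"
    using assms by (auto simp: controlled_def)
  have "ennreal (c (Suc n)) * L n (X.retraction n b) < \<infinity>"
    using lip_retraction_le[OF b(1)] b(2) by (rule le_less_trans)
  then have "L n (X.retraction n b) < \<infinity>"
    using c_pos[of n] by (auto simp: ennreal_mult_less_top ennreal_eq_0_iff)
  then have "ennreal K * (L n (X.retraction n b) + ennreal (cnorm (A n) (X.retraction n b))) < \<infinity>"
    by (simp add: ennreal_mult_less_top)
  with K retraction_sa[OF b(1)] show "S n (X.retraction n b) < \<infinity>" by (meson le_less_trans)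
qed simp

lemma controlled: "controlled n"
proof (induction n)
  case 0
  have "\<exists>K\<ge>0. \<forall>a\<in>carrier (sa (A 0)). L 0 a \<le> ennreal K * (L 0 a + ennreal (cnorm (A 0) a))"
    by (intro exI[of _ 1]) auto
  then show ?case using quantum_metric_L[of 0] by (simp add: controlled_def varkappa_def)
next
  case (Suc n)
  interpret lip_extension "sa (A n)" "sa (A (Suc n))" "\<alpha> n" "X.retraction n" "S n" "L (Suc n)" "S (Suc n)"
    "varkappa d (Suc n)" "1 / 2 ^ Suc n"
    by (rule lip_extension_step[OF Suc])
  obtain K where K: "K \<ge> 0" "\<forall>a\<in>carrier (sa (A n)). S n a \<le> ennreal K * (L n a + ennreal (cnorm (A n) a))"
    using Suc by (auto simp: controlled_def)
  \<comment> \<open>one summand for each term of the maximum; the second term needs the two summands with \<open>K\<close>\<close>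
  define M where "M = varkappa d (Suc n) + K / c (Suc n) + K + 2 * 2 ^ Suc n"
  have cp: "c (Suc n) > 0" by (rule c_pos)
  have parts: "0 \<le> K / c (Suc n)" "0 \<le> varkappa d (Suc n)"
    using K(1) cp varkappa_pos[of "Suc n"] by auto
  have "S (Suc n) b \<le> ennreal M * (L (Suc n) b + ennreal (cnorm (A (Suc n)) b))"
    if b: "b \<in> carrier (sa (A (Suc n)))" for b
  proof (cases "L (Suc n) b = \<infinity>")
    case True
    have "M > 0" using parts K(1) by (simp add: M_def add_nonneg_pos)
    then show ?thesis using True by (simp add: ennreal_mult_eq_top_iff ennreal_eq_0_iff)
  next
    case False
    define l where "l = enn2real (L (Suc n) b)"
    have l: "L (Suc n) b = ennreal l" "l \<ge> 0" using False by (auto simp: l_def less_top)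
    define N where "N = cnorm (A (Suc n)) b"
    have bc: "b \<in> carrier (A (Suc n))" using b by (simp add: sa_simps)
    have N: "N \<ge> 0" using A.cnorm_nonneg[OF bc] by (simp add: N_def)
    have Mbound: "k * l + k' * N \<le> M * (l + N)" if "k \<le> M" "k' \<le> M" for k k'
      using mult_right_mono[OF that(1) l(2)] mult_right_mono[OF that(2) N] by (simp add: distrib_left)
    let ?p = "X.retraction n b"
    have p: "?p \<in> carrier (sa (A n))" by (rule retraction_sa[OF b])
    have pN: "cnorm (A n) ?p \<le> N"
      using ou_morphism.norm_le[OF X.ou_morphism_retraction b] p b by (simp add: A.ou_norm_sa N_def)
    have "L n ?p = ennreal (1 / c (Suc n)) * (ennreal (c (Suc n)) * L n ?p)"
      using cp by (simp add: mult.assoc[symmetric] flip: ennreal_mult')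
    also have "\<dots> \<le> ennreal (1 / c (Suc n)) * ennreal l"
      using lip_retraction_le[OF b] by (intro mult_left_mono) (auto simp: l)
    finally have Lp: "L n ?p \<le> ennreal (l / c (Suc n))"
      using cp by (simp flip: ennreal_mult')
    have "ennreal (varkappa d (Suc n)) * L (Suc n) b \<le> ennreal (M * (l + N))"
      using Mbound[of "varkappa d (Suc n)" 0] parts K(1) l
      by (auto simp: M_def simp flip: ennreal_mult' intro!: ennreal_leI)
    moreover have "S n ?p \<le> ennreal (M * (l + N))"
    proof -
      have "S n ?p \<le> ennreal K * (L n ?p + ennreal (cnorm (A n) ?p))" using K(2) p by blast
      also have "\<dots> \<le> ennreal K * (ennreal (l / c (Suc n)) + ennreal N)"
        using Lp pN by (intro mult_left_mono add_mono ennreal_leI) auto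
      also have "\<dots> = ennreal (K / c (Suc n) * l + K * N)"
        using K(1) cp l N by (simp add: distrib_left flip: ennreal_plus ennreal_mult')
      also have "\<dots> \<le> ennreal (M * (l + N))"
        using parts K(1) by (intro ennreal_leI Mbound) (auto simp: M_def)
      finally show ?thesis .
    qed
    moreover have "ennreal (ou_norm (sa (A (Suc n))) (b \<ominus>\<^bsub>sa (A (Suc n))\<^esub> \<alpha> n ?p) / (1 / 2 ^ Suc n)) \<le> ennreal (M * (l + N))"
    proof (rule ennreal_leI)
      have "ou_norm (sa (A (Suc n))) (b \<ominus>\<^bsub>sa (A (Suc n))\<^esub> \<alpha> n ?p) \<le>
          ou_norm (sa (A (Suc n))) b + ou_norm (sa (A (Suc n))) (\<alpha> n ?p)"
        using A.sa.ou_norm_add[OF b, of "\<ominus>\<^bsub>sa (A (Suc n))\<^esub> \<alpha> n ?p"] p by (simp add: A.sa.minus_eq)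
      also have "\<dots> \<le> N + N"
        using j.norm_le[OF p] pN b p by (simp add: A.ou_norm_sa N_def)
      finally have "ou_norm (sa (A (Suc n))) (b \<ominus>\<^bsub>sa (A (Suc n))\<^esub> \<alpha> n ?p) / (1 / 2 ^ Suc n) \<le> 0 * l + (2 * 2 ^ Suc n) * N"
        by (simp add: field_simps)
      also have "\<dots> \<le> M * (l + N)"
        using parts K(1) by (intro Mbound) (auto simp: M_def)
      finally show "ou_norm (sa (A (Suc n))) (b \<ominus>\<^bsub>sa (A (Suc n))\<^esub> \<alpha> n ?p) / (1 / 2 ^ Suc n) \<le> M * (l + N)" .
    qed
    ultimately have "S (Suc n) b \<le> ennreal (M * (l + N))"
      unfolding S_Suc[OF b] by (intro max.boundedI)
    also have "\<dots> = ennreal M * (L (Suc n) b + ennreal (cnorm (A (Suc n)) b))"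
      using l N parts K(1) by (simp add: N_def ennreal_mult' M_def)
    finally show ?thesis .
  qed
  moreover have "M \<ge> 0" using parts K(1) by (simp add: M_def)
  moreover have "ennreal (varkappa d (Suc n)) * L (Suc n) b \<le> S (Suc n) b"
    if "b \<in> carrier (sa (A (Suc n)))" for b
    unfolding S_Suc[OF that] by (rule max.cobounded1)
  ultimately show ?case
    using quantum_metric_extension unfolding controlled_def by blast
qed

lemma lip_retraction_step:
  "lip_retraction (sa (A n)) (sa (A (Suc n))) (\<alpha> n) (X.retraction n) (S n) (S (Suc n)) (1 / 2 ^ Suc n)"
  by (rule lip_extension.lip_retraction_extension[OF lip_extension_step[OF controlled]])

theorem leibniz_S: "\<exists>G. leibniz_qcms G (A n) (S n)"
proof -
  obtain K where "K \<ge> 0" "\<forall>a\<in>carrier (sa (A n)). S n a \<le> ennreal K * (L n a + ennreal (cnorm (A n) a))"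
    using controlled[of n] by (auto simp: controlled_def)
  then have "leibniz_qcms (\<lambda>x y z w. K * (F n x y (z / varkappa d n) (w / varkappa d n) + x * y)) (A n) (S n)"
    using controlled[of n] by (intro leibniz_dominated[OF lip] varkappa_pos) (auto simp: controlled_def)
  then show ?thesis by blast
qed

theorem propinquity_S_le: "propinquity (A n) (S n) (A (Suc n)) (S (Suc n)) \<le> ennreal (1 / 2 ^ Suc n)"
proof -
  obtain G where G: "leibniz_qcms G (A n) (S n)" using leibniz_S[of n] by (rule exE)
  obtain G' where G': "leibniz_qcms G' (A (Suc n)) (S (Suc n))" using leibniz_S[of "Suc n"] by (rule exE)
  have "cstar_lip_retraction (A n) (A (Suc n)) (\<alpha> n) (X.retraction n) (S n) (S (Suc n)) (1 / 2 ^ Suc n) G G'"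
    by (intro cstar_lip_retraction.intro cstar_lip_retraction_axioms.intro G G')
      (rule ordered_cstar lip_retraction_step)+
  then show ?thesis by (rule cstar_lip_retraction.propinquity_le)
qed

lemma lip_tower_S: "lip_tower (\<lambda>n. sa (A n)) \<alpha> X.retraction S"
  by (rule lip_tower.intro) (rule lip_retraction_step)

theorem limit_S: "\<exists>(Q :: (nat \<Rightarrow> 'a) ous) L\<^sub>Q. quantum_metric_ous Q L\<^sub>Q \<and>
    (\<lambda>n. dist_q (sa (A n)) (S n) Q L\<^sub>Q) \<longlonglongrightarrow> 0"
  by (intro exI conjI) (rule lip_tower.quantum_metric_limit[OF lip_tower_S] lip_tower.dist_q_limit[OF lip_tower_S])+

end

theorem theorem2p7:
  fixes A :: "nat \<Rightarrow> 'a cstar"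
    and \<alpha> :: "nat \<Rightarrow> 'a \<Rightarrow> 'a"
    and F :: "nat \<Rightarrow> real \<Rightarrow> real \<Rightarrow> real \<Rightarrow> real \<Rightarrow> real"
    and L :: "nat \<Rightarrow> 'a \<Rightarrow> ennreal"
    and E :: "nat \<Rightarrow> 'a \<Rightarrow> 'a"
    and c d :: "nat \<Rightarrow> real"
  assumes cstar: "\<And>n. unital_cstar_algebra (A n)"
    and hom: "\<And>n. unital_star_hom (A n) (A (Suc n)) (\<alpha> n)"
    and mono: "\<And>n. inj_on (\<alpha> n) (carrier (A n))"
    and lip: "\<And>n. leibniz_qcms (F n) (A n) (L n)"
    and expectation: "\<And>n. n \<ge> 1 \<Longrightarrow>
           conditional_expectation (A n) (\<alpha> (n - 1) ` carrier (A (n - 1))) (E n)"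
    and lip_expectation: "\<And>n a. n \<ge> 1 \<Longrightarrow> a \<in> carrier (sa (A n)) \<Longrightarrow> L n (E n a) \<le> L n a"
    and c_pos: "\<And>n. n \<ge> 1 \<Longrightarrow> c n > 0"
    and d_pos: "\<And>n. n \<ge> 1 \<Longrightarrow> d n > 0"
    and lip_lower: "\<And>n a. n \<ge> 1 \<Longrightarrow> a \<in> carrier (sa (A (n - 1))) \<Longrightarrow>
           ennreal (c n) * L (n - 1) a \<le> L n (\<alpha> (n - 1) a)"
    and lip_upper: "\<And>n a. n \<ge> 1 \<Longrightarrow> a \<in> carrier (sa (A (n - 1))) \<Longrightarrow>
           L n (\<alpha> (n - 1) a) \<le> ennreal (d n) * L (n - 1) a"
  defines "S \<equiv> ind_lip A \<alpha> L E d"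
  shows "(\<forall>n. \<exists>G. leibniz_qcms G (A n) (S n)) \<and>
    (\<forall>n. propinquity (A n) (S n) (A (Suc n)) (S (Suc n)) \<le> ennreal (1 / 2 ^ (n + 1))) \<and>
    (\<exists>(Q :: (nat \<Rightarrow> 'a) ous) L\<^sub>Q. quantum_metric_ous Q L\<^sub>Q \<and>
       (\<lambda>n. dist_q (sa (A n)) (S n) Q L\<^sub>Q) \<longlonglongrightarrow> 0)"
proof -
  have seq: "lip_inductive_sequence A \<alpha> F L E c d"
  proof (rule lip_inductive_sequence.intro)
    fix n a
    show "unital_star_hom (A n) (A (Suc n)) (\<alpha> n)" by (rule hom)
    show "inj_on (\<alpha> n) (carrier (A n))" by (rule mono)
    show "leibniz_qcms (F n) (A n) (L n)" by (rule lip)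
    show "conditional_expectation (A (Suc n)) (\<alpha> n ` carrier (A n)) (E (Suc n))"
      using expectation[of "Suc n"] by simp
    show "a \<in> carrier (sa (A (Suc n))) \<Longrightarrow> L (Suc n) (E (Suc n) a) \<le> L (Suc n) a"
      using lip_expectation[of "Suc n"] by simp
    show "c (Suc n) > 0" "d (Suc n) > 0" using c_pos d_pos by simp_all
    show "a \<in> carrier (sa (A n)) \<Longrightarrow> ennreal (c (Suc n)) * L n a \<le> L (Suc n) (\<alpha> n a)"
      using lip_lower[of "Suc n" a] by simp
    show "a \<in> carrier (sa (A n)) \<Longrightarrow> L (Suc n) (\<alpha> n a) \<le> ennreal (d (Suc n)) * L n a"
      using lip_upper[of "Suc n" a] by simp
  qed
  show ?thesis
    unfolding S_def
  proof (intro conjI allI)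
    show "\<exists>G. leibniz_qcms G (A n) (ind_lip A \<alpha> L E d n)" for n
      by (rule lip_inductive_sequence.leibniz_S[OF seq])
    show "propinquity (A n) (ind_lip A \<alpha> L E d n) (A (Suc n)) (ind_lip A \<alpha> L E d (Suc n)) \<le> ennreal (1 / 2 ^ (n + 1))" for n
      using lip_inductive_sequence.propinquity_S_le[OF seq, of n] by simp
    show "\<exists>(Q :: (nat \<Rightarrow> 'a) ous) L\<^sub>Q. quantum_metric_ous Q L\<^sub>Q \<and>
       (\<lambda>n. dist_q (sa (A n)) (ind_lip A \<alpha> L E d n) Q L\<^sub>Q) \<longlonglongrightarrow> 0"
      by (rule lip_inductive_sequence.limit_S[OF seq])
  qed
qed

end
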